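(* For $N>1$ consider the initial data on $\mathbb T^3$ $$u_{\rm in}(x)=\Big(\cos x_2\,\frac{N}{N+\sin x_3},\ \cos x_1\,\frac{N+\sin x_3}{N},\ 0\Big),$$ which has favorable initial pressure gradient in the sense that $\partial_1u^1_{\rm in}+\partial_2u^2_{\rm in}=0$ and $\partial_3P_{\rm in}=0$, where $P_{\rm in}$ is defined by $-\Delta P_{\rm in}=\sum_{i,j\in\{1,2\}}\partial_iu^j_{\rm in}\,\partial_ju^i_{\rm in}$. Then there exist a positive constant $N_0$ and absolute constants $C_1,C_2>0$ such that for any $N>N_0$ the initial data $u_{\rm in}$ generates a unique solution $u$ to the Navier-Stokes equations on $[0,1]\times\mathbb T^3$, and this solution satisfies $$C_1\frac{t^2}{N^2}\le\|u^3(t,\cdot)\|_{L^\infty(\mathbb T^3)}\le C_2\frac{t^2}{N^2}\qquad\text{for all } 0\le t\le\frac1{N^2}.$$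
   Context: $\mathbb T^3=(\mathbb R/2\pi\mathbb Z)^3$; $u^i$ denotes the $i$-th component of $u$; $P_{\rm in}$ is the periodic solution (unique up to an additive constant) of the stated Poisson equation. The Navier-Stokes equations (viscosity $1$) are $\partial_t u+u\cdot\nabla u+\nabla P=\Delta u$, $\operatorname{div}u=0$ on $\mathbb T^3$. A solution with initial data $u_{\rm in}$ is understood in the mild sense: $u\in L^\infty((0,1)\times\mathbb T^3)$ and $u(t)=e^{t\Delta}u_{\rm in}-\int_0^t e^{(t-\tau)\Delta}\mathcal P\operatorname{div}(u\otimes u)(\tau)\,d\tau$, where $\mathcal P$ is the Leray projection onto divergence-free vector fields. *)

theory Defs
  imports "HOL-Analysis.Analysis" "HOL-Probability.Essential_Supremum"
begin

(* Functions on the torus (R / 2 pi Z)^3 are represented by functions on R^3 that are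
   2 pi-periodic in each coordinate; integrals, null sets and L-infinity norms are taken over one
   fundamental cell. *)

definition periodic :: "(real^3 \<Rightarrow> 'a) \<Rightarrow> bool" where
  "periodic f \<longleftrightarrow> (\<forall>x i. f (x + axis i (2 * pi)) = f x)"

definition torus :: "(real^3) measure" where
  "torus = restrict_space lborel (cbox 0 (\<chi> i. 2 * pi))"

definition Linf_norm :: "'a measure \<Rightarrow> ('a \<Rightarrow> 'b::real_normed_vector) \<Rightarrow> ereal" where
  "Linf_norm M f = esssup M (\<lambda>x. ereal (norm (f x)))"

definition in_Linf :: "'a measure \<Rightarrow> ('a \<Rightarrow> 'b::real_normed_vector) \<Rightarrow> bool" where
  "in_Linf M f \<longleftrightarrow> f \<in> borel_measurable M \<and> Linf_norm M f < \<infinity>"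


definition partial :: "3 \<Rightarrow> (real^3 \<Rightarrow> real) \<Rightarrow> real^3 \<Rightarrow> real" where
  "partial i f x = deriv (\<lambda>h. f (x + h *\<^sub>R axis i 1)) 0"

definition twice_continuously_differentiable :: "(real^3 \<Rightarrow> real) \<Rightarrow> bool" where
  "twice_continuously_differentiable f \<longleftrightarrow> (\<forall>x. f differentiable (at x)) \<and>
     (\<forall>i x. partial i f differentiable (at x)) \<and>
     (\<forall>i j. continuous_on UNIV (partial j (partial i f)))"

(* The classical periodic solutions P of  - Laplace P = sum_{i,j in {1,2}} d_i v^j d_j v^i. *)
definition initial_pressure :: "(real^3 \<Rightarrow> real^3) \<Rightarrow> (real^3 \<Rightarrow> real) \<Rightarrow> bool" where
  "initial_pressure v P \<longleftrightarrow> periodic P \<and> twice_continuously_differentiable P \<and>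
     (\<forall>x. - (\<Sum>i\<in>UNIV. partial i (partial i P) x) =
        (\<Sum>i\<in>{1,2}. \<Sum>j\<in>{1,2}. partial i (\<lambda>y. v y $ j) x * partial j (\<lambda>y. v y $ i) x))"

definition favorable_initial_pressure_gradient :: "(real^3 \<Rightarrow> real^3) \<Rightarrow> bool" where
  "favorable_initial_pressure_gradient v \<longleftrightarrow>
     (\<forall>x. partial 1 (\<lambda>y. v y $ 1) x + partial 2 (\<lambda>y. v y $ 2) x = 0) \<and>
     (\<exists>P. initial_pressure v P) \<and>
     (\<forall>P. initial_pressure v P \<longrightarrow> (\<forall>x. partial 3 P x = 0))"


(* The operators exp(t Laplace), div and the Leray projection act as Fourier multipliers on
   families of Fourier coefficients indexed by Z^3. *)

definition fourier_mode :: "int^3 \<Rightarrow> real^3 \<Rightarrow> complex" where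
  "fourier_mode k x = exp (\<i> * complex_of_real (\<Sum>j\<in>UNIV. of_int (k $ j) * x $ j))"

definition fourier_coeff :: "(real^3 \<Rightarrow> real) \<Rightarrow> int^3 \<Rightarrow> complex" where
  "fourier_coeff f k =
     (1 / (2 * pi) ^ 3) *\<^sub>R (\<integral>x. complex_of_real (f x) * fourier_mode (- k) x \<partial>torus)"

definition fourier_vec :: "(real^3 \<Rightarrow> real^3) \<Rightarrow> int^3 \<Rightarrow> complex^3" where
  "fourier_vec v k = (\<chi> i. fourier_coeff (\<lambda>x. v x $ i) k)"

definition fourier_tensor :: "(real^3 \<Rightarrow> real^3^3) \<Rightarrow> int^3 \<Rightarrow> complex^3^3" where
  "fourier_tensor F k = (\<chi> i j. fourier_coeff (\<lambda>x. F x $ i $ j) k)"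

definition fourier_series :: "(int^3 \<Rightarrow> complex^3) \<Rightarrow> real^3 \<Rightarrow> complex^3" where
  "fourier_series a x = (\<Sum>\<^sub>\<infinity>k. fourier_mode k x *s a k)"

definition freq_norm_sq :: "int^3 \<Rightarrow> real" where
  "freq_norm_sq k = (\<Sum>j\<in>UNIV. (of_int (k $ j))\<^sup>2)"

definition heat :: "real \<Rightarrow> (int^3 \<Rightarrow> complex^3) \<Rightarrow> int^3 \<Rightarrow> complex^3" where
  "heat t a k = exp (- t * freq_norm_sq k) *\<^sub>R a k"

(* For k = 0 the convention z / 0 = 0 makes this the identity on the mean, as it should be. *)
definition leray :: "(int^3 \<Rightarrow> complex^3) \<Rightarrow> int^3 \<Rightarrow> complex^3" where
  "leray a k = (\<chi> i. a k $ i -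
     of_int (k $ i) * (\<Sum>j\<in>UNIV. of_int (k $ j) * a k $ j) / complex_of_real (freq_norm_sq k))"

definition div_tensor :: "(int^3 \<Rightarrow> complex^3^3) \<Rightarrow> int^3 \<Rightarrow> complex^3" where
  "div_tensor A k = (\<chi> i. \<Sum>j\<in>UNIV. \<i> * of_int (k $ j) * A k $ i $ j)"

definition tensor :: "(real^3 \<Rightarrow> real^3) \<Rightarrow> (real^3 \<Rightarrow> real^3) \<Rightarrow> real^3 \<Rightarrow> real^3^3" where
  "tensor v w x = (\<chi> i j. v x $ i * w x $ j)"

definition complex_vec :: "real^3 \<Rightarrow> complex^3" where
  "complex_vec v = (\<chi> i. complex_of_real (v $ i))"

(* Mild solutions on [0,T] x torus. Each u(t) is meant as an element of L-infinity of the torus,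
   so the Duhamel formula is an identity for every t and almost every x. At t = 0 it reads
   u(0) = u0; this is stated separately because the Fourier series of a merely bounded u0 need not
   converge unconditionally. For t > 0 all series involved converge absolutely, and for u in
   L-infinity the time integrand is O((t - s)^(-1/2)). *)
definition mild_solution ::
    "real \<Rightarrow> (real^3 \<Rightarrow> real^3) \<Rightarrow> (real \<Rightarrow> real^3 \<Rightarrow> real^3) \<Rightarrow> bool" where
  "mild_solution T u0 u \<longleftrightarrow>
     (\<forall>t\<in>{0..T}. periodic (u t)) \<and>
     in_Linf (restrict_space lborel {0<..<T} \<Otimes>\<^sub>M torus) (\<lambda>(t, x). u t x) \<and>
     (AE x in torus. u 0 x = u0 x) \<and>
     (\<forall>t\<in>{0<..T}. AE x in torus.
        complex_vec (u t x) =
          fourier_series (heat t (fourier_vec u0)) x -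
          (\<integral>s\<in>{0..t}. fourier_series
             (heat (t - s) (leray (div_tensor (fourier_tensor (tensor (u s) (u s)))))) x \<partial>lborel))"


definition u_in :: "real \<Rightarrow> real^3 \<Rightarrow> real^3" where
  "u_in N x = vector [cos (x $ 2) * (N / (N + sin (x $ 3))),
                      cos (x $ 1) * ((N + sin (x $ 3)) / N),
                      0]"

end

(* With V = (cos x_2, cos x_1, 0), the field e^{-t} V is an exact solution and u_in = V + O(1/N). Let v be the
   heat flow of u_in and write u = v + d. Since the two factors of u_in depending on x_3 are inverse to each
   other, P div (v (x) v)(s) vanishes at s = 0 and is O(s / N^2). Hence d solves a fixed point equation with
   forcing O(t^2 / N^2), by contraction in the space of Fourier coefficients bounded by
   t^2 e^{lam t} (1 + |k|^2)^{-4} with lam large; this yields existence on [0,1] and the upper bound, as v^3 = 0.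
   Moreover d differs from its explicit forcing term by O(t^{5/2} / N^2), which for t <= 1 / N^2 is
   smaller by a factor 1 / N than the Fourier coefficient of the forcing at k = (1, 1, 2); this gives the lower bound.
   Uniqueness among bounded mild solutions: by Parseval and Bessel, the squared L^2 norm of the difference
   satisfies a Volterra inequality with kernel (t - s)^{-1/2}. *)

theory Submission
  imports Defs "HOL-Real_Asymp.Real_Asymp"
begin

text \<open>The weight (1 + |k|^2)^{-4} is stable under convolution and stays summable after the one
  derivative in the divergence, so every series for the constructed solution converges absolutely. A
  competing mild solution is merely bounded; the coefficients of its products are only known to be
  square summable. Uniqueness is therefore carried out in L^2, where exp(t Laplace) P div costs
  t^{-1/2}.

  Why the frequency (1, 1, 2): the product of the two components of the heat flow has frequencies
  (\<plusminus>1, \<plusminus>1, n). For n = 0 its divergence is a gradient, removed by the Leray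
  projection. For n = \<plusminus>1 the leading exponentials in time coincide, because 1^2 = 1 +
  0^2, and only O(s / N^3) is left. The smallest |n| with a contribution of exact order s / N^2 is
  2.

  Why t^{5/2}: the interaction of d with the flow contains a derivative, which the heat semigroup
  returns as a factor t^{1/2} in front of d = O(t^2 / N^2). For t \<le> 1 / N^2 this factor is at
  most 1 / N, so N only has to beat absolute constants.\<close>

section \<open>The initial pressure\<close>

text \<open>If \<open>D\<close> were positive, \<open>f'\<close>, which vanishes at the maximum,
  would be positive just to the right of 0, and the mean value theorem would give a value above
  \<open>f 0\<close>.\<close>

lemma second_derivative_nonpos_at_max:
  fixes f f' :: "real \<Rightarrow> real"
  assumes f': "\<And>t. (f has_real_derivative f' t) (at t)"
    and f'': "(f' has_real_derivative D) (at 0)"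
    and "0 < \<delta>" and max: "\<And>t. \<bar>t\<bar> < \<delta> \<Longrightarrow> f t \<le> f 0"
  shows "D \<le> 0"
proof (rule ccontr)
  assume "\<not> D \<le> 0"
  have "f' 0 = 0"
    using DERIV_local_max[OF f'[of 0] \<open>0 < \<delta>\<close>] max by simp
  moreover obtain d where "d > 0" and d: "\<And>h. 0 < h \<Longrightarrow> h < d \<Longrightarrow> f' 0 < f' (0 + h)"
    using DERIV_pos_inc_right[OF f''] \<open>\<not> D \<le> 0\<close> by auto
  ultimately have pos: "0 < f' h" if "0 < h" "h < d" for h
    using that d[of h] by simp
  define s where "s = min d \<delta> / 2"
  have s: "0 < s" "s < d" "s < \<delta>"
    using \<open>d > 0\<close> \<open>0 < \<delta>\<close> by (auto simp: s_def min_def)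
  obtain z where "0 < z" "z < s" "f s - f 0 = (s - 0) * f' z"
    using MVT2[OF s(1), of f f'] f' by blast
  then have "f s > f 0"
    using pos[of z] s by (metis diff_gt_0_iff_gt diff_zero less_trans mult_pos_pos)
  then show False
    using max[of s] s by auto
qed

lemma periodic_add:
  assumes "periodic f"
  shows "f (x + axis i (2 * pi * of_int n)) = f x"
proof -
  have nat: "f (x + axis i (2 * pi * of_nat m)) = f x" for m x
  proof (induction m arbitrary: x)
    case (Suc m)
    have "x + axis i (2 * pi * of_nat (Suc m)) = (x + axis i (2 * pi)) + axis i (2 * pi * of_nat m)"
      by (simp add: vec_eq_iff axis_def algebra_simps)
    then show ?case
      using Suc assms unfolding periodic_def by metis
  next
    case 0
    have "x + axis i (2 * pi * of_nat 0) = x"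
      by (simp add: vec_eq_iff axis_def)
    then show ?case
      by (simp only:)
  qed
  show ?thesis
  proof (cases "n \<ge> 0")
    case True
    then show ?thesis
      using nat[of x "nat n"] by simp
  next
    case False
    have E: "x + axis i (2 * pi * of_int n) + axis i (2 * pi * of_nat (nat (- n))) = x"
      using False by (simp add: vec_eq_iff axis_def)
    then show ?thesis
      using nat[of "x + axis i (2 * pi * of_int n)" "nat (- n)"] unfolding E by simp
  qed
qed

text \<open>One cell point \<open>y\<close> serves every periodic function and every displacement
  \<open>h\<close>, so a maximum attained on the compact cell is a maximum over the whole
  space.\<close>

lemma periodic_obtain_cell:
  fixes x :: "real^3"
  obtains y :: "real^3" where "y \<in> cbox 0 (\<chi> i. 2 * pi)"
    "\<And>(f :: real^3 \<Rightarrow> 'a) h. periodic f \<Longrightarrow> f (y + h) = f (x + h)"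
proof -
  define n where "n i = - \<lfloor>x $ i / (2 * pi)\<rfloor>" for i
  define y where "y = x + axis 1 (2 * pi * of_int (n 1)) + axis 2 (2 * pi * of_int (n 2))
    + axis 3 (2 * pi * of_int (n 3))"
  have y: "y $ i = x $ i + 2 * pi * of_int (n i)" for i
    using exhaust_3[of i] by (auto simp: y_def axis_def)
  have "0 \<le> y $ i \<and> y $ i \<le> 2 * pi" for i
  proof -
    have "of_int \<lfloor>x $ i / (2 * pi)\<rfloor> \<le> x $ i / (2 * pi)"
      "x $ i / (2 * pi) \<le> of_int \<lfloor>x $ i / (2 * pi)\<rfloor> + 1"
      by linarith+
    then have "of_int \<lfloor>x $ i / (2 * pi)\<rfloor> * (2 * pi) \<le> x $ i"
      "x $ i \<le> (of_int \<lfloor>x $ i / (2 * pi)\<rfloor> + 1) * (2 * pi)"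
      using pos_le_divide_eq[of "2 * pi" "of_int \<lfloor>x $ i / (2 * pi)\<rfloor>" "x $ i"]
        pos_divide_le_eq[of "2 * pi" "x $ i" "of_int \<lfloor>x $ i / (2 * pi)\<rfloor> + 1"] by auto
    then show ?thesis
      unfolding y n_def by (simp add: algebra_simps)
  qed
  then have "y \<in> cbox 0 (\<chi> i. 2 * pi)"
    by (simp add: mem_box_cart)
  moreover have "f (y + h) = f (x + h)" if "periodic f" for f :: "real^3 \<Rightarrow> 'a" and h
  proof -
    have "y + h = x + h + axis 1 (2 * pi * of_int (n 1)) + axis 2 (2 * pi * of_int (n 2))
      + axis 3 (2 * pi * of_int (n 3))"
      by (simp add: y_def)
    then show ?thesis
      by (simp only: periodic_add[OF that])
  qed
  ultimately show ?thesis
    using that by blast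
qed

text \<open>Doubling of variables: an interior maximum of \<open>Q (x + h e\<^sub>3) - Q x - \<epsilon> h (2 \<pi> - h)\<close> in
  \<open>(x, h)\<close> is impossible, because the sum of the second derivatives along \<open>e\<^sub>1\<close>, \<open>e\<^sub>2\<close> (applied to both
  points) and along \<open>\<plusminus>e\<^sub>3\<close> (moving the points apart) equals \<open>8 \<epsilon> > 0\<close>.\<close>

lemma periodic_harmonic_difference_le:
  fixes Q :: "real^3 \<Rightarrow> real"
  assumes per: "periodic Q" and cont: "continuous_on UNIV Q"
    and Q1: "\<And>z j t. ((\<lambda>t. Q (z + t *\<^sub>R axis j 1)) has_real_derivative Q1 j (z + t *\<^sub>R axis j 1)) (at t)"
    and Q2: "\<And>z j t. ((\<lambda>t. Q1 j (z + t *\<^sub>R axis j 1)) has_real_derivative Q2 j (z + t *\<^sub>R axis j 1)) (at t)"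
    and harm: "\<And>z. Q2 1 z + Q2 2 z + Q2 3 z = 0"
    and "\<epsilon> > 0" and h: "0 \<le> h" "h \<le> 2 * pi"
  shows "Q (x + h *\<^sub>R axis 3 1) - Q x \<le> \<epsilon> * (h * (2 * pi - h))"
proof -
  define \<Phi> where "\<Phi> = (\<lambda>(x, h). Q (x + h *\<^sub>R axis 3 1) - Q x - \<epsilon> * (h * (2 * pi - h)))"
  define K where "K = cbox (0::real^3) (\<chi> i. 2 * pi) \<times> {0..2 * pi}"
  have "compact K"
    unfolding K_def by (intro compact_Times compact_cbox compact_Icc)
  moreover have "(0, 0) \<in> K"
    by (auto simp: K_def mem_box_cart)
  moreover have "continuous_on K \<Phi>"
    unfolding \<Phi>_def case_prod_beta
    by (intro continuous_intros continuous_on_compose2[OF cont]) auto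
  ultimately obtain p where "p \<in> K" and p: "\<And>q. q \<in> K \<Longrightarrow> \<Phi> q \<le> \<Phi> p"
    using continuous_attains_sup[of K \<Phi>] by blast
  obtain y k where pk: "p = (y, k)"
    by force
  have k: "0 \<le> k" "k \<le> 2 * pi"
    using \<open>p \<in> K\<close> by (auto simp: pk K_def)
  have glob: "\<Phi> (z, l) \<le> \<Phi> (y, k)" if "0 \<le> l" "l \<le> 2 * pi" for z l
  proof -
    obtain z' where z': "z' \<in> cbox 0 (\<chi> i. 2 * pi)"
        "\<And>(f :: real^3 \<Rightarrow> real) h. periodic f \<Longrightarrow> f (z' + h) = f (z + h)"
      using periodic_obtain_cell[where ?'a=real, of z] by metis
    have "Q z' = Q z"
      using z'(2)[OF per, of 0] by simp
    then have "\<Phi> (z, l) = \<Phi> (z', l)"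
      using z'(2)[OF per] by (simp add: \<Phi>_def)
    also have "\<dots> \<le> \<Phi> (y, k)"
      using p[of "(z', l)"] z'(1) that by (simp add: K_def pk)
    finally show ?thesis .
  qed
  have "\<Phi> (y, k) \<le> 0"
  proof (rule ccontr)
    \<comment> \<open>By periodicity \<Phi> vanishes at \<open>h = 0\<close> and at
      \<open>h = 2 * pi\<close>, so a positive maximum has \<open>k\<close> strictly inside and the
      gap can be varied both ways.\<close>
    assume pos: "\<not> \<Phi> (y, k) \<le> 0"
    have "k \<noteq> 0"
      using pos by (auto simp: \<Phi>_def)
    moreover have "k \<noteq> 2 * pi"
    proof
      assume "k = 2 * pi"
      moreover have "y + (2 * pi) *\<^sub>R axis 3 1 = y + axis 3 (2 * pi)"
        by (simp add: vec_eq_iff axis_def)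
      ultimately show False
        using pos per by (simp add: \<Phi>_def periodic_def)
    qed
    ultimately have k': "0 < k" "k < 2 * pi"
      using k by auto
    define w where "w = y + k *\<^sub>R axis 3 1"
    have same: "Q2 j w - Q2 j y \<le> 0" for j
    proof (rule second_derivative_nonpos_at_max[of
          "\<lambda>t. Q (w + t *\<^sub>R axis j 1) - Q (y + t *\<^sub>R axis j 1)"
          "\<lambda>t. Q1 j (w + t *\<^sub>R axis j 1) - Q1 j (y + t *\<^sub>R axis j 1)" _ 1])
      show "((\<lambda>t. Q1 j (w + t *\<^sub>R axis j 1) - Q1 j (y + t *\<^sub>R axis j 1)) has_real_derivative
          Q2 j w - Q2 j y) (at 0)"
        using DERIV_diff[OF Q2[of j w 0] Q2[of j y 0]] by simp
      show "Q (w + t *\<^sub>R axis j 1) - Q (y + t *\<^sub>R axis j 1) \<le>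
          Q (w + 0 *\<^sub>R axis j 1) - Q (y + 0 *\<^sub>R axis j 1)" for t
        using glob[of k "y + t *\<^sub>R axis j 1"] k by (simp add: \<Phi>_def w_def algebra_simps)
    qed (auto intro!: derivative_intros Q1)
    define f where "f t = Q (w + t *\<^sub>R axis 3 1) - Q (y + (- t) *\<^sub>R axis 3 1)
      - \<epsilon> * ((k + 2 * t) * (2 * pi - (k + 2 * t)))" for t
    define f' where "f' t = Q1 3 (w + t *\<^sub>R axis 3 1) + Q1 3 (y + (- t) *\<^sub>R axis 3 1)
      - \<epsilon> * (4 * pi - 4 * k - 8 * t)" for t
    have "Q2 3 w - Q2 3 y + \<epsilon> * 8 \<le> 0"
    \<comment> \<open>Moving the two points apart by \<open>t\<close> each changes the gap to
      \<open>k + 2 * t\<close>; this radius keeps it in the admissible range.\<close>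
    proof (rule second_derivative_nonpos_at_max[of f f' _ "min (k/2) ((2 * pi - k)/2)"])
      have c1: "((\<lambda>t. Q (y + (- t) *\<^sub>R axis 3 1)) has_real_derivative - Q1 3 (y + (- t) *\<^sub>R axis 3 1)) (at t)"
        and c2: "((\<lambda>t. Q1 3 (y + (- t) *\<^sub>R axis 3 1)) has_real_derivative - Q2 3 (y + (- t) *\<^sub>R axis 3 1)) (at t)"
        for t
      proof -
        have um: "(uminus has_real_derivative (-1::real)) (at t)"
          by (auto intro!: derivative_eq_intros)
        show "((\<lambda>t. Q (y + (- t) *\<^sub>R axis 3 1)) has_real_derivative - Q1 3 (y + (- t) *\<^sub>R axis 3 1)) (at t)"
          "((\<lambda>t. Q1 3 (y + (- t) *\<^sub>R axis 3 1)) has_real_derivative - Q2 3 (y + (- t) *\<^sub>R axis 3 1)) (at t)"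
          using DERIV_chain2[where f="\<lambda>t. Q (y + t *\<^sub>R axis 3 1)", OF Q1[of y 3 "- t"] um]
            DERIV_chain2[where f="\<lambda>t. Q1 3 (y + t *\<^sub>R axis 3 1)", OF Q2[of 3 y "- t"] um]
          by simp_all
      qed
      show "(f has_real_derivative f' t) (at t)" for t
        unfolding f_def f'_def
        by (rule derivative_eq_intros Q1 c1 refl)+ (simp add: algebra_simps)
      have "((\<lambda>t. Q1 3 (w + t *\<^sub>R axis 3 1) + Q1 3 (y + (- t) *\<^sub>R axis 3 1)
          - \<epsilon> * (4 * pi - 4 * k - 8 * t)) has_real_derivative
          Q2 3 (w + 0 *\<^sub>R axis 3 1) - Q2 3 (y + (- 0) *\<^sub>R axis 3 1) + \<epsilon> * 8) (at 0)"
        by (rule derivative_eq_intros Q2 c2 refl)+ (simp add: algebra_simps)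
      then show "(f' has_real_derivative Q2 3 w - Q2 3 y + \<epsilon> * 8) (at 0)"
        by (simp add: f'_def[abs_def])
      show "f t \<le> f 0" if "\<bar>t\<bar> < min (k/2) ((2 * pi - k)/2)" for t
      proof -
        have "y + (- t) *\<^sub>R axis 3 1 + (k + 2 * t) *\<^sub>R axis 3 1 = w + t *\<^sub>R axis 3 1"
          by (simp add: w_def vec_eq_iff algebra_simps)
        then have "f t = \<Phi> (y + (- t) *\<^sub>R axis 3 1, k + 2 * t)"
          by (simp only: f_def \<Phi>_def prod.case)
        moreover have "f 0 = \<Phi> (y, k)"
          by (simp add: f_def \<Phi>_def w_def)
        moreover have "0 \<le> k + 2 * t" "k + 2 * t \<le> 2 * pi"
          using that by (auto simp: abs_if split: if_splits)
        ultimately show ?thesis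
          using glob[of "k + 2 * t"] by simp
      qed
    qed (use k' in auto)
    with same[of 1] same[of 2] harm[of w] harm[of y] \<open>\<epsilon> > 0\<close> show False
      by linarith
  qed
  then show ?thesis
    using glob[of h x] h by (simp add: \<Phi>_def)
qed

text \<open>Letting \<epsilon> tend to 0, a step of length \<open>h\<close> in direction 3 cannot
  increase \<open>Q\<close>. A further step of length \<open>2 * pi - h\<close> returns to the
  starting value by periodicity, so neither step can decrease it either, and \<open>Q\<close> is
  constant along this direction.\<close>

lemma periodic_harmonic_deriv_zero:
  fixes Q :: "real^3 \<Rightarrow> real"
  assumes per: "periodic Q" and cont: "continuous_on UNIV Q"
    and Q1: "\<And>z j t. ((\<lambda>t. Q (z + t *\<^sub>R axis j 1)) has_real_derivative Q1 j (z + t *\<^sub>R axis j 1)) (at t)"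
    and Q2: "\<And>z j t. ((\<lambda>t. Q1 j (z + t *\<^sub>R axis j 1)) has_real_derivative Q2 j (z + t *\<^sub>R axis j 1)) (at t)"
    and harm: "\<And>z. Q2 1 z + Q2 2 z + Q2 3 z = 0"
  shows "Q1 3 x = 0"
proof -
  have le: "Q (x + h *\<^sub>R axis 3 1) \<le> Q x" if h: "0 \<le> h" "h \<le> 2 * pi" for x h
  proof (rule ccontr)
    assume gt: "\<not> Q (x + h *\<^sub>R axis 3 1) \<le> Q x"
    define c where "c = Q (x + h *\<^sub>R axis 3 1) - Q x"
    have "c > 0" using gt by (simp add: c_def)
    define g where "g = h * (2 * pi - h)"
    have "g \<ge> 0" using h by (simp add: g_def)
    \<comment> \<open>The choice \<open>c / (g + 1)\<close> of \<epsilon> makes the error term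
      smaller than the gain \<open>c\<close>.\<close>
    have "c \<le> c / (g + 1) * g"
      unfolding c_def g_def
      by (rule periodic_harmonic_difference_le[OF per cont Q1 Q2 harm _ h])
        (use \<open>c > 0\<close> \<open>g \<ge> 0\<close> in \<open>auto simp: c_def g_def intro!: divide_pos_pos\<close>)
    then show False
      using \<open>c > 0\<close> \<open>g \<ge> 0\<close> by (simp add: field_simps)
  qed
  have "Q (x + h *\<^sub>R axis 3 1) = Q x" if h: "0 \<le> h" "h \<le> 2 * pi" for x h
  proof -
    have E: "x + h *\<^sub>R axis 3 1 + (2 * pi - h) *\<^sub>R axis 3 1 = x + axis 3 (2 * pi)"
      by (simp add: vec_eq_iff axis_def)
    then have "Q x \<le> Q (x + h *\<^sub>R axis 3 1)"
      using le[of "2 * pi - h" "x + h *\<^sub>R axis 3 1"] h per unfolding E by (simp add: periodic_def)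
    then show ?thesis
      using le[OF h, of x] by simp
  qed
  note const = this
  \<comment> \<open>The base point is moved back by one unit, so that \<open>x\<close> sits at
    parameter 1, inside the interval where constancy is known; at parameter 0 only one side would be
    covered.\<close>
  have "((\<lambda>t. Q (x - axis 3 1 + t *\<^sub>R axis 3 1)) has_real_derivative 0) (at 1)"
  proof (rule has_field_derivative_transform_within_open[of "\<lambda>t. Q (x - axis 3 1)" _ _ "{0<..<2 * pi}"])
    show "1 \<in> {0<..<2 * pi}" using pi_gt3 by simp
    show "Q (x - axis 3 1) = Q (x - axis 3 1 + t *\<^sub>R axis 3 1)" if "t \<in> {0<..<2 * pi}" for t
      using const[of t "x - axis 3 1"] that by simp
  qed auto
  moreover have "((\<lambda>t. Q (x - axis 3 1 + t *\<^sub>R axis 3 1)) has_real_derivative Q1 3 x) (at 1)"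
    using Q1[of "x - axis 3 1" 3 1] by simp
  ultimately show ?thesis
    using DERIV_unique by blast
qed

section \<open>The pressure of the initial data\<close>

lemma partial_eqI:
  "((\<lambda>h. f (x + h *\<^sub>R axis i 1)) has_real_derivative D) (at 0) \<Longrightarrow> partial i f x = D"
  unfolding partial_def by (rule DERIV_imp_deriv)

lemma has_real_derivative_partial:
  fixes f :: "real^3 \<Rightarrow> real"
  assumes "\<And>x. f differentiable (at x)"
  shows "((\<lambda>t. f (z + t *\<^sub>R axis j 1)) has_real_derivative partial j f (z + t *\<^sub>R axis j 1)) (at t)"
proof -
  have "(\<lambda>h. f (w + h *\<^sub>R axis j 1)) differentiable (at 0)" for w
    using differentiable_chain_at[of "\<lambda>h. w + h *\<^sub>R axis j 1" "0::real" f] assms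
    by (simp add: o_def)
  then have d: "((\<lambda>h. f (w + h *\<^sub>R axis j 1)) has_real_derivative partial j f w) (at 0)" for w
    unfolding partial_def by (simp add: DERIV_deriv_iff_real_differentiable)
  have "((\<lambda>h. f (z + (h + t) *\<^sub>R axis j 1)) has_real_derivative partial j f (z + t *\<^sub>R axis j 1)) (at 0)"
    using d[of "z + t *\<^sub>R axis j 1"] by (simp add: algebra_simps)
  then show ?thesis
    using DERIV_shift[of "\<lambda>t. f (z + t *\<^sub>R axis j 1)" _ 0 t] by simp
qed

lemma partial_sin_sin:
  fixes x :: "real^3"
  shows "partial i (\<lambda>x. sin (x $ 1) * sin (x $ 2)) x =
      (if i = 1 then cos (x $ 1) * sin (x $ 2) else if i = 2 then sin (x $ 1) * cos (x $ 2) else 0)"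
    "partial i (\<lambda>x. cos (x $ 1) * sin (x $ 2)) x =
      (if i = 1 then - sin (x $ 1) * sin (x $ 2) else if i = 2 then cos (x $ 1) * cos (x $ 2) else 0)"
    "partial i (\<lambda>x. sin (x $ 1) * cos (x $ 2)) x =
      (if i = 1 then cos (x $ 1) * cos (x $ 2) else if i = 2 then - sin (x $ 1) * sin (x $ 2) else 0)"
    "partial i (\<lambda>x. 0) x = 0"
  using exhaust_3[of i]
  by (auto intro!: partial_eqI derivative_eq_intros simp: axis_def)

lemma differentiable_sin_sin:
  fixes x :: "real^3"
  shows "(\<lambda>x. sin (x $ 1) * sin (x $ 2)) differentiable (at x)"
    "(\<lambda>x. cos (x $ 1) * sin (x $ 2)) differentiable (at x)"
    "(\<lambda>x. sin (x $ 1) * cos (x $ 2)) differentiable (at x)"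
proof -
  have *: "((\<lambda>x::real^3. x $ i) has_derivative (\<lambda>h. h $ i)) (at x)" for i
    by (rule bounded_linear_imp_has_derivative) (rule bounded_linear_vec_nth)
  have s: "(\<lambda>x::real^3. sin (x $ i)) differentiable (at x)" for i
    using has_derivative_sin[OF *] by (auto simp: differentiable_def)
  have c: "(\<lambda>x::real^3. cos (x $ i)) differentiable (at x)" for i
    using has_derivative_cos[OF *] by (auto simp: differentiable_def)
  show "(\<lambda>x. sin (x $ 1) * sin (x $ 2)) differentiable (at x)"
    "(\<lambda>x. cos (x $ 1) * sin (x $ 2)) differentiable (at x)"
    "(\<lambda>x. sin (x $ 1) * cos (x $ 2)) differentiable (at x)"
    by (intro differentiable_mult s c)+
qed

lemma partial_partial_sin_sin:
  "partial 1 (\<lambda>x::real^3. sin (x $ 1) * sin (x $ 2)) = (\<lambda>x. cos (x $ 1) * sin (x $ 2))"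
  "partial 2 (\<lambda>x::real^3. sin (x $ 1) * sin (x $ 2)) = (\<lambda>x. sin (x $ 1) * cos (x $ 2))"
  "partial 3 (\<lambda>x::real^3. sin (x $ 1) * sin (x $ 2)) = (\<lambda>x. 0)"
  by (auto simp: partial_sin_sin)

lemma twice_continuously_differentiable_sin_sin:
  "twice_continuously_differentiable (\<lambda>x. sin (x $ 1) * sin (x $ 2))"
  unfolding twice_continuously_differentiable_def
proof (intro conjI allI)
  fix i j :: 3 and x :: "real^3"
  show "(\<lambda>x. sin (x $ 1) * sin (x $ 2)) differentiable (at x)"
    by (rule differentiable_sin_sin)
  show "partial i (\<lambda>x. sin (x $ 1) * sin (x $ 2)) differentiable (at x)"
    using exhaust_3[of i] by (auto simp: partial_partial_sin_sin differentiable_sin_sin)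
  have "partial j (partial i (\<lambda>x::real^3. sin (x $ 1) * sin (x $ 2))) \<in>
    {\<lambda>x. - sin (x $ 1) * sin (x $ 2), \<lambda>x. cos (x $ 1) * cos (x $ 2), \<lambda>x. 0}"
    using exhaust_3[of i] exhaust_3[of j]
    by (auto simp: partial_partial_sin_sin fun_eq_iff partial_sin_sin)
  then show "continuous_on UNIV (partial j (partial i (\<lambda>x. sin (x $ 1) * sin (x $ 2))))"
    by (auto intro!: continuous_intros)
qed

lemma u_in_nth:
  "u_in N x $ 1 = cos (x $ 2) * (N / (N + sin (x $ 3)))"
  "u_in N x $ 2 = cos (x $ 1) * ((N + sin (x $ 3)) / N)"
  "u_in N x $ 3 = 0"
  by (simp_all add: u_in_def)

text \<open>Only the two cross derivatives survive, and in their product the factors depending on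
  \<open>x $ 3\<close> cancel: the right-hand side is 2 sin x1 sin x2, for which sin x1 sin x2
  itself is a solution. Any other solution differs from it by a periodic harmonic function, which is
  constant in direction 3.\<close>

lemma favorable_u_in:
  assumes "N > 1"
  shows "favorable_initial_pressure_gradient (u_in N)"
proof -
  have Npos: "N + sin (x $ 3) > 0" for x :: "real^3"
    using assms sin_ge_minus_one[of "x $ 3"] by linarith
  then have Nnz: "N + sin (x $ 3) \<noteq> 0" for x :: "real^3"
    by (metis less_irrefl)
  have p: "partial 1 (\<lambda>y. u_in N y $ 1) x = 0" "partial 2 (\<lambda>y. u_in N y $ 2) x = 0"
    "partial 2 (\<lambda>y. u_in N y $ 1) x = - sin (x $ 2) * (N / (N + sin (x $ 3)))"
    "partial 1 (\<lambda>y. u_in N y $ 2) x = - sin (x $ 1) * ((N + sin (x $ 3)) / N)" for x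
    unfolding u_in_nth
    by (rule partial_eqI; use assms Nnz in \<open>auto intro!: derivative_eq_intros simp: axis_def\<close>)+
  have rhs: "(\<Sum>i\<in>{1,2}. \<Sum>j\<in>{1,2}. partial i (\<lambda>y. u_in N y $ j) x * partial j (\<lambda>y. u_in N y $ i) x)
      = 2 * (sin (x $ 1) * sin (x $ 2))" for x
    using Npos[of x] assms by (simp add: p)
  let ?P0 = "\<lambda>x::real^3. sin (x $ 1) * sin (x $ 2)"
  have lap0: "(\<Sum>i\<in>UNIV. partial i (partial i ?P0) x) = - 2 * ?P0 x" for x
    by (simp add: sum_3 partial_partial_sin_sin partial_sin_sin)
  have per0: "periodic ?P0"
    unfolding periodic_def
  proof (intro allI)
    fix x :: "real^3" and i :: 3
    show "?P0 (x + axis i (2 * pi)) = ?P0 x"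
      using exhaust_3[of i] by (auto simp: axis_def)
  qed
  have P0: "initial_pressure (u_in N) ?P0"
    unfolding initial_pressure_def rhs lap0
    using twice_continuously_differentiable_sin_sin per0 by simp
  moreover have "partial 3 P x = 0" if P: "initial_pressure (u_in N) P" for P x
  proof -
    define Q where "Q x = P x - ?P0 x" for x
    define Q1 where "Q1 j x = partial j P x - partial j ?P0 x" for j x
    define Q2 where "Q2 j x = partial j (partial j P) x - partial j (partial j ?P0) x" for j x
    have t: "twice_continuously_differentiable P" "twice_continuously_differentiable ?P0"
      using P twice_continuously_differentiable_sin_sin by (auto simp: initial_pressure_def)
    have "Q1 3 x = 0"
    proof (rule periodic_harmonic_deriv_zero[of Q Q1 Q2])
      show "periodic Q"
        using P per0 unfolding initial_pressure_def periodic_def Q_def by simp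
      have "continuous_on UNIV P" "continuous_on UNIV ?P0"
        using t unfolding twice_continuously_differentiable_def
        by (auto intro!: differentiable_imp_continuous_on simp: differentiable_on_def)
      then show "continuous_on UNIV Q"
        unfolding Q_def by (intro continuous_intros)
      show "((\<lambda>t. Q (z + t *\<^sub>R axis j 1)) has_real_derivative Q1 j (z + t *\<^sub>R axis j 1)) (at t)" for z j t
        unfolding Q_def Q1_def
        by (intro DERIV_diff has_real_derivative_partial[of P] has_real_derivative_partial[of ?P0])
          (use t in \<open>auto simp: twice_continuously_differentiable_def\<close>)
      show "((\<lambda>t. Q1 j (z + t *\<^sub>R axis j 1)) has_real_derivative Q2 j (z + t *\<^sub>R axis j 1)) (at t)" for z j t
        unfolding Q1_def Q2_def
        by (intro DERIV_diff has_real_derivative_partial[of "partial j P"]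
              has_real_derivative_partial[of "partial j ?P0"])
          (use t in \<open>auto simp: twice_continuously_differentiable_def\<close>)
      show "Q2 1 z + Q2 2 z + Q2 3 z = 0" for z
      proof -
        have "- (\<Sum>i\<in>UNIV. partial i (partial i P) z) = 2 * ?P0 z"
          using P unfolding initial_pressure_def rhs by blast
        then show ?thesis
          using lap0[of z] by (simp add: Q2_def sum_3)
      qed
    qed
    then show ?thesis
      by (simp add: Q1_def partial_partial_sin_sin)
  qed
  ultimately show ?thesis
    unfolding favorable_initial_pressure_gradient_def using p by auto
qed

section \<open>Fourier series on the torus\<close>

lemma norm_vec_le_sum: "norm x \<le> (\<Sum>i\<in>UNIV. norm (x $ i))"
  unfolding norm_vec_def by (rule L2_set_le_sum) auto

lemma norm_vec_sq: "(norm x)\<^sup>2 = (\<Sum>i\<in>UNIV. (norm (x $ i))\<^sup>2)"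
  unfolding norm_vec_def L2_set_def by (simp add: sum_nonneg)

lemma norm_vector_smult: "norm (z *s a) = cmod z * norm a" for a :: "complex^3"
proof -
  have "(norm (z *s a))\<^sup>2 = (cmod z * norm a)\<^sup>2"
    unfolding norm_vec_sq power_mult_distrib sum_distrib_left
    by (simp add: norm_mult power_mult_distrib)
  then show ?thesis
    by (simp add: power2_eq_iff_nonneg)
qed

text \<open>In finite dimension unconditional convergence is absolute, coordinate by coordinate.
  This is what lets \<open>infsum\<close> be read as a Lebesgue integral.\<close>

lemma euclidean_summable_imp_abs_summable:
  fixes f :: "'a \<Rightarrow> 'b::euclidean_space"
  assumes "f summable_on A"
  shows "(\<lambda>x. norm (f x)) summable_on A"
proof -
  have comp: "(\<lambda>x. \<bar>f x \<bullet> b\<bar>) summable_on A" for b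
  proof -
    have "(\<lambda>x. f x \<bullet> b) summable_on A"
      by (rule summable_on_bounded_linear[OF bounded_linear_inner_left assms])
    then show "(\<lambda>x. \<bar>f x \<bullet> b\<bar>) summable_on A"
      using summable_on_iff_abs_summable_on_real[of "\<lambda>x. f x \<bullet> b" A] by simp
  qed
  have "(\<lambda>x. \<Sum>b\<in>B. \<bar>f x \<bullet> b\<bar>) summable_on A" if "finite B" for B
    using that by (induction B rule: finite_induct) (auto intro: summable_on_add comp)
  then have "(\<lambda>x. \<Sum>b\<in>Basis. \<bar>f x \<bullet> b\<bar>) summable_on A"
    by simp
  then show ?thesis
    by (rule summable_on_comparison_test) (auto intro: norm_le_l1)
qed

text \<open>Divergent series are covered too: there \<open>infsum\<close> and the Lebesgue integral
  both take the value 0. Measurability of sums and exchanges of sum and integral thereby become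
  statements about a product with a counting measure.\<close>

lemma infsum_eq_lebesgue_integral:
  fixes f :: "'a \<Rightarrow> 'b::euclidean_space"
  shows "infsum f UNIV = (\<integral>x. f x \<partial>count_space UNIV)"
proof (cases "f summable_on UNIV")
  case True
  then have "Infinite_Set_Sum.abs_summable_on f UNIV"
    using euclidean_summable_imp_abs_summable abs_summable_equivalent by blast
  then show ?thesis
    using infsetsum_infsum[of f UNIV] by (simp add: infsetsum_def)
next
  case False
  then have "\<not> Infinite_Set_Sum.abs_summable_on f UNIV"
    using abs_summable_equivalent abs_summable_summable by blast
  then show ?thesis
    using False by (simp add: infsum_not_exists abs_summable_on_def not_integrable_integral_eq
        set_integrable_def)
qed

lemma integrable_count_space_iff:
  fixes f :: "'a \<Rightarrow> 'b::euclidean_space"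
  shows "integrable (count_space UNIV) f \<longleftrightarrow> (\<lambda>x. norm (f x)) summable_on UNIV"
  using abs_summable_equivalent[of f UNIV] by (simp add: abs_summable_on_def set_integrable_def)

lemma borel_measurable_infsum:
  fixes f :: "'k::countable \<Rightarrow> 'a \<Rightarrow> 'b::euclidean_space"
  assumes [measurable]: "\<And>k. f k \<in> borel_measurable M"
  shows "(\<lambda>x. \<Sum>\<^sub>\<infinity>k. f k x) \<in> borel_measurable M"
proof -
  interpret sigma_finite_measure "count_space (UNIV :: 'k set)"
    by (rule sigma_finite_measure_count_space_countable) simp
  have "(\<lambda>x. f (snd x) (fst x)) \<in> borel_measurable (M \<Otimes>\<^sub>M count_space UNIV)"
    by (rule measurable_compose_countable'[where I=UNIV and g=snd and f="\<lambda>k x. f k (fst x)"]) auto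
  then have [measurable]: "case_prod (\<lambda>x k. f k x) \<in> borel_measurable (M \<Otimes>\<^sub>M count_space UNIV)"
    by (simp add: case_prod_beta')
  show ?thesis
    unfolding infsum_eq_lebesgue_integral by measurable
qed

lemma integral_infsum:
  fixes f :: "'k::countable \<Rightarrow> 'a \<Rightarrow> 'b::euclidean_space"
  assumes M: "sigma_finite_measure M" and int: "\<And>k. integrable M (f k)"
    and sum: "(\<lambda>k. \<integral>x. norm (f k x) \<partial>M) summable_on UNIV"
  shows "integrable M (\<lambda>x. \<Sum>\<^sub>\<infinity>k. f k x)"
    and "(\<integral>x. (\<Sum>\<^sub>\<infinity>k. f k x) \<partial>M) = (\<Sum>\<^sub>\<infinity>k. \<integral>x. f k x \<partial>M)"
proof -
  interpret K: sigma_finite_measure "count_space (UNIV :: 'k set)"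
    by (rule sigma_finite_measure_count_space_countable) simp
  interpret M: sigma_finite_measure M by fact
  interpret pair_sigma_finite "count_space (UNIV :: 'k set)" M ..
  have meas: "case_prod f \<in> borel_measurable (count_space UNIV \<Otimes>\<^sub>M M)"
    using int by (intro measurable_pair_measure_countable1) auto
  have prod: "integrable (count_space UNIV \<Otimes>\<^sub>M M) (case_prod f)"
  proof (rule Fubini_integrable[OF meas])
    show "integrable (count_space UNIV) (\<lambda>k. \<integral>x. norm (case_prod f (k, x)) \<partial>M)"
      unfolding integrable_count_space_iff using sum by simp
  qed (simp add: int)
  show "integrable M (\<lambda>x. \<Sum>\<^sub>\<infinity>k. f k x)"
    unfolding infsum_eq_lebesgue_integral by (rule integrable_snd[OF prod])
  show "(\<integral>x. (\<Sum>\<^sub>\<infinity>k. f k x) \<partial>M) = (\<Sum>\<^sub>\<infinity>k. \<integral>x. f k x \<partial>M)"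
    unfolding infsum_eq_lebesgue_integral by (rule Fubini_integral[OF prod])
qed

lemma space_torus: "space torus = cbox 0 (\<chi> i. 2 * pi)"
  by (simp add: torus_def space_restrict_space)

lemma borel_measurable_torus:
  "f \<in> borel_measurable borel \<Longrightarrow> f \<in> borel_measurable torus"
  unfolding torus_def by (intro measurable_restrict_space1) simp

lemma emeasure_torus: "emeasure torus (space torus) = ennreal ((2 * pi) ^ 3)"
proof -
  have B: "(Basis :: (real^3) set) = (\<lambda>i. axis i 1) ` UNIV"
    by (auto simp: Basis_vec_def)
  have inj: "inj_on (\<lambda>i::3. axis i (1::real)) UNIV"
    by (auto simp: inj_on_def axis_eq_axis)
  have "(\<Prod>b\<in>Basis. ((\<chi> i. 2 * pi) - 0) \<bullet> (b::real^3)) = (2 * pi) ^ 3"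
    unfolding B prod.reindex[OF inj] o_def cart_eq_inner_axis[symmetric] by simp
  moreover have "\<forall>b\<in>Basis. (0::real^3) \<bullet> b \<le> (\<chi> i. 2 * pi) \<bullet> b"
    unfolding B by (simp add: cart_eq_inner_axis[symmetric])
  ultimately show ?thesis
    unfolding space_torus unfolding torus_def
    by (subst emeasure_restrict_space) (auto simp: emeasure_lborel_cbox_eq)
qed

lemma finite_measure_torus: "finite_measure torus"
  by (rule finite_measureI) (simp add: emeasure_torus)

interpretation torus: finite_measure torus
  by (rule finite_measure_torus)

lemma measure_torus: "measure torus (space torus) = (2 * pi) ^ 3"
  by (simp add: measure_def emeasure_torus)

lemma integrable_torus_continuous:
  fixes f :: "real^3 \<Rightarrow> 'b::{banach, second_countable_topology}"
  assumes "continuous_on UNIV f"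
  shows "integrable torus f"
proof -
  have "compact (f ` cbox 0 (\<chi> i. 2 * pi))"
    by (intro compact_continuous_image compact_cbox continuous_on_subset[OF assms]) auto
  then obtain B where "\<And>x. x \<in> cbox 0 (\<chi> i. 2 * pi) \<Longrightarrow> norm (f x) \<le> B"
    using compact_imp_bounded bounded_iff by (metis imageI)
  then show ?thesis
    by (intro torus.integrable_const_bound[of _ B] borel_measurable_torus
        borel_measurable_continuous_onI assms) (auto simp: space_torus)
qed

lemma fourier_mode_eq_cis: "fourier_mode k x = cis (\<Sum>j\<in>UNIV. of_int (k $ j) * x $ j)"
  by (simp add: fourier_mode_def cis_conv_exp)

lemma norm_fourier_mode [simp]: "cmod (fourier_mode k x) = 1"
  by (simp add: fourier_mode_eq_cis)

lemma fourier_mode_add: "fourier_mode (k + l) x = fourier_mode k x * fourier_mode l x"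
  by (simp add: fourier_mode_eq_cis cis_mult sum.distrib[symmetric] algebra_simps)

lemma fourier_mode_uminus: "fourier_mode (- k) x = cnj (fourier_mode k x)"
  by (simp add: fourier_mode_eq_cis cis_cnj sum_negf)

lemma continuous_fourier_mode: "continuous_on A (fourier_mode k)"
  unfolding fourier_mode_def by (intro continuous_intros)

lemma borel_measurable_fourier_mode [measurable]: "fourier_mode k \<in> borel_measurable torus"
  by (intro borel_measurable_torus borel_measurable_continuous_onI continuous_fourier_mode)

lemma periodic_fourier_mode: "periodic (fourier_mode k)"
  unfolding periodic_def
proof (intro allI)
  fix x :: "real^3" and i :: 3
  have "(\<Sum>j\<in>UNIV. of_int (k $ j) * (x + axis i (2 * pi)) $ j)
      = (\<Sum>j\<in>UNIV. of_int (k $ j) * x $ j) + 2 * pi * of_int (k $ i)"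
    using exhaust_3[of i] by (auto simp: sum_3 axis_def algebra_simps)
  then show "fourier_mode k (x + axis i (2 * pi)) = fourier_mode k x"
    by (simp add: fourier_mode_eq_cis cis_mult[symmetric] cis_multiple_2pi)
qed

lemma integral_cis_int:
  fixes n :: int
  shows "(\<integral>x. indicator {0..2*pi} x *\<^sub>R cis (of_int n * x) \<partial>lborel) = (if n = 0 then 2 * pi else 0)"
proof (cases "n = 0")
  case False
  have "((\<lambda>x. cis (of_int n * x) / (\<i> * of_int n)) has_vector_derivative cis (of_int n * x)) (at x within S)" for x S
  proof -
    have "((\<lambda>x. exp (\<i> * of_int n * of_real x) / (\<i> * of_int n)) has_vector_derivative
       exp (\<i> * of_int n * of_real x)) (at x within S)"
      by (rule has_vector_derivative_real_field[of "\<lambda>z. exp (\<i> * of_int n * z) / (\<i> * of_int n)"])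
        (use False in \<open>auto intro!: derivative_eq_intros\<close>)
    then show ?thesis
      by (simp add: cis_conv_exp mult_ac)
  qed
  then have "(\<integral>x. indicator {0..2*pi} x *\<^sub>R cis (of_int n * x) \<partial>lborel) =
     cis (of_int n * (2 * pi)) / (\<i> * of_int n) - cis (of_int n * 0) / (\<i> * of_int n)"
    by (intro integral_FTC_atLeastAtMost) (auto intro!: continuous_intros)
  also have "cis (of_int n * (2 * pi)) = 1"
    using cis_multiple_2pi[of "of_int n"] by (simp add: mult_ac)
  finally show ?thesis
    using False by simp
qed (simp add: scaleR_conv_of_real)

lemma integral_lborel_prod:
  fixes f :: "'a::euclidean_space \<Rightarrow> real \<Rightarrow> complex"
  assumes int: "\<And>b. b \<in> Basis \<Longrightarrow> integrable lborel (f b)"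
  shows "(\<integral>x. (\<Prod>b\<in>Basis. f b (x \<bullet> b)) \<partial>lborel) = (\<Prod>b\<in>Basis. \<integral>x. f b x \<partial>lborel)"
proof -
  interpret product_sigma_finite "\<lambda>_::'a. lborel::real measure"
    by standard
  have [measurable]: "\<And>b. b \<in> Basis \<Longrightarrow> f b \<in> borel_measurable borel"
    using int by (auto dest: borel_measurable_integrable)
  show ?thesis
    by (subst lborel_eq, subst integral_distr)
      (auto simp: product_integral_prod[OF finite_Basis int] cong: prod.cong)
qed

lemma prod_UNIV_3: "prod f (UNIV :: 3 set) = f 1 * f 2 * f 3"
  unfolding UNIV_3 by (simp add: mult.assoc)

lemma integral_fourier_mode:
  "(\<integral>x. fourier_mode k x \<partial>torus) = (if k = 0 then (2 * pi) ^ 3 else 0)"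
proof -
  \<comment> \<open>The \<open>THE\<close> recovers the coordinate index of a basis vector, since
    the product formula for \<open>lborel\<close> is indexed by \<open>Basis\<close>.\<close>
  define f where "f b t = indicator {0..2*pi} t *\<^sub>R cis (of_int (k $ (THE i. b = axis i 1)) * t)"
    for b :: "real^3" and t
  have the: "(THE i. axis j (1::real) = axis i 1) = j" for j :: 3
    by (auto simp: axis_eq_axis)
  have B: "(Basis :: (real^3) set) = (\<lambda>i. axis i 1) ` UNIV"
    by (auto simp: Basis_vec_def)
  have inj: "inj_on (\<lambda>i::3. axis i (1::real)) UNIV"
    by (auto simp: inj_on_def axis_eq_axis)
  have "indicator (cbox 0 (\<chi> i. 2 * pi)) x *\<^sub>R fourier_mode k x = (\<Prod>b\<in>Basis. f b (x \<bullet> b))" for x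
  proof -
    have "cis (\<Sum>j\<in>UNIV. of_int (k $ j) * x $ j) = (\<Prod>j\<in>UNIV. cis (of_int (k $ j) * x $ j))"
      unfolding sum_3 prod_UNIV_3 cis_mult ..
    moreover have "indicator (cbox 0 (\<chi> i. 2 * pi)) x = (\<Prod>j\<in>UNIV. indicator {0..2*pi} (x $ j) :: real)"
      unfolding prod_UNIV_3 by (auto simp: indicator_def mem_box_cart forall_3)
    ultimately show ?thesis
      unfolding B prod.reindex[OF inj] o_def f_def the fourier_mode_eq_cis
      by (simp add: cart_eq_inner_axis[symmetric] scaleR_conv_of_real prod.distrib)
  qed
  then have "(\<integral>x. fourier_mode k x \<partial>torus) = (\<integral>x. (\<Prod>b\<in>Basis. f b (x \<bullet> b)) \<partial>lborel)"
    unfolding torus_def by (subst integral_restrict_space) auto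
  also have "\<dots> = (\<Prod>b\<in>Basis. \<integral>x. f b x \<partial>lborel)"
  proof (rule integral_lborel_prod)
    show "integrable lborel (f b)" for b
      unfolding f_def by (rule borel_integrable_compact) (auto intro!: continuous_intros)
  qed
  also have "\<dots> = (\<Prod>i\<in>UNIV. if k $ i = 0 then 2 * pi else 0)"
    unfolding B prod.reindex[OF inj] o_def f_def the integral_cis_int by simp
  also have "\<dots> = (if k = 0 then (2 * pi) ^ 3 else 0)"
    unfolding prod_UNIV_3 by (auto simp: vec_eq_iff forall_3 power3_eq_cube)
  finally show ?thesis
    by simp
qed

lemma integral_fourier_mode_mult:
  "(\<integral>x. fourier_mode k x * fourier_mode (- l) x \<partial>torus) = (if k = l then (2 * pi) ^ 3 else 0)"
  unfolding fourier_mode_add[symmetric] by (simp add: integral_fourier_mode)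

lemma summable_mult_fourier_mode:
  fixes c :: "int^3 \<Rightarrow> complex"
  assumes "(\<lambda>k. norm (c k)) summable_on UNIV"
  shows "(\<lambda>k. c k * fourier_mode k x) summable_on UNIV" "(\<lambda>k. norm (c k * fourier_mode k x)) summable_on UNIV"
proof -
  show "(\<lambda>k. norm (c k * fourier_mode k x)) summable_on UNIV"
    using assms by (simp add: norm_mult)
  then show "(\<lambda>k. c k * fourier_mode k x) summable_on UNIV"
    by (rule abs_summable_summable)
qed

lemma borel_measurable_fourier_sum:
  fixes c :: "int^3 \<Rightarrow> complex"
  shows
  "(\<lambda>x. \<Sum>\<^sub>\<infinity>k. c k * fourier_mode k x) \<in> borel_measurable torus"
  by (intro borel_measurable_infsum borel_measurable_times) auto

lemma norm_fourier_sum_le: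
  fixes c :: "int^3 \<Rightarrow> complex"
  assumes "(\<lambda>k. norm (c k)) summable_on UNIV"
  shows "norm (\<Sum>\<^sub>\<infinity>k. c k * fourier_mode k x) \<le> (\<Sum>\<^sub>\<infinity>k. norm (c k))"
  using norm_infsum_bound[OF summable_mult_fourier_mode(2)[OF assms], of x] by (simp add: norm_mult)

lemma integral_fourier_sum:
  fixes c :: "int^3 \<Rightarrow> complex"
  assumes c: "(\<lambda>k. norm (c k)) summable_on UNIV"
  shows "(\<integral>x. (\<Sum>\<^sub>\<infinity>l. c l * fourier_mode l x) * fourier_mode (- k) x \<partial>torus) = (2 * pi) ^ 3 * c k"
proof -
  have "(\<integral>x. (\<Sum>\<^sub>\<infinity>l. c l * fourier_mode l x) * fourier_mode (- k) x \<partial>torus)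
      = (\<integral>x. (\<Sum>\<^sub>\<infinity>l. c l * (fourier_mode l x * fourier_mode (- k) x)) \<partial>torus)"
    unfolding infsum_cmult_left'[symmetric] mult.assoc ..
  also have "\<dots> = (\<Sum>\<^sub>\<infinity>l. \<integral>x. c l * (fourier_mode l x * fourier_mode (- k) x) \<partial>torus)"
  proof (rule integral_infsum(2))
    show "integrable torus (\<lambda>x. c l * (fourier_mode l x * fourier_mode (- k) x))" for l
      by (intro integrable_torus_continuous continuous_intros continuous_fourier_mode)
    show "(\<lambda>l. \<integral>x. cmod (c l * (fourier_mode l x * fourier_mode (- k) x)) \<partial>torus) summable_on UNIV"
      using summable_on_cmult_right[OF c, of "(2 * pi) ^ 3"] by (simp add: norm_mult measure_torus)
  qed (rule torus.sigma_finite_measure_axioms)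
  also have "\<dots> = (\<Sum>\<^sub>\<infinity>l\<in>{k}. c l * (2 * pi) ^ 3)"
    by (rule infsum_cong_neutral) (auto simp: integral_fourier_mode_mult)
  finally show ?thesis
    by simp
qed

lemma fourier_coeff_fourier_sum:
  fixes c :: "int^3 \<Rightarrow> complex"
  assumes "(\<lambda>k. norm (c k)) summable_on UNIV"
    and "\<And>x. complex_of_real (f x) = (\<Sum>\<^sub>\<infinity>k. c k * fourier_mode k x)"
  shows "fourier_coeff f k = c k"
  unfolding fourier_coeff_def assms(2) integral_fourier_sum[OF assms(1)]
  by (simp add: scaleR_conv_of_real)

text \<open>Only one factor of |g|^2 is expanded into its series. The other stays a bounded
  function, so termwise integration rests on the summability of \<open>c\<close>, and the integrals
  that remain are conjugates of Fourier coefficients of g.\<close>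

lemma parseval_fourier_sum:
  fixes c :: "int^3 \<Rightarrow> complex"
  assumes c: "(\<lambda>k. norm (c k)) summable_on UNIV"
  shows "(\<lambda>k. (norm (c k))\<^sup>2) summable_on UNIV"
    and "integrable torus (\<lambda>x. (norm (\<Sum>\<^sub>\<infinity>k. c k * fourier_mode k x))\<^sup>2)"
    and "(\<integral>x. (norm (\<Sum>\<^sub>\<infinity>k. c k * fourier_mode k x))\<^sup>2 \<partial>torus) = (2 * pi) ^ 3 * (\<Sum>\<^sub>\<infinity>k. (norm (c k))\<^sup>2)"
proof -
  define g where "g x = (\<Sum>\<^sub>\<infinity>k. c k * fourier_mode k x)" for x
  define B where "B = (\<Sum>\<^sub>\<infinity>k. norm (c k))"
  have gB: "norm (g x) \<le> B" for x
    unfolding g_def B_def by (rule norm_fourier_sum_le[OF c])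
  have [measurable]: "g \<in> borel_measurable torus"
    unfolding g_def by (rule borel_measurable_fourier_sum)
  have [measurable]: "(\<lambda>x. cnj (g x)) \<in> borel_measurable torus"
    by (rule borel_measurable_continuous_on[of cnj]) (auto intro!: continuous_intros)
  have B0: "0 \<le> B"
    unfolding B_def by (intro infsum_nonneg) auto
  have cB: "norm (c k) \<le> B" for k
    using finite_sum_le_infsum[OF c, of "{k}"] by (simp add: B_def)
  have "(\<lambda>k. B * norm (c k)) summable_on UNIV"
    by (rule summable_on_cmult_right[OF c])
  then show s2: "(\<lambda>k. (norm (c k))\<^sup>2) summable_on UNIV"
    by (rule summable_on_comparison_test) (auto simp: power2_eq_square intro!: mult_right_mono cB)
  show "integrable torus (\<lambda>x. (norm (\<Sum>\<^sub>\<infinity>k. c k * fourier_mode k x))\<^sup>2)"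
    unfolding g_def[symmetric]
    by (rule torus.integrable_const_bound[of _ "B\<^sup>2"]) (auto intro!: power_mono gB)
  have "complex_of_real (\<integral>x. (norm (g x))\<^sup>2 \<partial>torus) = (\<integral>x. g x * cnj (g x) \<partial>torus)"
    by (simp add: complex_norm_square[symmetric] del: of_real_power)
  also have "\<dots> = (\<integral>x. (\<Sum>\<^sub>\<infinity>k. c k * (fourier_mode k x * cnj (g x))) \<partial>torus)"
  proof -
    have "g x * cnj (g x) = (\<Sum>\<^sub>\<infinity>k. c k * (fourier_mode k x * cnj (g x)))" for x
      unfolding mult.assoc[symmetric] infsum_cmult_left' by (simp add: g_def)
    then show ?thesis by simp
  qed
  also have "\<dots> = (\<Sum>\<^sub>\<infinity>k. \<integral>x. c k * (fourier_mode k x * cnj (g x)) \<partial>torus)"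
  proof (rule integral_infsum(2))
    show int: "integrable torus (\<lambda>x. c l * (fourier_mode l x * cnj (g x)))" for l
      by (rule torus.integrable_const_bound[of _ "B * B"])
        (auto simp: norm_mult intro!: mult_mono gB cB B0)
    show "(\<lambda>l. \<integral>x. cmod (c l * (fourier_mode l x * cnj (g x))) \<partial>torus) summable_on UNIV"
    proof (rule summable_on_comparison_test)
      show "(\<lambda>l. norm (c l) * (B * (2 * pi) ^ 3)) summable_on UNIV"
        by (rule summable_on_cmult_left[OF c])
      have "(\<integral>x. cmod (c l * (fourier_mode l x * cnj (g x))) \<partial>torus) \<le> (\<integral>x. cmod (c l) * B \<partial>torus)" for l
        by (intro integral_mono integrable_norm int) (auto simp: norm_mult intro!: mult_left_mono gB)
      then show "(\<integral>x. cmod (c l * (fourier_mode l x * cnj (g x))) \<partial>torus) \<le> norm (c l) * (B * (2 * pi) ^ 3)" for l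
        by (simp add: measure_torus mult_ac)
    qed auto
  qed (rule torus.sigma_finite_measure_axioms)
  also have "\<dots> = (\<Sum>\<^sub>\<infinity>k. c k * (cnj (c k) * (2 * pi) ^ 3))"
  proof -
    have "(\<integral>x. fourier_mode k x * cnj (g x) \<partial>torus) = cnj ((2 * pi) ^ 3 * c k)" for k
    proof -
      have "(\<integral>x. fourier_mode k x * cnj (g x) \<partial>torus) = cnj (\<integral>x. g x * fourier_mode (- k) x \<partial>torus)"
        unfolding Bochner_Integration.integral_cnj[symmetric] by (simp add: fourier_mode_uminus mult.commute)
      then show ?thesis
        unfolding g_def integral_fourier_sum[OF c] .
    qed
    then show ?thesis
      by (simp add: mult_ac)
  qed
  also have "\<dots> = complex_of_real ((2 * pi) ^ 3 * (\<Sum>\<^sub>\<infinity>k. (norm (c k))\<^sup>2))"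
  proof -
    have "complex_of_real (\<Sum>\<^sub>\<infinity>k. (norm (c k))\<^sup>2) = (\<Sum>\<^sub>\<infinity>k. c k * cnj (c k))"
      unfolding infsumI[OF has_sum_of_real[OF has_sum_infsum[OF s2]], symmetric] complex_norm_square ..
    then show ?thesis
      unfolding of_real_mult mult.assoc[symmetric] infsum_cmult_left' by simp
  qed
  finally show "(\<integral>x. (norm (\<Sum>\<^sub>\<infinity>k. c k * fourier_mode k x))\<^sup>2 \<partial>torus) = (2 * pi) ^ 3 * (\<Sum>\<^sub>\<infinity>k. (norm (c k))\<^sup>2)"
    unfolding g_def of_real_eq_iff .
qed

text \<open>The squared L^2 distance between \<open>f\<close> and a partial sum \<open>p\<close> of
  its series is nonnegative; expanding it leaves the integral of f^2 minus the sum over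
  \<open>K\<close>. For merely bounded functions this replaces Parseval, which is proved here only
  for absolutely summable coefficients.\<close>

lemma bessel:
  assumes [measurable]: "f \<in> borel_measurable torus" and bd: "AE x in torus. \<bar>f x\<bar> \<le> M"
  shows "(\<lambda>k. (norm (fourier_coeff f k))\<^sup>2) summable_on UNIV"
    and "(2 * pi) ^ 3 * (\<Sum>\<^sub>\<infinity>k. (norm (fourier_coeff f k))\<^sup>2) \<le> (\<integral>x. (f x)\<^sup>2 \<partial>torus)"
proof -
  define c where "c = fourier_coeff f"
  have fM: "integrable torus (\<lambda>x. (f x)\<^sup>2)"
  proof (rule torus.integrable_const_bound[of _ "M\<^sup>2"])
    show "AE x in torus. norm ((f x)\<^sup>2) \<le> M\<^sup>2"
      using bd by eventually_elim (simp add: abs_le_square_iff power2_le_iff_abs_le)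
  qed simp
  have fi: "integrable torus (\<lambda>x. complex_of_real (f x) * fourier_mode k x)" for k
    by (rule torus.integrable_const_bound[of _ M]) (use bd in \<open>auto simp: norm_mult\<close>)
  have ci: "(\<integral>x. complex_of_real (f x) * fourier_mode (- k) x \<partial>torus) = (2 * pi) ^ 3 * c k" for k
    by (simp add: c_def fourier_coeff_def scaleR_conv_of_real)
  have cs: "z * cnj z = (complex_of_real (cmod z))\<^sup>2" for z
    using complex_norm_square[of z] by simp
  have fin: "(2 * pi) ^ 3 * (\<Sum>k\<in>K. (norm (c k))\<^sup>2) \<le> (\<integral>x. (f x)\<^sup>2 \<partial>torus)" if "finite K" for K
  proof -
    define p where "p x = (\<Sum>k\<in>K. c k * fourier_mode k x)" for x
    have pc: "continuous_on UNIV p"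
      unfolding p_def by (intro continuous_intros continuous_fourier_mode)
    have cp: "cnj (p x) = (\<Sum>k\<in>K. cnj (c k) * fourier_mode (- k) x)" for x
      by (simp add: p_def fourier_mode_uminus)
    have fp: "complex_of_real (f x) * cnj (p x) = (\<Sum>k\<in>K. cnj (c k) * (complex_of_real (f x) * fourier_mode (- k) x))" for x
      unfolding cp by (simp add: sum_distrib_left mult_ac)
    have ifp: "integrable torus (\<lambda>x. complex_of_real (f x) * cnj (p x))"
      unfolding fp by (intro Bochner_Integration.integrable_sum integrable_mult_right fi)
    have ip: "integrable torus (\<lambda>x. p x * cnj (p x))"
      by (intro integrable_torus_continuous continuous_intros pc)
    have 1: "(\<integral>x. complex_of_real (f x) * cnj (p x) \<partial>torus) = (2 * pi) ^ 3 * (\<Sum>k\<in>K. (norm (c k))\<^sup>2)"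
      unfolding fp
      by (subst Bochner_Integration.integral_sum)
        (auto intro!: integrable_mult_right fi sum.cong
          simp: ci sum_distrib_left cs mult_ac)
    have 2: "(\<integral>x. p x * cnj (p x) \<partial>torus) = (2 * pi) ^ 3 * (\<Sum>k\<in>K. (norm (c k))\<^sup>2)"
    proof -
      have "p x * cnj (p x) = (\<Sum>k\<in>K. \<Sum>l\<in>K. c k * cnj (c l) * (fourier_mode k x * fourier_mode (- l) x))" for x
        unfolding cp unfolding p_def by (simp add: sum_product mult_ac)
      then have "(\<integral>x. p x * cnj (p x) \<partial>torus)
          = (\<integral>x. (\<Sum>k\<in>K. \<Sum>l\<in>K. c k * cnj (c l) * (fourier_mode k x * fourier_mode (- l) x)) \<partial>torus)"
        by simp
      also have "\<dots> = (\<Sum>k\<in>K. \<Sum>l\<in>K. c k * cnj (c l) * (if k = l then (2 * pi) ^ 3 else 0))"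
        unfolding integral_fourier_mode_mult[symmetric]
        by (subst Bochner_Integration.integral_sum,
            (intro integrable_torus_continuous continuous_intros continuous_fourier_mode; fail),
            rule sum.cong, simp, subst Bochner_Integration.integral_sum,
            (intro integrable_torus_continuous continuous_intros continuous_fourier_mode; fail),
            simp)
      also have "\<dots> = (\<Sum>k\<in>K. (2 * pi) ^ 3 * of_real ((norm (c k))\<^sup>2))"
        using that by (simp add: if_distrib cs mult_ac cong: if_cong)
      finally show ?thesis
        by (simp add: sum_distrib_left)
    qed
    have "0 \<le> (\<integral>x. (norm (complex_of_real (f x) - p x))\<^sup>2 \<partial>torus)"
      by simp
    also have "(\<lambda>x. (norm (complex_of_real (f x) - p x))\<^sup>2)
        = (\<lambda>x. (f x)\<^sup>2 - 2 * Re (complex_of_real (f x) * cnj (p x)) + Re (p x * cnj (p x)))"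
      unfolding cmod_power2 by (intro ext) (simp add: power2_eq_square algebra_simps)
    also have "(\<integral>x. (f x)\<^sup>2 - 2 * Re (complex_of_real (f x) * cnj (p x)) + Re (p x * cnj (p x)) \<partial>torus)
        = (\<integral>x. (f x)\<^sup>2 \<partial>torus) - 2 * Re (\<integral>x. complex_of_real (f x) * cnj (p x) \<partial>torus)
          + Re (\<integral>x. p x * cnj (p x) \<partial>torus)"
      using fM ifp ip by (simp add: integrable_Re integral_Re del: times_complex.sel complex_cnj)
    also have "\<dots> = (\<integral>x. (f x)\<^sup>2 \<partial>torus) - (2 * pi) ^ 3 * (\<Sum>k\<in>K. (norm (c k))\<^sup>2)"
      unfolding 1 2 Re_complex_of_real by simp
    finally show ?thesis
      by simp
  qed
  have fin': "(\<Sum>k\<in>K. (norm (c k))\<^sup>2) \<le> (\<integral>x. (f x)\<^sup>2 \<partial>torus) / (2 * pi) ^ 3" if "finite K" for K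
    using fin[OF that] by (simp add: field_simps)
  show s: "(\<lambda>k. (norm (fourier_coeff f k))\<^sup>2) summable_on UNIV"
    unfolding c_def[symmetric]
    by (rule nonneg_bdd_above_summable_on) (auto intro!: bdd_aboveI2 fin')
  have "(\<Sum>\<^sub>\<infinity>k. (norm (c k))\<^sup>2) \<le> (\<integral>x. (f x)\<^sup>2 \<partial>torus) / (2 * pi) ^ 3"
    using s unfolding c_def[symmetric] by (rule infsum_le_finite_sums) (rule fin')
  then show "(2 * pi) ^ 3 * (\<Sum>\<^sub>\<infinity>k. (norm (fourier_coeff f k))\<^sup>2) \<le> (\<integral>x. (f x)\<^sup>2 \<partial>torus)"
    by (simp add: c_def field_simps)
qed

lemma fourier_series_nth:
  assumes "(\<lambda>k. norm (a k)) summable_on UNIV"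
  shows "fourier_series a x $ i = (\<Sum>\<^sub>\<infinity>k. a k $ i * fourier_mode k x)"
    and "(\<lambda>k. norm (a k $ i)) summable_on UNIV"
    and "(\<lambda>k. fourier_mode k x *s a k) summable_on UNIV"
proof -
  show s: "(\<lambda>k. fourier_mode k x *s a k) summable_on UNIV"
    by (rule abs_summable_summable) (simp add: norm_vector_smult assms)
  have "bounded_linear (\<lambda>v::complex^3. v $ i)"
    by (rule bounded_linear_vec_nth)
  from infsum_bounded_linear_strong[OF _ this, of "\<lambda>k. fourier_mode k x *s a k" UNIV] summable_on_bounded_linear[OF this s] s
  show "fourier_series a x $ i = (\<Sum>\<^sub>\<infinity>k. a k $ i * fourier_mode k x)"
    by (simp add: fourier_series_def o_def mult.commute)
  show "(\<lambda>k. norm (a k $ i)) summable_on UNIV"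
    by (rule summable_on_comparison_test[OF assms]) (auto intro: Finite_Cartesian_Product.norm_nth_le)
qed

section \<open>The nonlinearity on Fourier coefficients\<close>

lemma bij_diff_right: "bij_betw (\<lambda>k. k - l) UNIV (UNIV :: 'a::group_add set)"
  by (rule bij_betw_byWitness[where f'="\<lambda>k. k + l"]) auto

lemma bij_diff_left: "bij_betw (\<lambda>l. k - l) UNIV (UNIV :: 'a::ab_group_add set)"
  by (rule bij_betw_byWitness[where f'="\<lambda>l. k - l"]) auto

lemma bij_neg: "bij_betw uminus UNIV (UNIV :: 'a::group_add set)"
  by (rule bij_betw_byWitness[where f'=uminus]) auto

lemma power2_of_int_unit: "\<bar>j\<bar> = 1 \<Longrightarrow> (real_of_int j)\<^sup>2 = 1"
  by (cases "j \<ge> 0") auto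

lemma freq_norm_sq_nonneg [simp]: "0 \<le> freq_norm_sq k"
  by (simp add: freq_norm_sq_def sum_nonneg)

lemma freq_norm_sq_uminus [simp]: "freq_norm_sq (- k) = freq_norm_sq k"
  by (simp add: freq_norm_sq_def)

lemma freq_norm_sq_3: "freq_norm_sq k = (of_int (k $ 1))\<^sup>2 + (of_int (k $ 2))\<^sup>2 + (of_int (k $ 3))\<^sup>2"
  by (simp add: freq_norm_sq_def sum_3)

lemma abs_le_sqrt_freq_norm_sq: "\<bar>of_int (k $ j)\<bar> \<le> sqrt (freq_norm_sq k)"
proof -
  have "(of_int (k $ j))\<^sup>2 \<le> freq_norm_sq k"
    unfolding freq_norm_sq_def by (rule member_le_sum) auto
  then show ?thesis
    using real_le_rsqrt by fastforce
qed

lemma freq_norm_sq_pos [simp]: "0 < 1 + freq_norm_sq k" "1 + freq_norm_sq k \<noteq> 0"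
  using freq_norm_sq_nonneg[of k] by linarith+

text \<open>The exponent 4 leaves room: after multiplication by 1 + |k|^2, hence after one
  derivative, the family is still summable on Z^3.\<close>

definition wt :: "int^3 \<Rightarrow> real" where
  "wt k = 1 / (1 + freq_norm_sq k) ^ 4"

lemma wt_pos: "0 < wt k"
  unfolding wt_def by (intro divide_pos_pos zero_less_power freq_norm_sq_pos) simp

lemma wt_nonneg [simp]: "0 \<le> wt k"
  using wt_pos[of k] by simp

lemma summable_on_nat_abs:
  fixes f :: "nat \<Rightarrow> real"
  assumes "f summable_on UNIV"
  shows "(\<lambda>n::int. f (nat \<bar>n\<bar>)) summable_on UNIV"
proof -
  have "(\<lambda>n. f (nat \<bar>n\<bar>)) summable_on range int" "(\<lambda>n. f (nat \<bar>n\<bar>)) summable_on range (\<lambda>n. - int n)"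
    by (subst summable_on_reindex; use assms in \<open>auto simp: o_def inj_on_def\<close>)+
  then have "(\<lambda>n. f (nat \<bar>n\<bar>)) summable_on (range int \<union> range (\<lambda>n. - int n))"
    by (rule summable_on_union)
  moreover have "range int \<union> range (\<lambda>n. - int n) = UNIV"
  proof -
    have "n \<in> range int \<union> range (\<lambda>n. - int n)" for n
      by (cases n rule: int_cases2) auto
    then show ?thesis by blast
  qed
  ultimately show ?thesis by simp
qed

lemma summable_inverse_square_int: "(\<lambda>n::int. 1 / (1 + (of_int n)\<^sup>2) :: real) summable_on UNIV"
proof -
  have "summable (\<lambda>n. 1 / (1 + (real n)\<^sup>2))"
  proof (rule summable_comparison_test)
    show "\<exists>N. \<forall>n\<ge>N. norm (1 / (1 + (real n)\<^sup>2)) \<le> inverse ((real n) ^ 2)"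
      by (intro exI[of _ 1]) (auto simp: field_simps add_pos_nonneg)
    show "summable (\<lambda>n. inverse ((real n) ^ 2))"
      by (rule inverse_power_summable) simp
  qed
  then have nat: "(\<lambda>n. 1 / (1 + (real n)\<^sup>2)) summable_on UNIV"
    by (simp add: summable_on_UNIV_nonneg_real_iff)
  from summable_on_nat_abs[OF nat] show ?thesis
    by simp
qed

text \<open>Each of the three factors \<open>1 + freq_norm_sq k\<close> dominates one factor 1 +
  k_j^2, so the product of three convergent one-dimensional series is a majorant.\<close>

lemma summable_inverse_cube: "(\<lambda>k. 1 / (1 + freq_norm_sq k) ^ 3) summable_on UNIV"
proof -
  define g :: "int \<Rightarrow> real" where "g n = 1 / (1 + (of_int n)\<^sup>2)" for n
  have g0: "0 \<le> g n" for n
    by (simp add: g_def add_nonneg_nonneg)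
  have gs: "g summable_on UNIV"
    using summable_inverse_square_int by (simp add: g_def[abs_def])
  define S where "S = infsum g UNIV"
  have fin: "(\<Sum>k\<in>F. g (k $ 1) * (g (k $ 2) * g (k $ 3))) \<le> S * (S * S)" if "finite F" for F :: "(int^3) set"
  proof -
    \<comment> \<open>\<open>G\<close> collects all coordinates occurring in \<open>F\<close>, so
      that \<open>F\<close> embeds into the cube over \<open>G\<close>, on which the sum
      factorises.\<close>
    define G where "G = (\<Union>k\<in>F. {k $ 1, k $ 2, k $ 3})"
    have fG: "finite G"
      using that by (simp add: G_def)
    have "(\<Sum>k\<in>F. g (k $ 1) * (g (k $ 2) * g (k $ 3)))
        = (\<Sum>p\<in>(\<lambda>k. (k $ 1, k $ 2, k $ 3)) ` F. g (fst p) * (g (fst (snd p)) * g (snd (snd p))))"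
      by (subst sum.reindex) (auto simp: inj_on_def vec_eq_iff forall_3)
    also have "\<dots> \<le> (\<Sum>p\<in>G \<times> (G \<times> G). g (fst p) * (g (fst (snd p)) * g (snd (snd p))))"
      by (rule sum_mono2) (use fG in \<open>auto simp: G_def intro!: mult_nonneg_nonneg g0\<close>)
    also have "\<dots> = (\<Sum>a\<in>G. \<Sum>q\<in>G \<times> G. g a * (g (fst q) * g (snd q)))"
      by (simp add: sum.cartesian_product case_prod_beta)
    also have "\<dots> = (\<Sum>a\<in>G. g a * (\<Sum>b\<in>G. \<Sum>c\<in>G. g b * g c))"
      by (simp add: sum.cartesian_product case_prod_beta sum_distrib_left)
    also have "\<dots> = sum g G * (sum g G * sum g G)"
      unfolding sum_product[symmetric] sum_distrib_right[symmetric] ..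
    also have "\<dots> \<le> S * (S * S)"
      using finite_sum_le_infsum[OF gs fG] g0
      by (intro mult_mono) (auto simp: S_def intro!: sum_nonneg infsum_nonneg mult_nonneg_nonneg)
    finally show ?thesis .
  qed
  have "(\<lambda>k::int^3. g (k $ 1) * (g (k $ 2) * g (k $ 3))) summable_on UNIV"
    by (rule nonneg_bdd_above_summable_on) (auto intro!: bdd_aboveI2 fin mult_nonneg_nonneg g0)
  then show ?thesis
  proof (rule summable_on_comparison_test)
    fix k :: "int^3"
    have "(1 + (of_int (k $ 1))\<^sup>2) * ((1 + (of_int (k $ 2))\<^sup>2) * (1 + (of_int (k $ 3))\<^sup>2))
        \<le> (1 + freq_norm_sq k) * ((1 + freq_norm_sq k) * (1 + freq_norm_sq k))"
      by (intro mult_mono) (auto simp: freq_norm_sq_3 intro!: mult_nonneg_nonneg add_nonneg_nonneg)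
    then show "1 / (1 + freq_norm_sq k) ^ 3 \<le> g (k $ 1) * (g (k $ 2) * g (k $ 3))"
      unfolding g_def by (simp add: power3_eq_cube mult.assoc) (intro divide_left_mono mult_pos_pos; simp add: add_pos_nonneg)
  qed (simp add: add_nonneg_nonneg)
qed

lemma summable_freq_wt: "(\<lambda>k. (1 + freq_norm_sq k) * wt k) summable_on UNIV"
proof -
  have "x * (1 / x ^ 4) = 1 / x ^ 3" if "x \<noteq> 0" for x :: real
    using that by (simp add: eval_nat_numeral)
  then have "(1 + freq_norm_sq k) * wt k = 1 / (1 + freq_norm_sq k) ^ 3" for k
    unfolding wt_def using freq_norm_sq_pos(2) by blast
  then show ?thesis
    using summable_inverse_cube by simp
qed

lemma sqrt_le_1_plus: "0 \<le> x \<Longrightarrow> sqrt x \<le> 1 + (x::real)"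
  by (rule real_le_lsqrt) (auto simp: power2_eq_square algebra_simps intro: add_nonneg_nonneg)

lemma summable_sqrt_wt: "(\<lambda>k. sqrt (freq_norm_sq k) * wt k) summable_on UNIV"
  by (rule summable_on_comparison_test[OF summable_freq_wt])
    (auto intro!: mult_right_mono sqrt_le_1_plus)

lemma summable_wt: "wt summable_on UNIV"
  by (rule summable_on_comparison_test[OF summable_freq_wt])
    (auto simp: algebra_simps intro!: mult_nonneg_nonneg)

lemma summable_wt_shift: "(\<lambda>l. wt (k - l)) summable_on UNIV" "(\<Sum>\<^sub>\<infinity>l. wt (k - l)) = (\<Sum>\<^sub>\<infinity>l. wt l)"
proof -
  show "(\<lambda>l. wt (k - l)) summable_on UNIV" "(\<Sum>\<^sub>\<infinity>l. wt (k - l)) = (\<Sum>\<^sub>\<infinity>l. wt l)"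
    using summable_on_reindex_bij_betw[OF bij_diff_left, of wt] infsum_reindex_bij_betw[OF bij_diff_left, of wt] summable_wt
    by auto
qed

text \<open>Since k = l + (k - l), the quantity 1 + |k|^2 is at most twice the sum of its values at
  l and k - l. Fourth powers give 128 = 2^4 * 8, the 8 coming from (x + y)^4 \<le> 8 (x^4 + y^4); it
  remains to divide by the three fourth powers.\<close>

lemma wt_mult_wt_le: "wt l * wt (k - l) \<le> 128 * wt k * (wt l + wt (k - l))"
proof -
  define x where "x = 1 + freq_norm_sq l"
  define y where "y = 1 + freq_norm_sq (k - l)"
  define z where "z = 1 + freq_norm_sq k"
  have pos: "x > 0" "y > 0" "z > 0"
    by (simp_all add: x_def y_def z_def add_pos_nonneg)
  have sq: "a\<^sup>2 \<le> 2 * b\<^sup>2 + 2 * (a - b)\<^sup>2" for a b :: real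
    using zero_le_power2[of "a - 2 * b"] by (simp add: power2_eq_square algebra_simps)
  have "z \<le> 2 * x + 2 * y"
    unfolding x_def y_def z_def freq_norm_sq_3
    using sq[of "of_int (k $ 1)" "of_int (l $ 1)"] sq[of "of_int (k $ 2)" "of_int (l $ 2)"]
      sq[of "of_int (k $ 3)" "of_int (l $ 3)"] by simp
  then have "z ^ 4 \<le> (2 * x + 2 * y) ^ 4"
    using pos by (intro power_mono) auto
  also have "\<dots> \<le> 128 * (x ^ 4 + y ^ 4)"
  proof -
    have two: "(a + b)\<^sup>2 \<le> 2 * (a\<^sup>2 + b\<^sup>2)" for a b :: real
      using sum_squares_bound[of a b] by (simp add: power2_eq_square algebra_simps)
    have "((x + y)\<^sup>2)\<^sup>2 \<le> (2 * (x\<^sup>2 + y\<^sup>2))\<^sup>2"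
      by (intro power_mono two) auto
    also have "\<dots> = 4 * (x\<^sup>2 + y\<^sup>2)\<^sup>2"
      unfolding power_mult_distrib by simp
    also have "\<dots> \<le> 4 * (2 * ((x\<^sup>2)\<^sup>2 + (y\<^sup>2)\<^sup>2))"
      by (intro mult_left_mono two) auto
    finally have "(x + y) ^ 4 \<le> 8 * (x ^ 4 + y ^ 4)"
      by (simp flip: power_mult)
    moreover have "(2 * x + 2 * y) ^ 4 = 16 * (x + y) ^ 4"
      unfolding distrib_left[symmetric] power_mult_distrib by simp
    ultimately show ?thesis
      by simp
  qed
  finally have "1 / (x ^ 4 * y ^ 4) \<le> 128 * (1 / z ^ 4) * (1 / x ^ 4 + 1 / y ^ 4)"
    using pos by (simp add: field_simps)
  then show ?thesis
    by (simp add: wt_def x_def y_def z_def)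
qed

text \<open>256 is twice 128: over \<open>l\<close> the two families \<open>wt l\<close> and
  \<open>wt (k - l)\<close> have the same sum.\<close>

definition Kw :: real where "Kw = 256 * (\<Sum>\<^sub>\<infinity>l. wt l)"

lemma summable_wt_conv: "(\<lambda>l. wt l * wt (k - l)) summable_on UNIV"
  and wt_conv_le: "(\<Sum>\<^sub>\<infinity>l. wt l * wt (k - l)) \<le> Kw * wt k"
proof -
  have s: "(\<lambda>l. 128 * wt k * (wt l + wt (k - l))) summable_on UNIV"
    by (intro summable_on_cmult_right summable_on_add summable_wt summable_wt_shift)
  show *: "(\<lambda>l. wt l * wt (k - l)) summable_on UNIV"
    by (rule summable_on_comparison_test[OF s]) (auto simp: wt_mult_wt_le)
  have "(\<Sum>\<^sub>\<infinity>l. wt l * wt (k - l)) \<le> (\<Sum>\<^sub>\<infinity>l. 128 * wt k * (wt l + wt (k - l)))"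
    by (rule infsum_mono[OF * s wt_mult_wt_le])
  also have "\<dots> = Kw * wt k"
    by (subst infsum_cmult_right')
      (simp add: infsum_add[OF summable_wt summable_wt_shift(1)] summable_wt_shift(2) Kw_def)
  finally show "(\<Sum>\<^sub>\<infinity>l. wt l * wt (k - l)) \<le> Kw * wt k" .
qed

lemma Kw_pos: "0 < Kw"
proof -
  have "wt 0 \<le> (\<Sum>\<^sub>\<infinity>l. wt l)"
    using finite_sum_le_infsum[OF summable_wt, of "{0}"] by simp
  then show ?thesis
    using wt_pos[of 0] by (simp add: Kw_def)
qed

section \<open>The bilinear nonlinearity on weighted coefficient families\<close>

definition conv :: "(int^3 \<Rightarrow> complex^3) \<Rightarrow> (int^3 \<Rightarrow> complex^3) \<Rightarrow> int^3 \<Rightarrow> complex^3^3" where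
  "conv a b k = (\<chi> i j. \<Sum>\<^sub>\<infinity>l. a l $ i * b (k - l) $ j)"

text \<open>The term P div (a tensor b) of the equation, for fields given by their Fourier
  coefficients.\<close>

definition adv :: "(int^3 \<Rightarrow> complex^3) \<Rightarrow> (int^3 \<Rightarrow> complex^3) \<Rightarrow> int^3 \<Rightarrow> complex^3" where
  "adv a b = leray (div_tensor (conv a b))"

lemma conv_term_le:
  assumes "\<And>k. norm (a k) \<le> A * wt k" "\<And>k. norm (b k) \<le> B * wt k"
  shows "cmod (a l $ i * b (k - l) $ j) \<le> A * B * (wt l * wt (k - l))"
proof -
  have "cmod (a l $ i) \<le> A * wt l" "cmod (b (k - l) $ j) \<le> B * wt (k - l)"
    using assms Finite_Cartesian_Product.norm_nth_le order_trans by blast+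
  then have "cmod (a l $ i) * cmod (b (k - l) $ j) \<le> (A * wt l) * (B * wt (k - l))"
    by (intro mult_mono) (auto intro: order_trans[OF norm_ge_zero])
  then show ?thesis
    by (simp add: norm_mult mult_ac)
qed

lemma summable_conv:
  assumes "\<And>k. norm (a k) \<le> A * wt k" "\<And>k. norm (b k) \<le> B * wt k"
  shows "(\<lambda>l. cmod (a l $ i * b (k - l) $ j)) summable_on UNIV"
    "(\<lambda>l. a l $ i * b (k - l) $ j) summable_on UNIV"
proof -
  have "(\<lambda>l. A * B * (wt l * wt (k - l))) summable_on UNIV"
    by (intro summable_on_cmult_right summable_wt_conv)
  then show "(\<lambda>l. cmod (a l $ i * b (k - l) $ j)) summable_on UNIV"
    by (rule summable_on_comparison_test) (auto intro: conv_term_le[OF assms])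
  then show "(\<lambda>l. a l $ i * b (k - l) $ j) summable_on UNIV"
    by (rule abs_summable_summable)
qed

lemma norm_conv_le:
  assumes "\<And>k. norm (a k) \<le> A * wt k" "\<And>k. norm (b k) \<le> B * wt k" "0 \<le> A * B"
  shows "cmod (conv a b k $ i $ j) \<le> A * B * (Kw * wt k)"
proof -
  have s: "(\<lambda>l. A * B * (wt l * wt (k - l))) summable_on UNIV"
    by (intro summable_on_cmult_right summable_wt_conv)
  have "cmod (conv a b k $ i $ j) \<le> (\<Sum>\<^sub>\<infinity>l. cmod (a l $ i * b (k - l) $ j))"
    unfolding conv_def using norm_infsum_bound[OF summable_conv(1)[OF assms(1,2), of i k j]] by simp
  also have "\<dots> \<le> (\<Sum>\<^sub>\<infinity>l. A * B * (wt l * wt (k - l)))"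
    by (rule infsum_mono[OF summable_conv(1)[OF assms(1,2)] s conv_term_le[OF assms(1,2)]])
  also have "\<dots> \<le> A * B * (Kw * wt k)"
    unfolding infsum_cmult_right' by (rule mult_left_mono[OF wt_conv_le assms(3)])
  finally show ?thesis .
qed

text \<open>With S the sum of the |D_j|, where D is the divergence, the projection changes each
  component by at most S: one factor |k| sits in k_i, one in the scalar product, and both cancel
  against |k|^2. Adding the three components gives S + 3 S, hence the factor 4. At k = 0 the
  quotient is 0 by convention.\<close>

lemma norm_leray_div_le:
  "norm (leray (div_tensor A) k) \<le> 4 * sqrt (freq_norm_sq k) * (\<Sum>i\<in>UNIV. \<Sum>j\<in>UNIV. cmod (A k $ i $ j))"
proof -
  define q where "q = freq_norm_sq k"
  define D where "D = div_tensor A k"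
  define S where "S = (\<Sum>j\<in>UNIV. cmod (D $ j))"
  have q0: "0 \<le> q" and S0: "0 \<le> S"
    by (simp_all add: q_def S_def sum_nonneg)
  have kq: "cmod (of_int (k $ j)) \<le> sqrt q" for j
    using abs_le_sqrt_freq_norm_sq[of k j] by (simp add: q_def)
  have "cmod (D $ i) \<le> sqrt q * (\<Sum>j\<in>UNIV. cmod (A k $ i $ j))" for i
  proof -
    have "cmod (D $ i) \<le> (\<Sum>j\<in>UNIV. cmod (\<i> * of_int (k $ j) * A k $ i $ j))"
      unfolding D_def div_tensor_def vec_lambda_beta by (rule norm_sum)
    also have "\<dots> \<le> (\<Sum>j\<in>UNIV. sqrt q * cmod (A k $ i $ j))"
      using kq by (intro sum_mono) (simp add: norm_mult mult_right_mono)
    finally show ?thesis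
      by (simp add: sum_distrib_left)
  qed
  then have SA: "S \<le> sqrt q * (\<Sum>i\<in>UNIV. \<Sum>j\<in>UNIV. cmod (A k $ i $ j))"
    unfolding S_def sum_distrib_left[of "sqrt q" "\<lambda>i. \<Sum>j\<in>UNIV. cmod (A k $ i $ j)"] by (rule sum_mono)
  have kD: "cmod (\<Sum>j\<in>UNIV. of_int (k $ j) * D $ j) \<le> sqrt q * S"
  proof -
    have "cmod (\<Sum>j\<in>UNIV. of_int (k $ j) * D $ j) \<le> (\<Sum>j\<in>UNIV. cmod (of_int (k $ j) * D $ j))"
      by (rule norm_sum)
    also have "\<dots> \<le> (\<Sum>j\<in>UNIV. sqrt q * cmod (D $ j))"
      using kq by (intro sum_mono) (simp add: norm_mult mult_right_mono)
    finally show ?thesis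
      by (simp add: S_def sum_distrib_left)
  qed
  have "cmod (leray (div_tensor A) k $ i) \<le> cmod (D $ i) + S" for i
  proof -
    have "cmod (of_int (k $ i) * (\<Sum>j\<in>UNIV. of_int (k $ j) * D $ j) / complex_of_real q) \<le> S"
    proof (cases "q = 0")
      case False
      have "cmod (of_int (k $ i)) * cmod (\<Sum>j\<in>UNIV. of_int (k $ j) * D $ j) \<le> sqrt q * (sqrt q * S)"
        by (intro mult_mono kq kD) (auto simp: q0)
      also have "\<dots> = q * S"
        using q0 by (simp flip: mult.assoc)
      finally show ?thesis
        using False q0 by (simp add: norm_divide norm_mult divide_le_eq mult.commute)
    qed (simp add: S0)
    then show ?thesis
      unfolding leray_def vec_lambda_beta D_def[symmetric] q_def[symmetric]
      by (intro order_trans[OF norm_triangle_ineq4] add_mono) auto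
  qed
  then have "norm (leray (div_tensor A) k) \<le> (\<Sum>i\<in>UNIV. cmod (D $ i) + S)"
    by (intro order_trans[OF norm_vec_le_sum] sum_mono)
  also have "\<dots> = 4 * S"
    by (simp add: sum.distrib S_def[symmetric])
  finally show ?thesis
    using SA by (simp add: q_def)
qed

lemma leray_div_diff:
  "leray (div_tensor (\<lambda>k. A k - B k)) k = leray (div_tensor A) k - leray (div_tensor B) k"
  by (simp add: leray_def div_tensor_def vec_eq_iff sum_subtractf algebra_simps diff_divide_distrib)

lemma leray_div_add:
  "leray (div_tensor (\<lambda>k. A k + B k)) k = leray (div_tensor A) k + leray (div_tensor B) k"
  by (simp add: leray_def div_tensor_def vec_eq_iff sum.distrib algebra_simps add_divide_distrib)

lemma leray_div_cong: "A k = B k \<Longrightarrow> leray (div_tensor A) k = leray (div_tensor B) k"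
  by (simp add: leray_def div_tensor_def)

text \<open>36 = 4 * 9: the factor of the projection times the nine entries of the tensor.\<close>

definition Cadv :: real where "Cadv = 36 * Kw"

lemma Cadv_pos: "0 < Cadv"
  using Kw_pos by (simp add: Cadv_def)

lemma norm_adv_le:
  assumes "\<And>k. norm (a k) \<le> A * wt k" "\<And>k. norm (b k) \<le> B * wt k" "0 \<le> A * B"
  shows "norm (adv a b k) \<le> Cadv * (A * B) * (sqrt (freq_norm_sq k) * wt k)"
proof -
  have "(\<Sum>i\<in>UNIV. \<Sum>j\<in>UNIV. cmod (conv a b k $ i $ j)) \<le> (\<Sum>i\<in>(UNIV::3 set). \<Sum>j\<in>(UNIV::3 set). A * B * (Kw * wt k))"
    by (intro sum_mono norm_conv_le assms)
  then have "4 * sqrt (freq_norm_sq k) * (\<Sum>i\<in>UNIV. \<Sum>j\<in>UNIV. cmod (conv a b k $ i $ j))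
      \<le> 4 * sqrt (freq_norm_sq k) * (9 * (A * B * (Kw * wt k)))"
    by (intro mult_left_mono) auto
  then show ?thesis
    unfolding adv_def using norm_leray_div_le[of "conv a b" k] by (simp add: Cadv_def mult_ac)
qed

text \<open>Polarisation a a - b b = (a - b) a + b (a - b); the bounds by \<open>wt\<close> are what
  allows the convolution series to be split.\<close>

lemma adv_diff:
  assumes "\<And>k. norm (a k) \<le> A * wt k" "\<And>k. norm (b k) \<le> B * wt k"
  shows "adv a a k - adv b b k = adv (\<lambda>k. a k - b k) a k + adv b (\<lambda>k. a k - b k) k"
proof -
  have d: "norm (a k - b k) \<le> (A + B) * wt k" for k
    using norm_triangle_ineq4[of "a k" "b k"] assms(1)[of k] assms(2)[of k]
    by (simp add: distrib_right)
  have "conv a a k $ i $ j - conv b b k $ i $ j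
      = conv (\<lambda>k. a k - b k) a k $ i $ j + conv b (\<lambda>k. a k - b k) k $ i $ j" for k i j
  proof -
    have "conv a a k $ i $ j + - conv b b k $ i $ j
        = (\<Sum>\<^sub>\<infinity>l. a l $ i * a (k - l) $ j + - (b l $ i * b (k - l) $ j))"
      unfolding conv_def vec_lambda_beta infsum_uminus[symmetric]
      by (rule infsum_add[symmetric])
        (simp_all add: summable_on_uminus summable_conv(2)[OF assms(1) assms(1)] summable_conv(2)[OF assms(2) assms(2)])
    also have "\<dots> = (\<Sum>\<^sub>\<infinity>l. (a l - b l) $ i * a (k - l) $ j + b l $ i * (a (k - l) - b (k - l)) $ j)"
      by (rule infsum_cong) (simp add: algebra_simps)
    also have "\<dots> = conv (\<lambda>k. a k - b k) a k $ i $ j + conv b (\<lambda>k. a k - b k) k $ i $ j"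
      unfolding conv_def vec_lambda_beta
      by (rule infsum_add) (rule summable_conv(2)[OF d assms(1)] summable_conv(2)[OF assms(2) d])+
    finally show ?thesis by simp
  qed
  then have *: "conv a a k = conv b b k + conv (\<lambda>k. a k - b k) a k + conv b (\<lambda>k. a k - b k) k" for k
    by (simp add: vec_eq_iff diff_eq_eq add_ac)
  have "adv a a k = leray (div_tensor (\<lambda>k. conv b b k + (conv (\<lambda>k. a k - b k) a k + conv b (\<lambda>k. a k - b k) k))) k"
    unfolding adv_def by (rule leray_div_cong) (simp add: * add.assoc)
  also have "\<dots> = adv b b k + (adv (\<lambda>k. a k - b k) a k + adv b (\<lambda>k. a k - b k) k)"
    unfolding leray_div_add adv_def ..
  finally show ?thesis
    by simp
qed

text \<open>The condition on coefficients that makes the Fourier sum real valued.\<close>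

definition hermitian :: "(int^3 \<Rightarrow> complex^3) \<Rightarrow> bool" where
  "hermitian a \<longleftrightarrow> (\<forall>k i. a (- k) $ i = cnj (a k $ i))"

lemma hermitian_adv:
  assumes "hermitian a" "hermitian b"
  shows "hermitian (adv a b)"
proof -
  have "conv a b (- k) $ i $ j = (\<Sum>\<^sub>\<infinity>l. a (- l) $ i * b (- k - (- l)) $ j)" for k i j
    unfolding conv_def vec_lambda_beta by (rule infsum_reindex_bij_betw[OF bij_neg, symmetric])
  moreover have "a (- l) $ i * b (- k - (- l)) $ j = cnj (a l $ i * b (k - l) $ j)" for k l i j
  proof -
    have "b (- k - (- l)) $ j = cnj (b (k - l) $ j)"
      using assms(2)[unfolded hermitian_def, rule_format, of "k - l" j] by simp
    then show ?thesis
      using assms(1) by (simp add: hermitian_def)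
  qed
  ultimately have "conv a b (- k) $ i $ j = cnj (conv a b k $ i $ j)" for k i j
    by (simp only: infsum_cnj) (simp only: conv_def vec_lambda_beta)
  then show ?thesis
    by (simp add: hermitian_def adv_def leray_def div_tensor_def sum_negf)
qed

lemma continuous_on_infsum:
  fixes f :: "'k \<Rightarrow> 'a::topological_space \<Rightarrow> 'b::banach"
  assumes "\<And>k. continuous_on S (f k)" "\<And>k x. x \<in> S \<Longrightarrow> norm (f k x) \<le> M k" "M summable_on UNIV"
  shows "continuous_on S (\<lambda>x. \<Sum>\<^sub>\<infinity>k. f k x)"
proof (rule uniform_limit_theorem)
  show "uniform_limit S (\<lambda>X x. \<Sum>k\<in>X. f k x) (\<lambda>x. \<Sum>\<^sub>\<infinity>k. f k x) (finite_subsets_at_top UNIV)"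
    by (rule Weierstrass_m_test_general) (use assms in auto)
qed (auto intro!: always_eventually continuous_on_sum assms(1))

text \<open>The bounds are uniform in \<open>t\<close>, so the Weierstrass M-test applies to the
  convolution series. Continuity in time reduces the Duhamel integrals of coefficients to integrals
  of continuous functions.\<close>

lemma continuous_on_adv:
  assumes "\<And>k. continuous_on S (\<lambda>t. a t k)" "\<And>k. continuous_on S (\<lambda>t. b t k)"
    and "\<And>t k. t \<in> S \<Longrightarrow> norm (a t k) \<le> A * wt k" "\<And>t k. t \<in> S \<Longrightarrow> norm (b t k) \<le> B * wt k"
  shows "continuous_on S (\<lambda>t. adv (a t) (b t) k)"
proof -
  have "continuous_on S (\<lambda>t. conv (a t) (b t) k $ i $ j)" for i j
    unfolding conv_def vec_lambda_beta
  proof (rule continuous_on_infsum)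
    show "continuous_on S (\<lambda>x. a x l $ i * b x (k - l) $ j)" for l
      by (intro continuous_intros assms)
    show "cmod (a x l $ i * b x (k - l) $ j) \<le> A * B * (wt l * wt (k - l))" if "x \<in> S" for l x
      by (rule conv_term_le) (use assms that in auto)
    show "(\<lambda>l. A * B * (wt l * wt (k - l))) summable_on UNIV"
      by (intro summable_on_cmult_right summable_wt_conv)
  qed
  note conv = this
  have "continuous_on S (\<lambda>t. div_tensor (conv (a t) (b t)) k $ i)" for i
    unfolding div_tensor_def vec_lambda_beta
    by (intro continuous_on_sum continuous_on_mult continuous_on_const conv)
  then have "continuous_on S (\<lambda>t. adv (a t) (b t) k $ i)" for i
    unfolding adv_def leray_def vec_lambda_beta divide_inverse
    by (intro continuous_on_sum continuous_on_diff continuous_on_mult continuous_on_const)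
  then show ?thesis
    using continuous_on_vec_lambda[of S "\<lambda>i t. adv (a t) (b t) k $ i"] by simp
qed

section \<open>Uniqueness of mild solutions\<close>

text \<open>The operator exp(\<tau> Laplace) P div, whose kernel is the gradient of the Oseen
  kernel; it is applied to tensors that are merely bounded.\<close>

definition oseen :: "real \<Rightarrow> (real^3 \<Rightarrow> real^3^3) \<Rightarrow> int^3 \<Rightarrow> complex^3" where
  "oseen \<tau> F = heat \<tau> (leray (div_tensor (fourier_tensor F)))"

definition bounded_tensor :: "real \<Rightarrow> (real^3 \<Rightarrow> real^3^3) \<Rightarrow> bool" where
  "bounded_tensor M F \<longleftrightarrow> (\<forall>i j. (\<lambda>x. F x $ i $ j) \<in> borel_measurable torus) \<and>
     (\<forall>i j. AE x in torus. \<bar>F x $ i $ j\<bar> \<le> M)"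

lemma fourier_coeff_bound:
  assumes [measurable]: "f \<in> borel_measurable torus" and bd: "AE x in torus. \<bar>f x\<bar> \<le> M"
  shows "norm (fourier_coeff f k) \<le> M"
proof -
  have i: "integrable torus (\<lambda>x. complex_of_real (f x) * fourier_mode (- k) x)"
    by (rule torus.integrable_const_bound[of _ M]) (use bd in \<open>auto simp: norm_mult\<close>)
  have "norm (\<integral>x. complex_of_real (f x) * fourier_mode (- k) x \<partial>torus) \<le> (\<integral>x. M \<partial>torus)"
  proof (intro order_trans[OF integral_norm_bound] integral_mono_AE integrable_norm i torus.integrable_const)
    show "AE x in torus. norm (complex_of_real (f x) * fourier_mode (- k) x) \<le> M"
      using bd by eventually_elim (simp add: norm_mult)
  qed
  then show ?thesis
    by (simp add: fourier_coeff_def measure_torus field_simps)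
qed

text \<open>Applying x \<le> e^x to x = \<tau> z / 4 and raising to the power 4 matches the exponent
  of \<open>wt\<close>; the factor \<open>exp \<tau>\<close> pays for the 1 in z = 1 + |k|^2. For
  fixed positive \<tau>, bounded coefficients thus become absolutely summable.\<close>

lemma exp_neg_mult_le_wt:
  assumes "0 < \<tau>"
  shows "exp (- \<tau> * freq_norm_sq k) \<le> exp \<tau> * (4 / \<tau>) ^ 4 * wt k"
proof -
  define z where "z = 1 + freq_norm_sq k"
  have z: "0 < z" by (simp add: z_def)
  have "\<tau> * z / 4 \<le> exp (\<tau> * z / 4)"
    using exp_ge_add_one_self[of "\<tau> * z / 4"] by linarith
  then have "(\<tau> * z / 4) ^ 4 \<le> exp (\<tau> * z / 4) ^ 4"
    using z assms by (intro power_mono) auto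
  also have "\<dots> = exp (\<tau> * z)"
    by (simp flip: exp_of_nat_mult)
  finally have "exp (- (\<tau> * z)) \<le> (4 / \<tau>) ^ 4 * (1 / z ^ 4)"
    using z assms by (simp add: exp_minus field_simps)
  then have "exp \<tau> * exp (- (\<tau> * z)) \<le> exp \<tau> * ((4 / \<tau>) ^ 4 * (1 / z ^ 4))"
    by (rule mult_left_mono) simp
  moreover have "exp (- \<tau> * freq_norm_sq k) = exp \<tau> * exp (- (\<tau> * z))"
    by (simp add: z_def algebra_simps flip: exp_add)
  ultimately show ?thesis
    by (simp add: wt_def z_def mult.assoc)
qed

lemma norm_oseen_le:
  "norm (oseen \<tau> F k) \<le> exp (- \<tau> * freq_norm_sq k) * (4 * sqrt (freq_norm_sq k) *
     (\<Sum>i\<in>UNIV. \<Sum>j\<in>UNIV. norm (fourier_coeff (\<lambda>x. F x $ i $ j) k)))"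
  unfolding oseen_def heat_def norm_scaleR
  using norm_leray_div_le[of "fourier_tensor F" k] by (simp add: fourier_tensor_def)

lemma oseen_summable:
  assumes "0 < \<tau>" "bounded_tensor M F"
  shows "(\<lambda>k. norm (oseen \<tau> F k)) summable_on UNIV"
proof -
  define C where "C = exp \<tau> * (4 / \<tau>) ^ 4"
  have C: "0 \<le> C" using assms(1) by (simp add: C_def)
  have "norm (oseen \<tau> F k) \<le> C * (36 * \<bar>M\<bar>) * (sqrt (freq_norm_sq k) * wt k)" for k
  proof -
    have "(\<Sum>i\<in>UNIV. \<Sum>j\<in>UNIV. norm (fourier_coeff (\<lambda>x. F x $ i $ j) k)) \<le> (\<Sum>i\<in>(UNIV::3 set). \<Sum>j\<in>(UNIV::3 set). \<bar>M\<bar>)"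
      using assms(2) unfolding bounded_tensor_def
      by (intro sum_mono order_trans[OF fourier_coeff_bound abs_ge_self]) auto
    then have S: "(\<Sum>i\<in>UNIV. \<Sum>j\<in>UNIV. norm (fourier_coeff (\<lambda>x. F x $ i $ j) k)) \<le> 9 * \<bar>M\<bar>"
      by simp
    have "exp (- \<tau> * freq_norm_sq k) * (4 * sqrt (freq_norm_sq k) *
        (\<Sum>i\<in>UNIV. \<Sum>j\<in>UNIV. norm (fourier_coeff (\<lambda>x. F x $ i $ j) k)))
      \<le> (C * wt k) * (4 * sqrt (freq_norm_sq k) * (9 * \<bar>M\<bar>))"
      using exp_neg_mult_le_wt[OF assms(1), of k] C S
      by (intro mult_mono mult_left_mono) (auto simp: C_def intro!: mult_nonneg_nonneg sum_nonneg)
    then show ?thesis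
      using norm_oseen_le[of \<tau> F k] by (simp add: mult_ac)
  qed
  then show ?thesis
    by (intro summable_on_comparison_test[OF summable_on_cmult_right[OF summable_sqrt_wt]]) auto
qed

text \<open>Parabolic smoothing frequency by frequency: the derivative contributes |k|^2, and x
  e^{-x} \<le> 1 with x = 2 \<tau> |k|^2 turns it into 1 / (2 \<tau>). The constant is 4^2 from the
  projection times 9 from Cauchy-Schwarz over the tensor entries, divided by 2.\<close>

lemma norm_oseen_sq_le:
  assumes "0 < \<tau>"
  shows "(norm (oseen \<tau> F k))\<^sup>2 \<le> 72 / \<tau> * (\<Sum>i\<in>UNIV. \<Sum>j\<in>UNIV. (norm (fourier_coeff (\<lambda>x. F x $ i $ j) k))\<^sup>2)"
proof -
  define q where "q = freq_norm_sq k"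
  have q0: "0 \<le> q" by (simp add: q_def)
  define a where "a p = norm (fourier_coeff (\<lambda>x. F x $ fst p $ snd p) k)" for p :: "3 \<times> 3"
  have S: "(\<Sum>i\<in>UNIV. \<Sum>j\<in>UNIV. f (i, j)) = (\<Sum>p\<in>UNIV. f p)" for f :: "3 \<times> 3 \<Rightarrow> real"
    by (simp add: sum.cartesian_product)
  have "(\<Sum>p\<in>UNIV. 1 * a p)\<^sup>2 \<le> (\<Sum>p\<in>(UNIV::(3 \<times> 3) set). 1\<^sup>2) * (\<Sum>p\<in>UNIV. (a p)\<^sup>2)"
    by (rule Cauchy_Schwarz_ineq_sum)
  then have cs: "(\<Sum>p\<in>UNIV. a p)\<^sup>2 \<le> 9 * (\<Sum>p\<in>UNIV. (a p)\<^sup>2)"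
    by simp
  have "(norm (oseen \<tau> F k))\<^sup>2 \<le> (exp (- \<tau> * q) * (4 * sqrt q * (\<Sum>p\<in>UNIV. a p)))\<^sup>2"
    using norm_oseen_le[of \<tau> F k] S[of a] by (intro power_mono) (auto simp: a_def q_def)
  also have "\<dots> = (exp (- \<tau> * q))\<^sup>2 * (16 * q * (\<Sum>p\<in>UNIV. a p)\<^sup>2)"
    using q0 by (simp add: power_mult_distrib)
  also have "\<dots> \<le> (exp (- \<tau> * q))\<^sup>2 * (16 * q * (9 * (\<Sum>p\<in>UNIV. (a p)\<^sup>2)))"
    using q0 by (intro mult_left_mono cs) auto
  also have "\<dots> = 144 * (q * (exp (- \<tau> * q))\<^sup>2) * (\<Sum>p\<in>UNIV. (a p)\<^sup>2)"
    by simp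
  also have "\<dots> \<le> 144 * (1 / (2 * \<tau>)) * (\<Sum>p\<in>UNIV. (a p)\<^sup>2)"
  proof (intro mult_right_mono mult_left_mono)
    have "2 * \<tau> * q * exp (- (2 * \<tau> * q)) \<le> 1"
    proof -
      have "2 * \<tau> * q \<le> exp (2 * \<tau> * q)"
        using exp_ge_add_one_self[of "2 * \<tau> * q"] by linarith
      then show ?thesis
        by (simp add: exp_minus field_simps)
    qed
    moreover have "(exp (- \<tau> * q))\<^sup>2 = exp (- (2 * \<tau> * q))"
      by (simp add: power2_eq_square flip: exp_add)
    ultimately show "q * (exp (- \<tau> * q))\<^sup>2 \<le> 1 / (2 * \<tau>)"
      using assms by (simp add: field_simps)
  qed (auto intro: sum_nonneg)
  finally show ?thesis
    using S[of "\<lambda>p. (a p)\<^sup>2"] by (simp add: a_def)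
qed

lemma borel_measurable_vec:
  fixes f :: "'a \<Rightarrow> ('b::euclidean_space)^'n"
  assumes "\<And>i. (\<lambda>x. f x $ i) \<in> borel_measurable M"
  shows "f \<in> borel_measurable M"
proof (subst borel_measurable_euclidean_space, rule ballI)
  fix b :: "'b^'n" assume "b \<in> Basis"
  then obtain i u where "b = axis i u"
    by (auto simp: Basis_vec_def)
  then show "(\<lambda>x. f x \<bullet> b) \<in> borel_measurable M"
    using assms[of i] by (simp add: inner_axis)
qed

lemma borel_measurable_vec_nth:
  fixes f :: "'a \<Rightarrow> ('b::euclidean_space)^'n"
  assumes "f \<in> borel_measurable M"
  shows "(\<lambda>x. f x $ i) \<in> borel_measurable M"
  by (rule borel_measurable_continuous_on[OF _ assms]) (intro continuous_intros)

lemma borel_measurable_fourier_series [measurable]: "fourier_series a \<in> borel_measurable torus"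
  unfolding fourier_series_def
  by (intro borel_measurable_infsum borel_measurable_vec, unfold vector_smult_component) measurable

text \<open>Parseval applies on the left, where the heat factor makes the series absolutely
  convergent; on the right \<open>F\<close> is only bounded and Bessel has to suffice.\<close>

lemma oseen_L2:
  assumes \<tau>: "0 < \<tau>" and F: "bounded_tensor M F"
  shows "(\<integral>\<^sup>+x. ennreal ((norm (fourier_series (oseen \<tau> F) x))\<^sup>2) \<partial>torus)
     \<le> ennreal (72 / \<tau> * (\<Sum>i\<in>UNIV. \<Sum>j\<in>UNIV. \<integral>x. (F x $ i $ j)\<^sup>2 \<partial>torus))"
proof -
  define A where "A = oseen \<tau> F"
  have A: "(\<lambda>k. norm (A k)) summable_on UNIV"
    unfolding A_def by (rule oseen_summable[OF \<tau> F])
  note nth = fourier_series_nth[OF A]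
  define S where "S x i = (\<Sum>\<^sub>\<infinity>k. A k $ i * fourier_mode k x)" for x i
  note pars = parseval_fourier_sum[OF nth(2), folded S_def]
  have meas: "(\<lambda>x. S x i) \<in> borel_measurable torus" for i
    unfolding S_def by (rule borel_measurable_fourier_sum)
  have n: "(norm (fourier_series A x))\<^sup>2 = (\<Sum>i\<in>UNIV. (norm (S x i))\<^sup>2)" for x
    unfolding norm_vec_sq nth(1) S_def ..
  have int: "integrable torus (\<lambda>x. (norm (fourier_series A x))\<^sup>2)"
    unfolding n by (intro Bochner_Integration.integrable_sum pars(2))
  have bd: "(\<lambda>x. F x $ i $ j) \<in> borel_measurable torus" "AE x in torus. \<bar>F x $ i $ j\<bar> \<le> M" for i j
    using F by (auto simp: bounded_tensor_def)
  define a where "a i j k = (norm (fourier_coeff (\<lambda>x. F x $ i $ j) k))\<^sup>2" for i j k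
  have as: "a i j summable_on UNIV" "(2 * pi) ^ 3 * infsum (a i j) UNIV \<le> (\<integral>x. (F x $ i $ j)\<^sup>2 \<partial>torus)" for i j
    using bessel[OF bd] by (simp_all add: a_def[abs_def])
  have sum_has: "((\<lambda>k. \<Sum>i\<in>UNIV. \<Sum>j\<in>UNIV. a i j k) has_sum (\<Sum>i\<in>UNIV. \<Sum>j\<in>UNIV. infsum (a i j) UNIV)) UNIV"
    by (simp add: sum_3) (intro has_sum_add has_sum_infsum as)
  have sum_A: "((\<lambda>k. (norm (A k))\<^sup>2) has_sum (\<Sum>i\<in>UNIV. \<Sum>\<^sub>\<infinity>k. (norm (A k $ i))\<^sup>2)) UNIV"
    unfolding norm_vec_sq sum_3 by (intro has_sum_add has_sum_infsum pars(1))
  have "(\<integral>\<^sup>+x. ennreal ((norm (fourier_series A x))\<^sup>2) \<partial>torus) = ennreal (\<integral>x. (norm (fourier_series A x))\<^sup>2 \<partial>torus)"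
    by (rule nn_integral_eq_integral[OF int]) simp
  also have "(\<integral>x. (norm (fourier_series A x))\<^sup>2 \<partial>torus) = (\<Sum>i\<in>UNIV. \<integral>x. (norm (S x i))\<^sup>2 \<partial>torus)"
    unfolding n by (intro Bochner_Integration.integral_sum pars(2))
  also have "\<dots> = (2 * pi) ^ 3 * (\<Sum>i\<in>UNIV. \<Sum>\<^sub>\<infinity>k. (norm (A k $ i))\<^sup>2)"
    unfolding pars(3) sum_distrib_left ..
  also have "\<dots> \<le> (2 * pi) ^ 3 * (72 / \<tau> * (\<Sum>i\<in>UNIV. \<Sum>j\<in>UNIV. infsum (a i j) UNIV))"
    by (intro mult_left_mono has_sum_mono[OF sum_A has_sum_cmult_right[OF sum_has]])
      (unfold A_def a_def, rule norm_oseen_sq_le[OF \<tau>], simp)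
  also have "\<dots> = 72 / \<tau> * (\<Sum>i\<in>UNIV. \<Sum>j\<in>UNIV. (2 * pi) ^ 3 * infsum (a i j) UNIV)"
    by (simp add: sum_distrib_left sum_distrib_right sum_divide_distrib mult_ac)
  also have "\<dots> \<le> 72 / \<tau> * (\<Sum>i\<in>UNIV. \<Sum>j\<in>UNIV. \<integral>x. (F x $ i $ j)\<^sup>2 \<partial>torus)"
    using \<tau> by (intro mult_left_mono sum_mono as) auto
  finally show ?thesis
    by (simp add: A_def ennreal_leI)
qed

text \<open>The bound 1 / \<tau> for the squared norm is not integrable in time. The weight
  \<tau>^{1/2} leaves \<tau>^{-1/2}, which is; the weight is paid for in
  \<open>weighted_cauchy_schwarz\<close>. 648 = 72 * 9, with nine tensor entries.\<close>

lemma oseen_weighted_L2: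
  assumes \<tau>: "0 < \<tau>" and F: "bounded_tensor M F"
    and W: "\<And>i j. (\<integral>x. (F x $ i $ j)\<^sup>2 \<partial>torus) \<le> W"
  shows "(\<integral>\<^sup>+x. ennreal (\<tau> powr (1/2) * (norm (fourier_series (oseen \<tau> F) x))\<^sup>2) \<partial>torus)
     \<le> ennreal (648 * W * \<tau> powr (-1/2))"
proof -
  have "(\<integral>\<^sup>+x. ennreal (\<tau> powr (1/2) * (norm (fourier_series (oseen \<tau> F) x))\<^sup>2) \<partial>torus)
      = ennreal (\<tau> powr (1/2)) * (\<integral>\<^sup>+x. ennreal ((norm (fourier_series (oseen \<tau> F) x))\<^sup>2) \<partial>torus)"
    by (subst nn_integral_cmult[symmetric]) (simp_all add: ennreal_mult')
  also have "\<dots> \<le> ennreal (\<tau> powr (1/2)) * ennreal (72 / \<tau> * (\<Sum>i\<in>(UNIV::3 set). \<Sum>j\<in>(UNIV::3 set). W))"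
    using \<tau> by (intro mult_left_mono order_trans[OF oseen_L2[OF \<tau> F]] ennreal_leI sum_mono W) auto
  also have "\<dots> = ennreal (648 * W * (\<tau> powr (1/2) / \<tau>))"
    by (subst ennreal_mult'[symmetric]) (simp_all add: mult_ac)
  also have "\<tau> powr (1/2) / \<tau> = \<tau> powr (-1/2)"
    using \<tau> powr_diff[of \<tau> "1/2" 1] by simp
  finally show ?thesis .
qed

lemma fourier_coeff_diff:
  assumes "f \<in> borel_measurable torus" "AE x in torus. \<bar>f x\<bar> \<le> M"
    "g \<in> borel_measurable torus" "AE x in torus. \<bar>g x\<bar> \<le> M"
  shows "fourier_coeff (\<lambda>x. f x - g x) k = fourier_coeff f k - fourier_coeff g k"
proof -
  have i: "integrable torus (\<lambda>x. complex_of_real (h x) * fourier_mode (- k) x)"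
    if [measurable]: "h \<in> borel_measurable torus" and "AE x in torus. \<bar>h x\<bar> \<le> M" for h
    by (rule torus.integrable_const_bound[of _ M]) (use that in \<open>auto simp: norm_mult\<close>)
  show ?thesis
    unfolding fourier_coeff_def
    using Bochner_Integration.integral_diff[OF i[OF assms(1,2)] i[OF assms(3,4)]]
    by (simp add: left_diff_distrib scaleR_diff_right)
qed

lemma bounded_tensor_diff:
  assumes "bounded_tensor M F" "bounded_tensor M G"
  shows "bounded_tensor (2 * M) (\<lambda>x. F x - G x)"
  unfolding bounded_tensor_def
proof (intro conjI allI)
  fix i j
  show "(\<lambda>x. (F x - G x) $ i $ j) \<in> borel_measurable torus"
    using assms by (auto simp: bounded_tensor_def intro!: borel_measurable_diff)
  have "AE x in torus. \<bar>F x $ i $ j\<bar> \<le> M" "AE x in torus. \<bar>G x $ i $ j\<bar> \<le> M"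
    using assms by (auto simp: bounded_tensor_def)
  then show "AE x in torus. \<bar>(F x - G x) $ i $ j\<bar> \<le> 2 * M"
    by eventually_elim auto
qed

lemma fourier_series_oseen_diff:
  assumes \<tau>: "0 < \<tau>" and F: "bounded_tensor M F" and G: "bounded_tensor M G"
  shows "fourier_series (oseen \<tau> F) x - fourier_series (oseen \<tau> G) x = fourier_series (oseen \<tau> (\<lambda>x. F x - G x)) x"
proof -
  have "fourier_coeff (\<lambda>x. F x $ i $ j - G x $ i $ j) k
      = fourier_coeff (\<lambda>x. F x $ i $ j) k - fourier_coeff (\<lambda>x. G x $ i $ j) k" for i j k
    using F G by (intro fourier_coeff_diff[where M=M]) (auto simp: bounded_tensor_def)
  then have "fourier_tensor (\<lambda>x. F x - G x) = (\<lambda>k. fourier_tensor F k - fourier_tensor G k)"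
    by (simp add: fourier_tensor_def fun_eq_iff vec_eq_iff)
  then have *: "oseen \<tau> (\<lambda>x. F x - G x) k = oseen \<tau> F k - oseen \<tau> G k" for k
    by (simp add: oseen_def heat_def leray_div_diff scaleR_diff_right)
  have s: "(\<lambda>k. fourier_mode k x *s oseen \<tau> H k) summable_on UNIV" if "bounded_tensor M H" for H
    by (rule fourier_series_nth(3)[OF oseen_summable[OF \<tau> that]])
  have "(\<lambda>k. - (fourier_mode k x *s oseen \<tau> G k)) summable_on UNIV"
    using s[OF G] by (simp add: summable_on_uminus)
  from infsum_add[OF s[OF F] this] show ?thesis
    unfolding fourier_series_def by (simp add: * infsum_uminus vec.scale_right_diff_distrib)
qed

section \<open>Integration in time with singular kernels\<close>

definition unit_time :: "real measure" where
  "unit_time = restrict_space lborel {0<..<1}"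

lemma space_unit_time: "space unit_time = {0<..<1}"
  by (simp add: unit_time_def space_restrict_space)

lemma borel_measurable_unit_time: "f \<in> borel_measurable borel \<Longrightarrow> f \<in> borel_measurable unit_time"
  unfolding unit_time_def by (intro measurable_restrict_space1) simp

interpretation unit_time: finite_measure unit_time
  unfolding unit_time_def
  by (rule finite_measureI) (simp add: space_restrict_space emeasure_restrict_space)

interpretation time_torus: pair_sigma_finite unit_time torus
  by standard

text \<open>Measurability is only known on the open unit interval and for the integrand cut off to 0
  < s < t. The endpoint values, which may be arbitrary, are added as functions supported at one
  point and do not affect the integral.\<close>

lemma set_lebesgue_integral_eq_unit_time:
  fixes f :: "real \<Rightarrow> 'b::{banach, second_countable_topology}"
  assumes t: "0 < t" "t \<le> 1"
    and meas: "(\<lambda>s. indicator {0<..<t} s *\<^sub>R f s) \<in> borel_measurable unit_time"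
  shows "(\<integral>s\<in>{0..t}. f s \<partial>lborel) = (\<integral>s. indicator {0<..<t} s *\<^sub>R f s \<partial>unit_time)"
proof -
  have eq: "indicator {0<..<1} s *\<^sub>R (indicator {0<..<t} s *\<^sub>R f s) = indicator {0<..<t} s *\<^sub>R f s" for s
    using t by (auto simp: indicator_def)
  have m: "(\<lambda>s. indicator {0<..<t} s *\<^sub>R f s) \<in> borel_measurable lborel"
    using meas borel_measurable_restrict_space_iff[of "{0<..<1}" lborel "\<lambda>s. indicator {0<..<t} s *\<^sub>R f s"]
    unfolding unit_time_def eq by simp
  have sp: "indicator {0..t} s *\<^sub>R f s = indicator {0<..<t} s *\<^sub>R f s + indicator {0} s *\<^sub>R f 0 + indicator {t} s *\<^sub>R f t" for s
    using t by (auto simp: indicator_def)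
  have m': "(\<lambda>s. indicator {0..t} s *\<^sub>R f s) \<in> borel_measurable lborel"
    unfolding sp by (intro borel_measurable_add[OF borel_measurable_add[OF m]]) measurable
  have "AE s in lborel. s \<noteq> 0" "AE s in lborel. s \<noteq> t"
    by (auto intro: AE_lborel_singleton)
  then have "AE s in lborel. indicator {0..t} s *\<^sub>R f s = indicator {0<..<t} s *\<^sub>R f s"
    by eventually_elim (auto simp: indicator_def)
  then have "(\<integral>s\<in>{0..t}. f s \<partial>lborel) = (\<integral>s. indicator {0<..<t} s *\<^sub>R f s \<partial>lborel)"
    unfolding set_lebesgue_integral_def by (intro integral_cong_AE m m')
  also have "\<dots> = (\<integral>s. indicator {0<..<t} s *\<^sub>R f s \<partial>unit_time)"
    using integral_restrict_space[of "{0<..<1}" lborel "\<lambda>s. indicator {0<..<t} s *\<^sub>R f s"]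
    unfolding unit_time_def eq by simp
  finally show ?thesis .
qed

lemma nn_integral_powr_kernel:
  fixes p t :: real
  assumes t: "0 < t" "t \<le> 1" and p: "0 < p"
  shows "(\<integral>\<^sup>+s. ennreal (indicator {0<..<t} s * (t - s) powr (p - 1)) \<partial>unit_time) = ennreal (t powr p / p)"
proof -
  have "((\<lambda>s. (t - s) powr (p - 1)) has_integral (- ((t - t) powr p / p) - - ((t - 0) powr p / p))) {0..t}"
  proof (rule fundamental_theorem_of_calculus_interior)
    show "continuous_on {0..t} (\<lambda>s. - ((t - s) powr p / p))"
      using p by (intro continuous_intros continuous_on_powr') auto
    show "((\<lambda>s. - ((t - s) powr p / p)) has_vector_derivative (t - s) powr (p - 1)) (at s)" if "s \<in> {0<..<t}" for s
      using that p by (auto simp flip: has_real_derivative_iff_has_vector_derivative intro!: derivative_eq_intros)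
  qed (use t in auto)
  then have hi: "((\<lambda>s. (t - s) powr (p - 1)) has_integral (t powr p / p)) {0..t}"
    using p by simp
  have "(\<integral>\<^sup>+s. ennreal (indicator {0<..<t} s * (t - s) powr (p - 1)) \<partial>unit_time)
      = (\<integral>\<^sup>+s. ennreal ((t - s) powr (p - 1)) * indicator {0..t} s \<partial>lborel)"
    unfolding unit_time_def
  proof (subst nn_integral_restrict_space, simp, rule nn_integral_cong_AE)
    have "AE s in lborel. s \<noteq> 0" "AE s in lborel. s \<noteq> t"
      by (auto intro: AE_lborel_singleton)
    then show "AE s in lborel. ennreal (indicator {0<..<t} s * (t - s) powr (p - 1)) * indicator {0<..<1} s
        = ennreal ((t - s) powr (p - 1)) * indicator {0..t} s"
      by eventually_elim (use t in \<open>auto simp: indicator_def\<close>)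
  qed
  also have "\<dots> = ennreal (t powr p / p)"
    by (rule nn_integral_has_integral_lebesgue'[OF _ hi]) simp
  finally show ?thesis .
qed

text \<open>Cauchy-Schwarz for the splitting of |D| into (t - s)^{-1/4} and (t - s)^{1/4} |D|. It is
  derived from the nonnegative quadratic W - 2 y |D| + y^2 w in y, whose case y = 1 also gives the
  integrability of \<open>D\<close>. The factor 2 bounds the total mass of w = (t - s)^{-1/2} for t
  \<le> 1.\<close>

lemma weighted_cauchy_schwarz:
  fixes D :: "real \<Rightarrow> 'b::{banach, second_countable_topology}"
  assumes t: "0 < t" "t \<le> 1" and [measurable]: "D \<in> borel_measurable unit_time"
    and supp: "\<And>s. \<not> (0 < s \<and> s < t) \<Longrightarrow> D s = 0"
    and fin: "(\<integral>\<^sup>+s. ennreal ((t - s) powr (1/2) * (norm (D s))\<^sup>2) \<partial>unit_time) < \<infinity>"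
  shows "integrable unit_time D"
    and "ennreal ((norm (\<integral>s. D s \<partial>unit_time))\<^sup>2)
      \<le> 2 * (\<integral>\<^sup>+s. ennreal ((t - s) powr (1/2) * (norm (D s))\<^sup>2) \<partial>unit_time)"
proof -
  define w where "w s = indicator {0<..<t} s * (t - s) powr (1/2 - 1)" for s
  define W where "W s = (t - s) powr (1/2) * (norm (D s))\<^sup>2" for s
  have [measurable]: "(\<lambda>s. (t - s) powr (1/2)) \<in> borel_measurable unit_time"
    by (rule borel_measurable_unit_time) measurable
  have [measurable]: "w \<in> borel_measurable unit_time"
    unfolding w_def by (rule borel_measurable_unit_time) measurable
  have [measurable]: "W \<in> borel_measurable unit_time"
    unfolding W_def by measurable
  define A where "A = t powr (1/2) / (1/2)"
  have A: "0 < A" "A \<le> 2"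
    using t powr_le1[of "1/2" t] by (auto simp: A_def)
  have wn: "(\<integral>\<^sup>+s. ennreal (w s) \<partial>unit_time) = ennreal A"
    unfolding w_def A_def by (rule nn_integral_powr_kernel) (use t in auto)
  have w0: "0 \<le> w s" and W0: "0 \<le> W s" for s
    by (auto simp: w_def W_def)
  have wi: "integrable unit_time w"
    by (rule integrableI_nn_integral_finite[OF _ _ wn]) (auto simp: w0)
  have wA: "(\<integral>s. w s \<partial>unit_time) = A"
    using wn A by (subst integral_eq_nn_integral) (auto simp: w0)
  obtain \<beta> where \<beta>: "(\<integral>\<^sup>+s. ennreal (W s) \<partial>unit_time) = ennreal \<beta>" "0 \<le> \<beta>"
    using fin unfolding W_def[symmetric] by (cases "\<integral>\<^sup>+s. ennreal (W s) \<partial>unit_time") auto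
  have Wi: "integrable unit_time W"
    by (rule integrableI_nn_integral_finite[OF _ _ \<beta>(1)]) (auto simp: W0)
  have Wb: "(\<integral>s. W s \<partial>unit_time) = \<beta>"
    using \<beta> by (subst integral_eq_nn_integral) (auto simp: W0)
  have quad: "0 \<le> W s - 2 * y * norm (D s) + y\<^sup>2 * w s" for y s
  proof (cases "0 < s \<and> s < t")
    case True
    define \<tau> where "\<tau> = (t - s) powr (1/2)"
    have "\<tau> > 0" using True by (simp add: \<tau>_def)
    have "w s = 1 / \<tau>"
      using True powr_minus_divide[of "t - s" "1/2"] by (simp add: w_def \<tau>_def)
    then have "W s - 2 * y * norm (D s) + y\<^sup>2 * w s = (\<tau> * norm (D s) - y)\<^sup>2 / \<tau>"
      using \<open>\<tau> > 0\<close> by (simp add: W_def \<tau>_def[symmetric] power2_eq_square field_simps)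
    then show ?thesis
      using \<open>\<tau> > 0\<close> by simp
  next
    case False
    then show ?thesis
      using supp[OF False] w0[of s] W0[of s] by simp
  qed
  show Di: "integrable unit_time D"
  proof (rule Bochner_Integration.integrable_bound)
    show "integrable unit_time (\<lambda>s. W s + w s)"
      by (intro Bochner_Integration.integrable_add wi Wi)
    have "norm (D s) \<le> W s + w s" for s
      using quad[of s 1] w0[of s] W0[of s] by simp
    then show "AE s in unit_time. norm (D s) \<le> norm (W s + w s)"
      using w0 W0 by (intro AE_I2) (simp add: add_nonneg_nonneg)
  qed simp
  define I where "I = (\<integral>s. norm (D s) \<partial>unit_time)"
  have I0: "0 \<le> I" by (simp add: I_def)
  \<comment> \<open>The integrated quadratic in y is smallest at y = I / A.\<close>
  have "0 \<le> (\<integral>s. W s - 2 * (I / A) * norm (D s) + (I / A)\<^sup>2 * w s \<partial>unit_time)"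
    by (intro integral_nonneg_AE AE_I2 quad)
  also have "\<dots> = \<beta> - 2 * (I / A) * I + (I / A)\<^sup>2 * A"
    using Wi wi Di by (simp add: Wb wA I_def)
  also have "\<dots> = \<beta> - I\<^sup>2 / A"
    using A by (simp add: field_simps power2_eq_square)
  finally have "I\<^sup>2 \<le> A * \<beta>"
    using A by (simp add: field_simps)
  also have "\<dots> \<le> 2 * \<beta>"
    using A \<beta> by (intro mult_right_mono) auto
  finally have "(norm (\<integral>s. D s \<partial>unit_time))\<^sup>2 \<le> 2 * \<beta>"
    using order_trans[OF power_mono[OF integral_norm_bound[of unit_time D] norm_ge_zero, of 2]]
    unfolding I_def by blast
  then have "ennreal ((norm (\<integral>s. D s \<partial>unit_time))\<^sup>2) \<le> ennreal (2 * \<beta>)"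
    by (rule ennreal_leI)
  also have "\<dots> = 2 * ennreal \<beta>"
    using \<beta>(2) by (simp add: ennreal_mult')
  finally show "ennreal ((norm (\<integral>s. D s \<partial>unit_time))\<^sup>2)
      \<le> 2 * (\<integral>\<^sup>+s. ennreal ((t - s) powr (1/2) * (norm (D s))\<^sup>2) \<partial>unit_time)"
    unfolding W_def[symmetric] \<beta>(1) .
qed

text \<open>A negative power of \<open>lam\<close> is bought with a stronger singularity: the
  exponent drops from -1/2 to -3/4, which is still integrable. Behind it is x^{1/4} \<le> e^x for x
  = lam \<tau>.\<close>

lemma exp_le_powr_quarter:
  fixes lam \<tau> :: real
  assumes "0 < lam" "0 < \<tau>"
  shows "exp (- (lam * \<tau>)) * \<tau> powr (-1/2) \<le> lam powr (-1/4) * \<tau> powr (1/4 - 1)"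
proof -
  define x where "x = lam * \<tau>"
  have x: "0 < x" using assms by (simp add: x_def)
  have "x powr (1/4) \<le> exp x"
  proof (cases "x \<le> 1")
    case True
    then have "x powr (1/4) \<le> 1" using x by (intro powr_le1) auto
    also have "1 \<le> exp x" using x by simp
    finally show ?thesis .
  next
    case False
    then have "x powr (1/4) \<le> x powr 1" by (intro powr_mono) auto
    also have "\<dots> \<le> exp x" using x exp_ge_add_one_self[of x] unfolding powr_one[OF less_imp_le[OF x]] by linarith
    finally show ?thesis .
  qed
  then have "exp (- x) \<le> x powr (-1/4)"
    using le_imp_inverse_le[of "x powr (1/4)" "exp x"] x powr_minus[of x "1/4"] by (simp add: exp_minus)
  then have "exp (- x) * \<tau> powr (-1/2) \<le> x powr (-1/4) * \<tau> powr (-1/2)"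
    by (intro mult_right_mono) auto
  also have "\<dots> = lam powr (-1/4) * (\<tau> powr (-1/4) * \<tau> powr (-1/2))"
    using assms by (simp add: x_def powr_mult)
  also have "\<tau> powr (-1/4) * \<tau> powr (-1/2) = \<tau> powr (1/4 - 1)"
    by (simp flip: powr_add)
  finally show ?thesis
    by (simp add: x_def)
qed

text \<open>In the norm weighted with \<open>exp (- lam s)\<close> the Volterra operator
  with kernel \<open>(t - s) powr (-1/2)\<close> is a contraction for large \<open>lam\<close>.\<close>

lemma singular_gronwall:
  fixes f :: "real \<Rightarrow> ennreal" and C B :: real
  assumes ineq: "\<And>t. 0 < t \<Longrightarrow> t \<le> 1 \<Longrightarrow>
      f t \<le> ennreal C * (\<integral>\<^sup>+s. ennreal (indicator {0<..<t} s * (t - s) powr (-1/2)) * f s \<partial>unit_time)"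
    and bd: "AE s in unit_time. f s \<le> ennreal B" and C: "0 < C" and B: "0 \<le> B"
    and t: "0 < t" "t \<le> 1"
  shows "f t = 0"
proof -
  \<comment> \<open>The kernel with exponent -3/4 has mass at most 4, and this \<open>lam\<close>
    makes \<open>C * 4 * lam powr (-1/4)\<close> equal to 1/2.\<close>
  define lam where "lam = (8 * C) powr 4"
  have lam: "0 < lam" using C by (simp add: lam_def)
  have lam4: "lam powr (-1/4) = 1 / (8 * C)"
    unfolding lam_def powr_powr using C powr_minus_divide[of "8 * C" 1] by simp
  \<comment> \<open>An almost everywhere bound suffices under the integral and returns, halved, as a
    bound at every time; iteration forces \<open>f t\<close> to be 0.\<close>
  have step: "f t \<le> ennreal (B * (1/2) ^ Suc n * exp (lam * t))"
    if ae: "AE s in unit_time. f s \<le> ennreal (B * (1/2) ^ n * exp (lam * s))" and t: "0 < t" "t \<le> 1" for n t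
  proof -
    have "(\<integral>\<^sup>+s. ennreal (indicator {0<..<t} s * (t - s) powr (-1/2)) * f s \<partial>unit_time)
        \<le> (\<integral>\<^sup>+s. ennreal (B * (1/2) ^ n * exp (lam * t) * lam powr (-1/4)) *
              ennreal (indicator {0<..<t} s * (t - s) powr (1/4 - 1)) \<partial>unit_time)"
    proof (rule nn_integral_mono_AE)
      show "AE s in unit_time. ennreal (indicator {0<..<t} s * (t - s) powr (-1/2)) * f s
        \<le> ennreal (B * (1/2) ^ n * exp (lam * t) * lam powr (-1/4)) *
              ennreal (indicator {0<..<t} s * (t - s) powr (1/4 - 1))"
        using ae
      proof eventually_elim
        case (elim s)
        show ?case
        proof (cases "s \<in> {0<..<t}")
          case True
          have "ennreal (indicator {0<..<t} s * (t - s) powr (-1/2)) * f s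
              \<le> ennreal ((t - s) powr (-1/2)) * ennreal (B * (1/2) ^ n * exp (lam * s))"
            using True elim by (intro mult_mono) auto
          also have "\<dots> = ennreal ((t - s) powr (-1/2) * (B * (1/2) ^ n * exp (lam * s)))"
            using B by (simp add: ennreal_mult')
          also have "\<dots> \<le> ennreal (B * (1/2) ^ n * exp (lam * t) * lam powr (-1/4) * (t - s) powr (1/4 - 1))"
          proof (rule ennreal_leI)
            have "exp (lam * s) = exp (lam * t) * exp (- (lam * (t - s)))"
              by (simp add: algebra_simps flip: exp_add)
            then have "(t - s) powr (-1/2) * (B * (1/2) ^ n * exp (lam * s))
                = B * (1/2) ^ n * exp (lam * t) * (exp (- (lam * (t - s))) * (t - s) powr (-1/2))"
              by (simp only: mult_ac)
            also have "\<dots> \<le> B * (1/2) ^ n * exp (lam * t) * (lam powr (-1/4) * (t - s) powr (1/4 - 1))"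
              using True B by (intro mult_left_mono exp_le_powr_quarter lam) auto
            finally show "(t - s) powr (-1/2) * (B * (1/2) ^ n * exp (lam * s))
                \<le> B * (1/2) ^ n * exp (lam * t) * lam powr (-1/4) * (t - s) powr (1/4 - 1)"
              by (simp only: mult_ac)
          qed
          also have "\<dots> = ennreal (B * (1/2) ^ n * exp (lam * t) * lam powr (-1/4)) *
              ennreal (indicator {0<..<t} s * (t - s) powr (1/4 - 1))"
            using True B by (simp add: ennreal_mult'')
          finally show ?thesis .
        qed auto
      qed
    qed
    also have "\<dots> = ennreal (B * (1/2) ^ n * exp (lam * t) * lam powr (-1/4)) * ennreal (t powr (1/4) / (1/4))"
    proof -
      have "(\<lambda>s. ennreal (indicator {0<..<t} s * (t - s) powr (1/4 - 1))) \<in> borel_measurable unit_time"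
        by (intro borel_measurable_unit_time) measurable
      then show ?thesis
        using nn_integral_powr_kernel[OF t, of "1/4"] by (subst nn_integral_cmult) simp_all
    qed
    also have "\<dots> \<le> ennreal (B * (1/2) ^ n * exp (lam * t) * lam powr (-1/4)) * ennreal 4"
      using t powr_le1[of "1/4" t] by (intro mult_left_mono ennreal_leI) auto
    finally have "f t \<le> ennreal C * (ennreal (B * (1/2) ^ n * exp (lam * t) * lam powr (-1/4)) * ennreal 4)"
      using ineq[OF t] mult_left_mono order_trans by (metis (no_types, lifting) zero_le)
    also have "\<dots> = ennreal (C * (B * (1/2) ^ n * exp (lam * t) * lam powr (-1/4) * 4))"
      using B C by (simp add: ennreal_mult)
    also have "C * (B * (1/2) ^ n * exp (lam * t) * lam powr (-1/4) * 4) = B * (1/2) ^ Suc n * exp (lam * t)"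
      unfolding lam4 using C by (simp add: field_simps)
    finally show ?thesis .
  qed
  have ae: "AE s in unit_time. f s \<le> ennreal (B * (1/2) ^ n * exp (lam * s))" for n
  proof (induction n)
    case 0
    have "AE s in unit_time. s \<in> {0<..<1}"
      using AE_space[of unit_time] by (simp add: space_unit_time)
    with bd show ?case
    proof eventually_elim
      case (elim s)
      have "B * 1 \<le> B * exp (lam * s)"
        using elim lam B by (intro mult_left_mono) auto
      then show ?case
        using elim(1) by (simp add: order_trans[OF _ ennreal_leI])
    qed
  next
    case (Suc n)
    show ?case
      by (rule AE_I2) (use step[OF Suc] in \<open>auto simp: space_unit_time\<close>)
  qed
  have "f t \<le> ennreal (B * exp (lam * t) * (1/2) ^ n)" for n
    using step[OF ae[of n] t] by (rule order_trans) (use B in \<open>auto intro!: ennreal_leI mult_left_mono simp: mult_ac\<close>)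
  moreover have "(\<lambda>n. ennreal (B * exp (lam * t) * (1/2) ^ n)) \<longlonglongrightarrow> ennreal 0"
    using tendsto_mult_right_zero[OF LIMSEQ_power_zero[of "1/2::real"], of "B * exp (lam * t)"]
    by (intro tendsto_ennrealI) simp
  ultimately have "f t \<le> ennreal 0"
    by (intro LIMSEQ_le_const) auto
  then show ?thesis
    by simp
qed

section \<open>Bounded fields and the comparison of two mild solutions\<close>

lemma complex_vec_nth [simp]: "complex_vec a $ i = complex_of_real (a $ i)"
  by (simp add: complex_vec_def)

lemma norm_complex_vec: "norm (complex_vec a) = norm a"
  by (simp add: norm_vec_def)

lemma complex_vec_diff: "complex_vec (a - b) = complex_vec a - complex_vec b"
  by (simp add: vec_eq_iff)

locale bounded_field =
  fixes u :: "real \<Rightarrow> real^3 \<Rightarrow> real^3" and M :: real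
  assumes meas: "(\<lambda>(t, x). u t x) \<in> borel_measurable (unit_time \<Otimes>\<^sub>M torus)"
    and bound: "AE s in unit_time. AE x in torus. norm (u s x) \<le> M"
begin

lemma meas_slice: "s \<in> space unit_time \<Longrightarrow> u s \<in> borel_measurable torus"
  using measurable_Pair2[OF meas, of s] by simp

lemma bounded_tensor_slice:
  assumes s: "s \<in> space unit_time" and b: "AE x in torus. norm (u s x) \<le> M"
  shows "bounded_tensor (M\<^sup>2) (tensor (u s) (u s))"
  unfolding bounded_tensor_def
proof (intro conjI allI)
  fix i j
  have [measurable]: "(\<lambda>x. u s x $ i) \<in> borel_measurable torus" for i
    by (rule borel_measurable_vec_nth[OF meas_slice[OF s]])
  show "(\<lambda>x. tensor (u s) (u s) x $ i $ j) \<in> borel_measurable torus"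
    by (simp add: tensor_def)
  show "AE x in torus. \<bar>tensor (u s) (u s) x $ i $ j\<bar> \<le> M\<^sup>2"
    using b
  proof eventually_elim
    case (elim x)
    have "\<bar>u s x $ l\<bar> \<le> M" for l
      using order_trans[OF component_le_norm_cart elim] .
    then have "\<bar>u s x $ i\<bar> * \<bar>u s x $ j\<bar> \<le> M * M"
      using order_trans[OF norm_ge_zero elim] by (intro mult_mono) auto
    then show ?case
      by (simp add: tensor_def abs_mult power2_eq_square)
  qed
qed

text \<open>The open interval leaves out s = t, where the heat factor is gone and the series need
  not converge, and makes the integrand vanish outside the range of the Duhamel integral.\<close>

definition duhamel_integrand :: "real \<Rightarrow> real \<Rightarrow> real^3 \<Rightarrow> complex^3" where
  "duhamel_integrand t s x = indicator {0<..<t} s *\<^sub>R fourier_series (oseen (t - s) (tensor (u s) (u s))) x"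

text \<open>Joint measurability is obtained coefficient by coefficient: each Fourier coefficient of
  u(s) tensor u(s) is measurable in s as a parameter integral, and the series is a countable sum of
  products of a function of s with a mode in x.\<close>

lemma measurable_integrand:
  "(\<lambda>(s, x). duhamel_integrand t s x) \<in> borel_measurable (unit_time \<Otimes>\<^sub>M torus)"
proof -
  have [measurable]: "(\<lambda>p. u (fst p) (snd p) $ i) \<in> borel_measurable (unit_time \<Otimes>\<^sub>M torus)" for i
    using borel_measurable_vec_nth[OF meas, of i] by (simp add: case_prod_beta')
  have [measurable]: "(\<lambda>s. fourier_coeff (\<lambda>x. tensor (u s) (u s) x $ i $ j) k) \<in> borel_measurable unit_time" for i j k
    unfolding fourier_coeff_def tensor_def vec_lambda_beta
    by (intro borel_measurable_scaleR borel_measurable_const torus.borel_measurable_lebesgue_integral)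
      (simp add: case_prod_beta')
  have [measurable]: "(\<lambda>s. exp (- (t - s) * freq_norm_sq k)) \<in> borel_measurable unit_time" for k
    by (rule borel_measurable_unit_time) measurable
  have [measurable]: "(\<lambda>s. indicator {0<..<t} s :: real) \<in> borel_measurable unit_time"
    by (rule borel_measurable_unit_time) measurable
  have o [measurable]: "(\<lambda>s. oseen (t - s) (tensor (u s) (u s)) k $ i) \<in> borel_measurable unit_time" for k i
    unfolding oseen_def heat_def leray_def div_tensor_def fourier_tensor_def vec_lambda_beta vector_scaleR_component
    by (intro borel_measurable_scaleR borel_measurable_diff borel_measurable_divide borel_measurable_times
        borel_measurable_sum borel_measurable_const) measurable
  have "(\<lambda>p. duhamel_integrand t (fst p) (snd p)) \<in> borel_measurable (unit_time \<Otimes>\<^sub>M torus)"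
    unfolding duhamel_integrand_def fourier_series_def
  proof (intro borel_measurable_scaleR borel_measurable_infsum borel_measurable_vec)
    show "(\<lambda>p. (fourier_mode k (snd p) *s oseen (t - fst p) (tensor (u (fst p)) (u (fst p))) k) $ i)
        \<in> borel_measurable (unit_time \<Otimes>\<^sub>M torus)" for k i
      unfolding vector_smult_component
      using measurable_compose[OF measurable_fst o[of k i], of torus]
        measurable_compose[OF measurable_snd borel_measurable_fourier_mode[of k], of unit_time]
      by (intro borel_measurable_times)
  qed measurable
  then show ?thesis
    by (simp add: case_prod_beta')
qed

lemma AE_good: "AE s in unit_time. s \<in> space unit_time \<and> (AE x in torus. norm (u s x) \<le> M)"
  using bound AE_space[of unit_time] by eventually_elim simp

text \<open>This is where \<open>L\<^sup>2\<close> in space and the weight in time make the Duhamel integral absolutely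
  convergent at almost every point, although the pointwise bound on the integrand is not integrable in time.\<close>

lemma AE_finite_weighted:
  assumes t: "0 < t" "t \<le> 1"
  shows "AE x in torus. (\<integral>\<^sup>+s. ennreal ((t - s) powr (1/2) * (norm (duhamel_integrand t s x))\<^sup>2) \<partial>unit_time) < \<infinity>"
proof -
  define g where "g s x = ennreal ((t - s) powr (1/2) * (norm (duhamel_integrand t s x))\<^sup>2)" for s x
  have [measurable]: "(\<lambda>s. (t - s) powr (1/2)) \<in> borel_measurable unit_time"
    by (rule borel_measurable_unit_time) measurable
  have [measurable]: "(\<lambda>p. duhamel_integrand t (fst p) (snd p)) \<in> borel_measurable (unit_time \<Otimes>\<^sub>M torus)"
    using measurable_integrand by (simp add: case_prod_beta')
  have mg: "case_prod g \<in> borel_measurable (unit_time \<Otimes>\<^sub>M torus)"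
    unfolding g_def by (simp add: case_prod_beta')
  define C where "C = 648 * ((M\<^sup>2)\<^sup>2 * (2 * pi) ^ 3)"
  have C: "0 \<le> C" by (simp add: C_def)
  have "(\<integral>\<^sup>+x. \<integral>\<^sup>+s. g s x \<partial>unit_time \<partial>torus) = (\<integral>\<^sup>+s. \<integral>\<^sup>+x. g s x \<partial>torus \<partial>unit_time)"
    by (rule time_torus.Fubini'[OF mg])
  also have "\<dots> \<le> (\<integral>\<^sup>+s. ennreal C * ennreal (indicator {0<..<t} s * (t - s) powr (1/2 - 1)) \<partial>unit_time)"
  proof (rule nn_integral_mono_AE)
    show "AE s in unit_time. (\<integral>\<^sup>+x. g s x \<partial>torus) \<le> ennreal C * ennreal (indicator {0<..<t} s * (t - s) powr (1/2 - 1))"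
      using AE_good
    proof eventually_elim
      case (elim s)
      show ?case
      proof (cases "s \<in> {0<..<t}")
        case True
        define F where "F = tensor (u s) (u s)"
        define \<tau> where "\<tau> = t - s"
        have \<tau>: "0 < \<tau>" using True by (simp add: \<tau>_def)
        have F: "bounded_tensor (M\<^sup>2) F"
          unfolding F_def using elim by (intro bounded_tensor_slice) auto
        have Fs: "(\<integral>x. (F x $ i $ j)\<^sup>2 \<partial>torus) \<le> (M\<^sup>2)\<^sup>2 * (2 * pi) ^ 3" for i j
        proof -
          have [measurable]: "(\<lambda>x. F x $ i $ j) \<in> borel_measurable torus" and b: "AE x in torus. \<bar>F x $ i $ j\<bar> \<le> M\<^sup>2"
            using F by (auto simp: bounded_tensor_def)
          have b2: "AE x in torus. (F x $ i $ j)\<^sup>2 \<le> (M\<^sup>2)\<^sup>2"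
            using b by eventually_elim (metis abs_ge_zero power2_abs power_mono)
          have "(\<integral>x. (F x $ i $ j)\<^sup>2 \<partial>torus) \<le> (\<integral>x. (M\<^sup>2)\<^sup>2 \<partial>torus)"
            by (intro integral_mono_AE torus.integrable_const b2 torus.integrable_const_bound[of _ "(M\<^sup>2)\<^sup>2"])
              (use b2 in auto)
          then show ?thesis
            by (simp add: measure_torus mult.commute)
        qed
        have "(\<integral>\<^sup>+x. g s x \<partial>torus) \<le> ennreal (C * \<tau> powr (-1/2))"
          using oseen_weighted_L2[OF \<tau> F Fs] True
          by (simp add: g_def duhamel_integrand_def F_def \<tau>_def C_def)
        then show ?thesis
          using True C by (simp add: \<tau>_def ennreal_mult')
      qed (simp add: g_def duhamel_integrand_def)
    qed
  qed
  also have "\<dots> = ennreal C * ennreal (t powr (1/2) / (1/2))"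
  proof -
    have "(\<lambda>s. ennreal (indicator {0<..<t} s * (t - s) powr (1/2 - 1))) \<in> borel_measurable unit_time"
      by (intro borel_measurable_unit_time) measurable
    then show ?thesis
      using nn_integral_powr_kernel[OF t, of "1/2"] by (subst nn_integral_cmult) simp_all
  qed
  also have "\<dots> < \<infinity>"
    by (simp add: ennreal_mult_less_top)
  finally have fin: "(\<integral>\<^sup>+x. \<integral>\<^sup>+s. g s x \<partial>unit_time \<partial>torus) \<noteq> \<infinity>"
    by simp
  have "case_prod (\<lambda>x s. g s x) \<in> borel_measurable (torus \<Otimes>\<^sub>M unit_time)"
    using measurable_pair_swap[OF mg] by (simp add: case_prod_beta')
  then have "(\<lambda>x. \<integral>\<^sup>+s. g s x \<partial>unit_time) \<in> borel_measurable torus"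
    by (rule unit_time.borel_measurable_nn_integral)
  from nn_integral_PInf_AE[OF this fin] show ?thesis
    unfolding g_def by (simp add: top.not_eq_extremum)
qed

lemma measurable_integrand_slice:
  "x \<in> space torus \<Longrightarrow> (\<lambda>s. duhamel_integrand t s x) \<in> borel_measurable unit_time"
  using measurable_Pair1[OF measurable_integrand] by simp

lemma integral_eq:
  assumes t: "0 < t" "t \<le> 1" and x: "x \<in> space torus"
  shows "(\<integral>s\<in>{0..t}. fourier_series (heat (t - s) (leray (div_tensor (fourier_tensor (tensor (u s) (u s)))))) x \<partial>lborel)
     = (\<integral>s. duhamel_integrand t s x \<partial>unit_time)"
  unfolding duhamel_integrand_def oseen_def
  using measurable_integrand_slice[OF x, of t]
  by (intro set_lebesgue_integral_eq_unit_time t) (simp add: duhamel_integrand_def oseen_def)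

end

text \<open>One factor is exchanged at a time, which gives |a_i a_j - b_i b_j| \<le> 2 M |a - b|.
  Constant fields serve to state the bound pointwise.\<close>

lemma tensor_diff_sq_le:
  assumes "norm a \<le> M" "norm b \<le> M"
  shows "(tensor (\<lambda>x. a) (\<lambda>x. a) x $ i $ j - tensor (\<lambda>x. b) (\<lambda>x. b) x $ i $ j)\<^sup>2 \<le> 4 * M\<^sup>2 * (norm (a - b))\<^sup>2"
proof -
  have c: "\<bar>a $ i\<bar> \<le> M" "\<bar>b $ j\<bar> \<le> M" "\<bar>(a - b) $ i\<bar> \<le> norm (a - b)" "\<bar>(a - b) $ j\<bar> \<le> norm (a - b)"
    using assms component_le_norm_cart order_trans by blast+
  have M: "0 \<le> M" using norm_ge_zero[of a] assms(1) by linarith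
  have "a $ i * a $ j - b $ i * b $ j = a $ i * (a - b) $ j + (a - b) $ i * b $ j"
    by (simp add: algebra_simps)
  then have "\<bar>a $ i * a $ j - b $ i * b $ j\<bar> \<le> \<bar>a $ i\<bar> * \<bar>(a - b) $ j\<bar> + \<bar>(a - b) $ i\<bar> * \<bar>b $ j\<bar>"
    by (metis abs_mult abs_triangle_ineq)
  also have "\<dots> \<le> M * norm (a - b) + norm (a - b) * M"
    using M by (intro add_mono mult_mono c) auto
  finally have "\<bar>a $ i * a $ j - b $ i * b $ j\<bar> \<le> 2 * M * norm (a - b)"
    by simp
  then have "\<bar>a $ i * a $ j - b $ i * b $ j\<bar>\<^sup>2 \<le> (2 * M * norm (a - b))\<^sup>2"
    by (intro power_mono) auto
  then show ?thesis
    by (simp add: tensor_def power_mult_distrib)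
qed

text \<open>Every larger bound is offered as well, so that two solutions can share one
  \<open>M\<close>. Boundedness almost everywhere in (t, x) is passed on to almost every time
  slice.\<close>

lemma mild_solution_bounded_field:
  assumes "mild_solution 1 u0 u"
  obtains M0 where "\<And>M. M0 \<le> M \<Longrightarrow> bounded_field u M"
proof -
  have L: "in_Linf (unit_time \<Otimes>\<^sub>M torus) (\<lambda>(t, x). u t x)"
    using assms by (simp add: mild_solution_def unit_time_def)
  define e where "e = Linf_norm (unit_time \<Otimes>\<^sub>M torus) (\<lambda>(t, x). u t x)"
  have e: "e < \<infinity>"
    using L by (simp add: in_Linf_def e_def)
  have ae: "AE p in unit_time \<Otimes>\<^sub>M torus. ereal (norm (case p of (t, x) \<Rightarrow> u t x)) \<le> e"
    unfolding e_def Linf_norm_def by (rule esssup_AE)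
  obtain M0 where M0: "e \<le> ereal M0"
    using e by (cases e) auto
  have "bounded_field u M" if "M0 \<le> M" for M
  proof
    show "(\<lambda>(t, x). u t x) \<in> borel_measurable (unit_time \<Otimes>\<^sub>M torus)"
      using L by (simp add: in_Linf_def)
    have "AE p in unit_time \<Otimes>\<^sub>M torus. norm (u (fst p) (snd p)) \<le> M"
      using ae
    proof eventually_elim
      case (elim p)
      then have "ereal (norm (u (fst p) (snd p))) \<le> ereal M0"
        using order_trans[OF _ M0] by (metis case_prod_beta')
      then show ?case
        using that by simp
    qed
    from time_torus.AE_pair[OF this] show "AE s in unit_time. AE x in torus. norm (u s x) \<le> M"
      by simp
  qed
  then show ?thesis
    using that by blast
qed

text \<open>At t = 0 both solutions equal the data by definition. For t > 0 their difference is
  minus the integral \<open>H\<close> of the difference of the integrands. Its squared L^2 norm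
  \<open>f\<close> satisfies the Volterra inequality at every t in (0, 1], so the conclusion holds
  for every t and not just for almost every t.\<close>

lemma mild_solution_unique:
  assumes mu: "mild_solution 1 u0 u" and mv: "mild_solution 1 u0 v" and t: "0 \<le> t" "t \<le> 1"
  shows "AE x in torus. v t x = u t x"
proof (cases "t = 0")
  case True
  have "AE x in torus. u 0 x = u0 x" "AE x in torus. v 0 x = u0 x"
    using mu mv by (auto simp: mild_solution_def)
  then show ?thesis
    unfolding True by eventually_elim simp
next
  case False
  obtain Mu where Mu: "\<And>M. Mu \<le> M \<Longrightarrow> bounded_field u M"
    using mild_solution_bounded_field[OF mu] by blast
  obtain Mv where Mv: "\<And>M. Mv \<le> M \<Longrightarrow> bounded_field v M"
    using mild_solution_bounded_field[OF mv] by blast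
  \<comment> \<open>The 1 keeps the Volterra constant \<open>C\<close> positive.\<close>
  define M where "M = max 1 (max Mu Mv)"
  have M1: "1 \<le> M" by (simp add: M_def)
  interpret u: bounded_field u M
    by (rule Mu) (simp add: M_def)
  interpret v: bounded_field v M
    by (rule Mv) (simp add: M_def)
  define D where "D t s x = v.duhamel_integrand t s x - u.duhamel_integrand t s x" for t s x
  define H where "H t x = (\<integral>s. D t s x \<partial>unit_time)" for t x
  define f where "f t = (\<integral>\<^sup>+x. ennreal ((norm (v t x - u t x))\<^sup>2) \<partial>torus)" for t
  have mD: "(\<lambda>(s, x). D t s x) \<in> borel_measurable (unit_time \<Otimes>\<^sub>M torus)" for t
    using borel_measurable_diff[OF v.measurable_integrand[of t] u.measurable_integrand[of t]]
    by (simp add: D_def case_prod_beta')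
  have mDx: "(\<lambda>s. D t s x) \<in> borel_measurable unit_time" if "x \<in> space torus" for t x
    using measurable_Pair1[OF mD that] by simp
  have mH: "H t \<in> borel_measurable torus" for t
  proof -
    have "(\<lambda>(x, s). D t s x) \<in> borel_measurable (torus \<Otimes>\<^sub>M unit_time)"
      using measurable_pair_swap[OF mD] by (simp add: case_prod_beta')
    then show ?thesis
      unfolding H_def[abs_def] by (rule unit_time.borel_measurable_lebesgue_integral)
  qed
  have suppD: "D t s x = 0" if "\<not> (0 < s \<and> s < t)" for t s x
    using that by (simp add: D_def u.duhamel_integrand_def v.duhamel_integrand_def)
  define g where "g t s x = ennreal ((t - s) powr (1/2) * (norm (D t s x))\<^sup>2)" for t s x
  have mg: "case_prod (g t) \<in> borel_measurable (unit_time \<Otimes>\<^sub>M torus)" for t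
  proof -
    have [measurable]: "(\<lambda>s. (t - s) powr (1/2)) \<in> borel_measurable unit_time"
      by (rule borel_measurable_unit_time) measurable
    have [measurable]: "(\<lambda>p. D t (fst p) (snd p)) \<in> borel_measurable (unit_time \<Otimes>\<^sub>M torus)"
      using mD[of t] by (simp add: case_prod_beta')
    show ?thesis
      unfolding g_def by (simp add: case_prod_beta')
  qed
  have duhamel: "AE x in torus. complex_vec (v t x - u t x) = - H t x"
    and cs: "AE x in torus. ennreal ((norm (H t x))\<^sup>2) \<le> 2 * (\<integral>\<^sup>+s. g t s x \<partial>unit_time)"
    if t: "0 < t" "t \<le> 1" for t
  proof -
    \<comment> \<open>Subtracting the two Duhamel integrals requires each of them to converge: a
      Bochner integral that does not exist would silently be 0.\<close>
    have iu: "AE x in torus. integrable unit_time (\<lambda>s. u.duhamel_integrand t s x)"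
      using u.AE_finite_weighted[OF t] AE_space
    proof eventually_elim
      case (elim x)
      show ?case
        by (rule weighted_cauchy_schwarz(1)[OF t u.measurable_integrand_slice[OF elim(2)] _ elim(1)])
          (auto simp: u.duhamel_integrand_def indicator_def)
    qed
    have iv: "AE x in torus. integrable unit_time (\<lambda>s. v.duhamel_integrand t s x)"
      using v.AE_finite_weighted[OF t] AE_space
    proof eventually_elim
      case (elim x)
      show ?case
        by (rule weighted_cauchy_schwarz(1)[OF t v.measurable_integrand_slice[OF elim(2)] _ elim(1)])
          (auto simp: v.duhamel_integrand_def indicator_def)
    qed
    have "AE x in torus. complex_vec (u t x) =
          fourier_series (heat t (fourier_vec u0)) x -
          (\<integral>s\<in>{0..t}. fourier_series
             (heat (t - s) (leray (div_tensor (fourier_tensor (tensor (u s) (u s)))))) x \<partial>lborel)"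
      "AE x in torus. complex_vec (v t x) =
          fourier_series (heat t (fourier_vec u0)) x -
          (\<integral>s\<in>{0..t}. fourier_series
             (heat (t - s) (leray (div_tensor (fourier_tensor (tensor (v s) (v s)))))) x \<partial>lborel)"
      using mu mv t by (auto simp: mild_solution_def)
    then show "AE x in torus. complex_vec (v t x - u t x) = - H t x"
      using iu iv AE_space
    proof eventually_elim
      case (elim x)
      show ?case
        unfolding complex_vec_diff elim(1,2) u.integral_eq[OF t elim(5)] v.integral_eq[OF t elim(5)] H_def D_def
        using elim(3,4) by simp
    qed
    show "AE x in torus. ennreal ((norm (H t x))\<^sup>2) \<le> 2 * (\<integral>\<^sup>+s. g t s x \<partial>unit_time)"
      using u.AE_finite_weighted[OF t] v.AE_finite_weighted[OF t] AE_space
    proof eventually_elim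
      case (elim x)
      have "(\<integral>\<^sup>+s. g t s x \<partial>unit_time) \<le> (\<integral>\<^sup>+s. 2 * ennreal ((t - s) powr (1/2) * (norm (v.duhamel_integrand t s x))\<^sup>2)
          + 2 * ennreal ((t - s) powr (1/2) * (norm (u.duhamel_integrand t s x))\<^sup>2) \<partial>unit_time)"
      proof (rule nn_integral_mono)
        fix s
        have "(norm (D t s x))\<^sup>2 \<le> (norm (v.duhamel_integrand t s x) + norm (u.duhamel_integrand t s x))\<^sup>2"
          unfolding D_def by (intro power_mono norm_triangle_ineq4) auto
        also have "\<dots> \<le> 2 * (norm (v.duhamel_integrand t s x))\<^sup>2 + 2 * (norm (u.duhamel_integrand t s x))\<^sup>2"
          using sum_squares_bound[of "norm (v.duhamel_integrand t s x)" "norm (u.duhamel_integrand t s x)"]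
          by (simp add: power2_eq_square algebra_simps)
        finally have "(t - s) powr (1/2) * (norm (D t s x))\<^sup>2 \<le> (t - s) powr (1/2) *
            (2 * (norm (v.duhamel_integrand t s x))\<^sup>2 + 2 * (norm (u.duhamel_integrand t s x))\<^sup>2)"
          by (intro mult_left_mono) auto
        then have "g t s x \<le> ennreal (2 * ((t - s) powr (1/2) * (norm (v.duhamel_integrand t s x))\<^sup>2)
            + 2 * ((t - s) powr (1/2) * (norm (u.duhamel_integrand t s x))\<^sup>2))"
          unfolding g_def by (intro ennreal_leI) (simp add: algebra_simps)
        then show "g t s x \<le> 2 * ennreal ((t - s) powr (1/2) * (norm (v.duhamel_integrand t s x))\<^sup>2)
          + 2 * ennreal ((t - s) powr (1/2) * (norm (u.duhamel_integrand t s x))\<^sup>2)"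
          by (simp add: ennreal_plus ennreal_mult')
      qed
      also have "\<dots> = 2 * (\<integral>\<^sup>+s. ennreal ((t - s) powr (1/2) * (norm (v.duhamel_integrand t s x))\<^sup>2) \<partial>unit_time)
          + 2 * (\<integral>\<^sup>+s. ennreal ((t - s) powr (1/2) * (norm (u.duhamel_integrand t s x))\<^sup>2) \<partial>unit_time)"
      proof -
        have [measurable]: "(\<lambda>s. (t - s) powr (1/2)) \<in> borel_measurable unit_time"
          by (rule borel_measurable_unit_time) measurable
        note [measurable] = u.measurable_integrand_slice[OF elim(3), of t] v.measurable_integrand_slice[OF elim(3), of t]
        show ?thesis
          by (subst nn_integral_add) (simp_all add: nn_integral_cmult)
      qed
      also have "\<dots> < \<infinity>"
        using elim(1,2) by (simp add: ennreal_mult_less_top)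
      finally show ?case
        unfolding g_def H_def
        by (intro weighted_cauchy_schwarz(2)[OF t mDx[OF elim(3)] suppD])
    qed
  qed
  \<comment> \<open>2 from \<open>weighted_cauchy_schwarz\<close>, 648 from
    \<open>oseen_weighted_L2\<close>, 4 M^2 from comparing v tensor v with u tensor u.\<close>
  define C where "C = 2 * (648 * (4 * M\<^sup>2))"
  have C: "0 < C" using M1 by (simp add: C_def)
  have good: "AE s in unit_time. (s \<in> space unit_time \<and> (AE x in torus. norm (u s x) \<le> M)) \<and> (AE x in torus. norm (v s x) \<le> M)"
    using u.AE_good v.AE_good by eventually_elim simp
  have fH: "f t = (\<integral>\<^sup>+x. ennreal ((norm (H t x))\<^sup>2) \<partial>torus)" if t: "0 < t" "t \<le> 1" for t
    unfolding f_def
  proof (rule nn_integral_cong_AE)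
    show "AE x in torus. ennreal ((norm (v t x - u t x))\<^sup>2) = ennreal ((norm (H t x))\<^sup>2)"
      using duhamel[OF t] by eventually_elim (metis norm_complex_vec norm_minus_cancel)
  qed
  have ineq: "f t \<le> ennreal C * (\<integral>\<^sup>+s. ennreal (indicator {0<..<t} s * (t - s) powr (-1/2)) * f s \<partial>unit_time)"
    if t: "0 < t" "t \<le> 1" for t
  proof -
    have mx: "(\<lambda>x. \<integral>\<^sup>+s. g t s x \<partial>unit_time) \<in> borel_measurable torus"
    proof -
      have "case_prod (\<lambda>x s. g t s x) \<in> borel_measurable (torus \<Otimes>\<^sub>M unit_time)"
        using measurable_pair_swap[OF mg[of t]] by (simp add: case_prod_beta')
      then show ?thesis
        by (rule unit_time.borel_measurable_nn_integral)
    qed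
    have ms: "(\<lambda>s. \<integral>\<^sup>+x. g t s x \<partial>torus) \<in> borel_measurable unit_time"
      by (rule torus.borel_measurable_nn_integral[OF mg])
    have mf: "f \<in> borel_measurable unit_time"
    proof -
      have "(\<lambda>p. v (fst p) (snd p) - u (fst p) (snd p)) \<in> borel_measurable (unit_time \<Otimes>\<^sub>M torus)"
        using u.meas v.meas by (intro borel_measurable_diff) (simp_all add: case_prod_beta')
      then have "case_prod (\<lambda>s x. ennreal ((norm (v s x - u s x))\<^sup>2)) \<in> borel_measurable (unit_time \<Otimes>\<^sub>M torus)"
        unfolding case_prod_beta' by measurable
      then show ?thesis
        unfolding f_def[abs_def] by (rule torus.borel_measurable_nn_integral)
    qed
    have "f t \<le> (\<integral>\<^sup>+x. 2 * (\<integral>\<^sup>+s. g t s x \<partial>unit_time) \<partial>torus)"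
      unfolding fH[OF t] by (rule nn_integral_mono_AE[OF cs[OF t]])
    also have "\<dots> = 2 * (\<integral>\<^sup>+x. \<integral>\<^sup>+s. g t s x \<partial>unit_time \<partial>torus)"
      by (rule nn_integral_cmult[OF mx])
    also have "\<dots> = 2 * (\<integral>\<^sup>+s. \<integral>\<^sup>+x. g t s x \<partial>torus \<partial>unit_time)"
      unfolding time_torus.Fubini'[OF mg] ..
    also have "\<dots> = (\<integral>\<^sup>+s. 2 * (\<integral>\<^sup>+x. g t s x \<partial>torus) \<partial>unit_time)"
      by (rule nn_integral_cmult[OF ms, symmetric])
    \<comment> \<open>For almost every s < t the smoothing estimate is applied to F - G, whose
      entries are at most 2 M |v(s) - u(s)|.\<close>
    also have "\<dots> \<le> (\<integral>\<^sup>+s. ennreal C * (ennreal (indicator {0<..<t} s * (t - s) powr (-1/2)) * f s) \<partial>unit_time)"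
    proof (rule nn_integral_mono_AE)
      show "AE s in unit_time. 2 * (\<integral>\<^sup>+x. g t s x \<partial>torus)
          \<le> ennreal C * (ennreal (indicator {0<..<t} s * (t - s) powr (-1/2)) * f s)"
        using good
      proof eventually_elim
        case (elim s)
        show ?case
        proof (cases "s \<in> {0<..<t}")
          case True
          define \<tau> where "\<tau> = t - s"
          have \<tau>: "0 < \<tau>" using True by (simp add: \<tau>_def)
          define F where "F = tensor (v s) (v s)"
          define G where "G = tensor (u s) (u s)"
          have bF: "bounded_tensor (M\<^sup>2) F" and bG: "bounded_tensor (M\<^sup>2) G"
            unfolding F_def G_def using elim
            by (auto intro!: v.bounded_tensor_slice u.bounded_tensor_slice)
          note bFG = bounded_tensor_diff[OF bF bG]
          have D: "D t s x = fourier_series (oseen \<tau> (\<lambda>x. F x - G x)) x" for x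
            unfolding D_def v.duhamel_integrand_def u.duhamel_integrand_def
            using True fourier_series_oseen_diff[OF \<tau> bF bG, of x] by (simp add: F_def G_def \<tau>_def)
          have [measurable]: "u s \<in> borel_measurable torus" "v s \<in> borel_measurable torus"
            using u.meas_slice v.meas_slice elim by auto
          have aeuv: "AE x in torus. norm (v s x) \<le> M \<and> norm (u s x) \<le> M"
            using elim by (auto intro: AE_conjI)
          have w_int: "integrable torus (\<lambda>x. (norm (v s x - u s x))\<^sup>2)"
          proof (rule torus.integrable_const_bound[of _ "(2 * M)\<^sup>2"])
            show "AE x in torus. norm ((norm (v s x - u s x))\<^sup>2) \<le> (2 * M)\<^sup>2"
              using aeuv
            proof eventually_elim
              case (elim x)
              have "(norm (v s x - u s x))\<^sup>2 \<le> (2 * M)\<^sup>2"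
                using elim norm_triangle_ineq4[of "v s x" "u s x"] by (intro power_mono) auto
              then show ?case by simp
            qed
          qed measurable
          define W where "W = (\<integral>x. (norm (v s x - u s x))\<^sup>2 \<partial>torus)"
          have fW: "f s = ennreal W"
            unfolding f_def W_def by (rule nn_integral_eq_integral[OF w_int]) simp
          have FG: "(\<integral>x. ((F x - G x) $ i $ j)\<^sup>2 \<partial>torus) \<le> 4 * M\<^sup>2 * W" for i j
          proof -
            have m[measurable]: "(\<lambda>x. (F x - G x) $ i $ j) \<in> borel_measurable torus"
              using bFG by (auto simp: bounded_tensor_def)
            have le: "AE x in torus. ((F x - G x) $ i $ j)\<^sup>2 \<le> 4 * M\<^sup>2 * (norm (v s x - u s x))\<^sup>2"
              using aeuv
            proof eventually_elim
              case (elim x)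
              then show ?case
                using tensor_diff_sq_le[of "v s x" M "u s x" x i j] by (simp add: F_def G_def tensor_def)
            qed
            have "integrable torus (\<lambda>x. ((F x - G x) $ i $ j)\<^sup>2)"
            proof (rule Bochner_Integration.integrable_bound[OF integrable_mult_right[OF w_int, of "4 * M\<^sup>2"]
                  borel_measurable_power[OF m]])
              show "AE x in torus. norm (((F x - G x) $ i $ j)\<^sup>2) \<le> norm (4 * M\<^sup>2 * (norm (v s x - u s x))\<^sup>2)"
                using le by eventually_elim simp
            qed
            then have "(\<integral>x. ((F x - G x) $ i $ j)\<^sup>2 \<partial>torus) \<le> (\<integral>x. 4 * M\<^sup>2 * (norm (v s x - u s x))\<^sup>2 \<partial>torus)"
              by (intro integral_mono_AE integrable_mult_right w_int le)
            then show ?thesis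
              by (simp add: W_def)
          qed
          have W0: "0 \<le> W" by (simp add: W_def)
          have "(\<integral>\<^sup>+x. g t s x \<partial>torus) \<le> ennreal (C / 2 * \<tau> powr (-1/2) * W)"
            using oseen_weighted_L2[OF \<tau> bFG FG] by (simp add: g_def D \<tau>_def C_def mult_ac)
          then have "2 * (\<integral>\<^sup>+x. g t s x \<partial>torus) \<le> 2 * ennreal (C / 2 * \<tau> powr (-1/2) * W)"
            by (intro mult_left_mono) auto
          also have "\<dots> = ennreal (2 * (C / 2 * \<tau> powr (-1/2) * W))"
            using C W0 by (subst ennreal_mult') auto
          also have "\<dots> = ennreal C * (ennreal (\<tau> powr (-1/2)) * ennreal W)"
            using C W0 by (simp add: ennreal_mult mult.assoc)
          finally show ?thesis
            using True by (simp add: fW \<tau>_def)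
        qed (simp add: g_def suppD)
      qed
    qed
    also have "\<dots> = ennreal C * (\<integral>\<^sup>+s. ennreal (indicator {0<..<t} s * (t - s) powr (-1/2)) * f s \<partial>unit_time)"
    proof (rule nn_integral_cmult)
      have "(\<lambda>s. ennreal (indicator {0<..<t} s * (t - s) powr (-1/2))) \<in> borel_measurable unit_time"
        by (intro borel_measurable_unit_time) measurable
      then show "(\<lambda>s. ennreal (indicator {0<..<t} s * (t - s) powr (-1/2)) * f s) \<in> borel_measurable unit_time"
        by (intro borel_measurable_times_ennreal mf)
    qed
    finally show ?thesis .
  qed
  have fB: "AE s in unit_time. f s \<le> ennreal ((2 * M)\<^sup>2 * (2 * pi) ^ 3)"
    using good
  proof eventually_elim
    case (elim s)
    have "f s \<le> (\<integral>\<^sup>+x. ennreal ((2 * M)\<^sup>2) \<partial>torus)"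
      unfolding f_def
    proof (rule nn_integral_mono_AE)
      have "AE x in torus. norm (v s x) \<le> M \<and> norm (u s x) \<le> M"
        using elim by (auto intro: AE_conjI)
      then show "AE x in torus. ennreal ((norm (v s x - u s x))\<^sup>2) \<le> ennreal ((2 * M)\<^sup>2)"
      proof eventually_elim
        case (elim x)
        have "(norm (v s x - u s x))\<^sup>2 \<le> (2 * M)\<^sup>2"
          using elim norm_triangle_ineq4[of "v s x" "u s x"] by (intro power_mono) auto
        then show ?case by (rule ennreal_leI)
      qed
    qed
    also have "\<dots> = ennreal ((2 * M)\<^sup>2 * (2 * pi) ^ 3)"
      unfolding nn_integral_const emeasure_torus by (rule ennreal_mult'[symmetric]) simp
    finally show ?case .
  qed
  have t': "0 < t" "t \<le> 1"
    using t False by auto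
  have "f t = 0"
    by (rule singular_gronwall[OF ineq fB C _ t']) auto
  then have "(\<integral>\<^sup>+x. ennreal ((norm (H t x))\<^sup>2) \<partial>torus) = 0"
    using fH[OF t'] by simp
  moreover have "(\<lambda>x. ennreal ((norm (H t x))\<^sup>2)) \<in> borel_measurable torus"
    using mH[of t] by measurable
  ultimately have "AE x in torus. ennreal ((norm (H t x))\<^sup>2) = 0"
    by (simp add: nn_integral_0_iff_AE)
  then show ?thesis
    using duhamel[OF t']
  proof eventually_elim
    case (elim x)
    then have "complex_vec (v t x - u t x) = 0"
      by simp
    then have "norm (v t x - u t x) = 0"
      using norm_complex_vec[of "v t x - u t x"] by simp
    then show ?case
      by simp
  qed
qed

section \<open>Small perturbations of a heat flow\<close>

text \<open>One coefficient of the Duhamel integral, taken as a gauge integral since the integrands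
  below are continuous in time; \<open>fourier_series_duhamel\<close> passes to the field.\<close>

definition duhamel :: "(real \<Rightarrow> int^3 \<Rightarrow> complex^3) \<Rightarrow> real \<Rightarrow> int^3 \<Rightarrow> complex^3" where
  "duhamel F t k = integral {0..t} (\<lambda>s. heat (t - s) (F s) k)"

lemma continuous_on_heat:
  assumes "continuous_on S (\<lambda>s. F s k)"
  shows "continuous_on S (\<lambda>s. heat (t - s) (F s) k)"
  unfolding heat_def by (intro continuous_intros assms)

lemma duhamel_norm_le:
  assumes F: "continuous_on {0..t} (\<lambda>s. F s k)"
    and g: "(g has_integral I) {0..t}"
    and le: "\<And>s. 0 \<le> s \<Longrightarrow> s \<le> t \<Longrightarrow> exp (- ((t - s) * freq_norm_sq k)) * norm (F s k) \<le> g s"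
  shows "norm (duhamel F t k) \<le> I"
proof -
  have "norm (duhamel F t k) \<le> integral {0..t} g"
    unfolding duhamel_def
  proof (rule integral_norm_bound_integral)
    show "(\<lambda>s. heat (t - s) (F s) k) integrable_on {0..t}"
      by (intro integrable_continuous_interval continuous_on_heat F)
    show "g integrable_on {0..t}"
      using g by blast
    show "norm (heat (t - s) (F s) k) \<le> g s" if "s \<in> {0..t}" for s
    proof -
      have e: "- (t - s) * freq_norm_sq k = - ((t - s) * freq_norm_sq k)"
        by (rule minus_mult_left[symmetric])
      show ?thesis
        unfolding heat_def e norm_scaleR using le[of s] that by simp
    qed
  qed
  then show ?thesis
    using integral_unique[OF g] by simp
qed

lemma has_integral_exp_decay:
  fixes c :: real
  assumes "0 < c" "0 \<le> t"
  shows "((\<lambda>s. exp (- (c * (t - s)))) has_integral ((1 - exp (- (c * t))) / c)) {0..t}"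
proof -
  have "((\<lambda>s. exp (- (c * (t - s)))) has_integral (exp (- (c * (t - t))) / c - exp (- (c * (t - 0))) / c)) {0..t}"
    by (rule fundamental_theorem_of_calculus[OF assms(2), of "\<lambda>s. exp (- (c * (t - s))) / c"])
      (use assms in \<open>auto simp flip: has_real_derivative_iff_has_vector_derivative intro!: derivative_eq_intros\<close>)
  then show ?thesis
    by (simp add: diff_divide_distrib)
qed

lemma has_integral_linear_upto:
  fixes c :: real
  assumes "0 \<le> t"
  shows "((\<lambda>s. c * s) has_integral (c * t\<^sup>2 / 2)) {0..t}"
proof -
  have "((\<lambda>s. c * s) has_integral (c * t\<^sup>2 / 2 - c * 0\<^sup>2 / 2)) {0..t}"
    by (rule fundamental_theorem_of_calculus[OF assms, of "\<lambda>s. c * s\<^sup>2 / 2"])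
      (auto simp flip: has_real_derivative_iff_has_vector_derivative intro!: derivative_eq_intros)
  then show ?thesis
    by simp
qed

text \<open>Against the growth exp (lam s) the heat factor becomes exp (- (|k|^2 + lam) (t - s)),
  with integral at most 1 / (|k|^2 + lam). By the arithmetic-geometric mean inequality |k| / (|k|^2
  + lam) \<le> 1 / (2 sqrt lam): the derivative is absorbed uniformly in k and a small factor is
  gained.\<close>

lemma duhamel_le_exp_weight:
  assumes F: "continuous_on {0..t} (\<lambda>s. F s k)" and "0 \<le> t" "0 < lam" "0 \<le> A"
    and le: "\<And>s. 0 \<le> s \<Longrightarrow> s \<le> t \<Longrightarrow> norm (F s k) \<le> A * sqrt (freq_norm_sq k) * (s\<^sup>2 * exp (lam * s))"
  shows "norm (duhamel F t k) \<le> A * (t\<^sup>2 * exp (lam * t)) / (2 * sqrt lam)"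
proof -
  define q where "q = freq_norm_sq k"
  have q: "0 \<le> q" "0 < q + lam"
    using assms(3) by (simp_all add: q_def add_nonneg_pos)
  define B where "B = A * sqrt q * (t\<^sup>2 * exp (lam * t))"
  have B: "0 \<le> B"
    using assms(4) q by (simp add: B_def)
  have "norm (duhamel F t k) \<le> B * ((1 - exp (- ((q + lam) * t))) / (q + lam))"
  proof (rule duhamel_norm_le[where F=F and k=k and t=t, OF F has_integral_mult_right[OF has_integral_exp_decay[OF q(2) assms(2)]]])
    fix s assume s: "0 \<le> s" "s \<le> t"
    have "exp (- ((t - s) * q)) * norm (F s k) \<le> exp (- ((t - s) * q)) * (A * sqrt q * (t\<^sup>2 * exp (lam * s)))"
    proof (rule mult_left_mono)
      have "s\<^sup>2 * exp (lam * s) \<le> t\<^sup>2 * exp (lam * s)"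
        using s by (intro mult_right_mono power_mono) auto
      then have "A * sqrt q * (s\<^sup>2 * exp (lam * s)) \<le> A * sqrt q * (t\<^sup>2 * exp (lam * s))"
        using assms(4) q by (intro mult_left_mono) auto
      then show "norm (F s k) \<le> A * sqrt q * (t\<^sup>2 * exp (lam * s))"
        using le[OF s] by (simp add: q_def)
    qed simp
    also have "\<dots> = A * sqrt q * t\<^sup>2 * exp (- ((t - s) * q) + lam * s)"
      unfolding exp_add by simp
    also have "- ((t - s) * q) + lam * s = lam * t + - ((q + lam) * (t - s))"
      by (simp add: algebra_simps)
    also have "A * sqrt q * t\<^sup>2 * exp (lam * t + - ((q + lam) * (t - s))) = B * exp (- ((q + lam) * (t - s)))"
      unfolding exp_add B_def by simp
    finally show "exp (- ((t - s) * freq_norm_sq k)) * norm (F s k) \<le> B * exp (- ((q + lam) * (t - s)))"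
      by (simp add: q_def)
  qed
  also have "\<dots> \<le> B * (1 / (q + lam))"
    using q by (intro mult_left_mono divide_right_mono B) auto
  also have "\<dots> = A * (t\<^sup>2 * exp (lam * t)) * (sqrt q / (q + lam))"
    by (simp add: B_def)
  also have "\<dots> \<le> A * (t\<^sup>2 * exp (lam * t)) * (1 / (2 * sqrt lam))"
  proof (intro mult_left_mono)
    have "2 * sqrt q * sqrt lam \<le> q + lam"
      using sum_squares_bound[of "sqrt q" "sqrt lam"] q assms(3) by simp
    then show "sqrt q / (q + lam) \<le> 1 / (2 * sqrt lam)"
      using q assms(3) by (simp add: field_simps)
  qed (use assms(4) in auto)
  finally show ?thesis
    by simp
qed

text \<open>Here the derivative is traded for half a power of time: |k| times the integral of exp (-
  |k|^2 (t - s)) is (1 - exp (- |k|^2 t)) / |k|, at most sqrt t because 1 - e^{-x} \<le> sqrt x.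
  This is the origin of the exponent 5/2.\<close>

lemma duhamel_le_sqrt:
  assumes F: "continuous_on {0..t} (\<lambda>s. F s k)" and "0 \<le> t" "0 \<le> B"
    and le: "\<And>s. 0 \<le> s \<Longrightarrow> s \<le> t \<Longrightarrow> norm (F s k) \<le> B * sqrt (freq_norm_sq k)"
  shows "norm (duhamel F t k) \<le> B * sqrt t"
proof (cases "freq_norm_sq k = 0")
  case True
  have "norm (duhamel F t k) \<le> 0"
    by (rule duhamel_norm_le[where F=F and k=k and t=t, OF F has_integral_0]) (use le in \<open>auto simp: True\<close>)
  then show ?thesis
    using assms(2,3) by simp
next
  case False
  define q where "q = freq_norm_sq k"
  have q: "0 < q"
    using False freq_norm_sq_nonneg[of k] unfolding q_def by linarith
  have "norm (duhamel F t k) \<le> (B * sqrt q) * ((1 - exp (- (q * t))) / q)"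
  proof (rule duhamel_norm_le[where F=F and k=k and t=t, OF F has_integral_mult_right[OF has_integral_exp_decay[OF q assms(2)]]])
    fix s assume s: "0 \<le> s" "s \<le> t"
    show "exp (- ((t - s) * freq_norm_sq k)) * norm (F s k) \<le> B * sqrt q * exp (- (q * (t - s)))"
      using mult_left_mono[OF le[OF s], of "exp (- (q * (t - s)))"] by (simp add: q_def mult_ac)
  qed
  also have "\<dots> = B * ((1 - exp (- (q * t))) / sqrt q)"
    using q by (simp add: real_div_sqrt field_simps)
  also have "\<dots> \<le> B * sqrt t"
  proof (rule mult_left_mono)
    define x where "x = q * t"
    have "0 \<le> x" using q assms(2) by (simp add: x_def)
    have "1 - exp (- x) \<le> sqrt x"
    proof (cases "x \<le> 1")
      case True
      have "1 - exp (- x) \<le> x"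
        using exp_ge_add_one_self[of "- x"] by linarith
      also have "x \<le> sqrt x"
        using True \<open>0 \<le> x\<close> by (intro real_le_rsqrt) (auto simp: power2_eq_square mult_left_le)
      finally show ?thesis .
    next
      case False
      then have "1 \<le> sqrt x" by simp
      then show ?thesis
        using exp_gt_zero[of "- x"] by linarith
    qed
    then show "(1 - exp (- (q * t))) / sqrt q \<le> sqrt t"
      using q by (simp add: x_def real_sqrt_mult field_simps)
  qed fact
  finally show ?thesis .
qed

lemma duhamel_le_linear:
  assumes F: "continuous_on {0..t} (\<lambda>s. F s k)" and "0 \<le> t"
    and le: "\<And>s. 0 \<le> s \<Longrightarrow> s \<le> t \<Longrightarrow> norm (F s k) \<le> B * s"
  shows "norm (duhamel F t k) \<le> B * t\<^sup>2 / 2"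
proof (rule duhamel_norm_le[where F=F and k=k and t=t, OF F has_integral_linear_upto[OF assms(2)]])
  fix s assume s: "0 \<le> s" "s \<le> t"
  have "exp (- ((t - s) * freq_norm_sq k)) * norm (F s k) \<le> 1 * norm (F s k)"
    using s by (intro mult_right_mono) auto
  then show "exp (- ((t - s) * freq_norm_sq k)) * norm (F s k) \<le> B * s"
    using le[OF s] by simp
qed

lemma continuous_on_duhamel:
  assumes "continuous_on {0..T} (\<lambda>s. F s k)"
  shows "continuous_on {0..T} (\<lambda>t. duhamel F t k)"
proof -
  \<comment> \<open>Taking exp (- t |k|^2) out of the integral frees the integrand from
    \<open>t\<close>, so that continuity of the indefinite integral applies.\<close>
  have "duhamel F t k = exp (- (t * freq_norm_sq k)) *\<^sub>R integral {0..t} (\<lambda>s. exp (s * freq_norm_sq k) *\<^sub>R F s k)" for t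
  proof -
    have "- (t - s) * freq_norm_sq k = - (t * freq_norm_sq k) + s * freq_norm_sq k" for s
      by (simp add: algebra_simps)
    then show ?thesis
      unfolding duhamel_def heat_def integral_cmul[symmetric] scaleR_scaleR by (simp only: exp_add)
  qed
  moreover have "continuous_on {0..T} (\<lambda>t. integral {0..t} (\<lambda>s. exp (s * freq_norm_sq k) *\<^sub>R F s k))"
    by (intro indefinite_integral_continuous_1 integrable_continuous_interval continuous_intros assms)
  ultimately show ?thesis
    by (simp only:) (intro continuous_intros)
qed

lemma duhamel_diff:
  assumes "continuous_on {0..t} (\<lambda>s. F s k)" "continuous_on {0..t} (\<lambda>s. G s k)"
  shows "duhamel F t k - duhamel G t k = duhamel (\<lambda>s k. F s k - G s k) t k"
proof -
  have "duhamel F t k - duhamel G t k = integral {0..t} (\<lambda>s. heat (t - s) (F s) k - heat (t - s) (G s) k)"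
    unfolding duhamel_def
    by (rule integral_diff[symmetric]) (intro integrable_continuous_interval continuous_on_heat assms)+
  then show ?thesis
    by (simp add: duhamel_def heat_def scaleR_diff_right)
qed

lemma duhamel_nth:
  assumes "continuous_on {0..t} (\<lambda>s. F s k)"
  shows "duhamel F t k $ i = integral {0..t} (\<lambda>s. heat (t - s) (F s) k $ i)"
proof -
  have "(\<lambda>s. heat (t - s) (F s) k) integrable_on {0..t}"
    by (intro integrable_continuous_interval continuous_on_heat assms)
  from integral_linear[OF this bounded_linear_vec_nth[of i]] show ?thesis
    by (simp add: duhamel_def o_def)
qed

lemma hermitian_duhamel:
  assumes "\<And>k. continuous_on {0..t} (\<lambda>s. F s k)" "\<And>s. 0 \<le> s \<Longrightarrow> s \<le> t \<Longrightarrow> hermitian (F s)"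
  shows "hermitian (duhamel F t)"
  unfolding hermitian_def
proof (intro allI)
  fix k i
  have "duhamel F t (- k) $ i = integral {0..t} (\<lambda>s. cnj (heat (t - s) (F s) k $ i))"
    unfolding duhamel_nth[OF assms(1)]
    by (rule Henstock_Kurzweil_Integration.integral_cong)
      (use assms(2) in \<open>auto simp: heat_def hermitian_def\<close>)
  then show "duhamel F t (- k) $ i = cnj (duhamel F t k $ i)"
    unfolding duhamel_nth[OF assms(1)] Henstock_Kurzweil_Integration.integral_cnj .
qed

lemma norm_adv_diff_le:
  assumes "\<And>k. norm (a k) \<le> A * wt k" "\<And>k. norm (b k) \<le> A * wt k"
    "\<And>k. norm (a k - b k) \<le> \<delta> * wt k" "0 \<le> A" "0 \<le> \<delta>"
  shows "norm (adv a a k - adv b b k) \<le> 2 * Cadv * A * \<delta> * wt k * sqrt (freq_norm_sq k)"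
proof -
  have "norm (adv (\<lambda>k. a k - b k) a k) \<le> Cadv * (\<delta> * A) * (sqrt (freq_norm_sq k) * wt k)"
    "norm (adv b (\<lambda>k. a k - b k) k) \<le> Cadv * (A * \<delta>) * (sqrt (freq_norm_sq k) * wt k)"
    using assms by (auto intro!: norm_adv_le)
  then show ?thesis
    unfolding adv_diff[OF assms(1,2)]
    by (intro order_trans[OF norm_triangle_ineq]) (simp add: mult_ac)
qed

text \<open>The perturbation \<open>d\<close> of the heat flow \<open>v\<close> is measured in the norm
  \<open>sup |d t k| / (t\<^sup>2 exp (lam t) wt k)\<close>. A large \<open>lam\<close> makes the part of the Duhamel map that is
  linear in \<open>d\<close> contracting; the forcing \<open>adv (v s) (v s)\<close> is assumed to be small and to vanish at
  time zero, which accounts for the factor \<open>t\<^sup>2\<close>.\<close>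

locale perturbed_heat_flow =
  fixes v :: "real \<Rightarrow> int^3 \<Rightarrow> complex^3" and V E lam :: real
  assumes v_cont: "\<And>k. continuous_on {0..1} (\<lambda>t. v t k)"
    and v_bound: "\<And>t k. 0 \<le> t \<Longrightarrow> t \<le> 1 \<Longrightarrow> norm (v t k) \<le> V * wt k"
    and v_herm: "\<And>t. 0 \<le> t \<Longrightarrow> t \<le> 1 \<Longrightarrow> hermitian (v t)"
    and forcing: "\<And>s k. 0 \<le> s \<Longrightarrow> s \<le> 1 \<Longrightarrow> norm (adv (v s) (v s) k) \<le> E * wt k * s"
    and V0: "0 \<le> V" and E0: "0 \<le> E" and lam0: "0 < lam"
    and lam_large: "2 * Cadv * (V + 1) \<le> sqrt lam"
    and E_small: "2 * E * exp lam \<le> 1"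
begin

definition \<phi> :: "real \<Rightarrow> real" where "\<phi> t = t\<^sup>2 * exp (lam * t)"

lemma \<phi>_nonneg [simp]: "0 \<le> \<phi> t"
  by (simp add: \<phi>_def)

lemma \<phi>_mono: "0 \<le> s \<Longrightarrow> s \<le> t \<Longrightarrow> \<phi> s \<le> \<phi> t"
  unfolding \<phi>_def using lam0 by (intro mult_mono power_mono) auto

lemma \<phi>_le: "0 \<le> t \<Longrightarrow> t \<le> 1 \<Longrightarrow> \<phi> t \<le> exp lam"
  using \<phi>_mono[of t 1] by (simp add: \<phi>_def)

definition nonlin :: "(real \<Rightarrow> int^3 \<Rightarrow> complex^3) \<Rightarrow> real \<Rightarrow> int^3 \<Rightarrow> complex^3" where
  "nonlin d s = adv (\<lambda>k. v s k + d s k) (\<lambda>k. v s k + d s k)"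

text \<open>Radius 2 E: the first iterate has size at most E and the steps shrink by 1/2, so the
  geometric series stays in this ball.\<close>

definition small :: "(real \<Rightarrow> int^3 \<Rightarrow> complex^3) \<Rightarrow> bool" where
  "small d \<longleftrightarrow> (\<forall>k. continuous_on {0..1} (\<lambda>t. d t k)) \<and>
     (\<forall>t k. 0 \<le> t \<longrightarrow> t \<le> 1 \<longrightarrow> norm (d t k) \<le> 2 * E * \<phi> t * wt k)"

text \<open>\<open>E_small\<close> keeps the perturbation below \<open>wt\<close>, so V + 1 bounds
  the whole field.\<close>

lemma small_sum_bound:
  assumes "small d" "0 \<le> t" "t \<le> 1"
  shows "norm (v t k + d t k) \<le> (V + 1) * wt k"
proof -
  have "2 * E * \<phi> t \<le> 2 * E * exp lam"
    using \<phi>_le[OF assms(2,3)] E0 by (intro mult_left_mono) auto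
  then have "2 * E * \<phi> t * wt k \<le> 1 * wt k"
    using E_small by (intro mult_right_mono) auto
  moreover have "norm (d t k) \<le> 2 * E * \<phi> t * wt k"
    using assms unfolding small_def by blast
  ultimately have "norm (d t k) \<le> wt k"
    by linarith
  then show ?thesis
    using norm_triangle_ineq[of "v t k" "d t k"] v_bound[OF assms(2,3), of k]
    by (simp add: distrib_right)
qed

lemma small_zero: "small (\<lambda>t k. 0)"
  using E0 by (simp add: small_def)

lemma continuous_on_nonlin:
  assumes "small d" "t \<le> 1"
  shows "continuous_on {0..t} (\<lambda>s. nonlin d s k)"
proof -
  have "continuous_on {0..1} (\<lambda>s. nonlin d s k)"
    unfolding nonlin_def
    by (rule continuous_on_adv[where A="V + 1" and B="V + 1"])
      (use assms v_cont small_sum_bound in \<open>auto simp: small_def intro!: continuous_intros\<close>)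
  then show ?thesis
    by (rule continuous_on_subset) (use assms in auto)
qed

lemma nonlin_diff_le:
  assumes "small d" "small d'" "0 \<le> s" "s \<le> 1" "0 \<le> \<delta>"
    and "\<And>k. norm (d s k - d' s k) \<le> \<delta> * wt k"
  shows "norm (nonlin d s k - nonlin d' s k) \<le> 2 * Cadv * (V + 1) * \<delta> * wt k * sqrt (freq_norm_sq k)"
  unfolding nonlin_def
  by (rule norm_adv_diff_le) (use assms small_sum_bound V0 in auto)

text \<open>\<open>lam_large\<close> is exactly what makes the Lipschitz constant 2 Cadv (V + 1) /
  (2 sqrt lam) at most 1/2.\<close>

lemma duhamel_nonlin_diff_le_exp:
  assumes "small d" "small d'" "0 \<le> t" "t \<le> 1" "0 \<le> \<delta>"
    and diff: "\<And>s k. 0 \<le> s \<Longrightarrow> s \<le> 1 \<Longrightarrow> norm (d s k - d' s k) \<le> \<delta> * \<phi> s * wt k"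
  shows "norm (duhamel (nonlin d) t k - duhamel (nonlin d') t k) \<le> \<delta> / 2 * \<phi> t * wt k"
proof -
  have "norm (duhamel (\<lambda>s k. nonlin d s k - nonlin d' s k) t k)
      \<le> (2 * Cadv * (V + 1) * \<delta> * wt k) * (t\<^sup>2 * exp (lam * t)) / (2 * sqrt lam)"
  proof (rule duhamel_le_exp_weight)
    show "continuous_on {0..t} (\<lambda>s. nonlin d s k - nonlin d' s k)"
      by (intro continuous_intros continuous_on_nonlin assms)
    show "norm (nonlin d s k - nonlin d' s k)
        \<le> 2 * Cadv * (V + 1) * \<delta> * wt k * sqrt (freq_norm_sq k) * (s\<^sup>2 * exp (lam * s))"
      if "0 \<le> s" "s \<le> t" for s
    proof -
      have "norm (nonlin d s k - nonlin d' s k) \<le> 2 * Cadv * (V + 1) * (\<delta> * \<phi> s) * wt k * sqrt (freq_norm_sq k)"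
        using that assms by (intro nonlin_diff_le) auto
      then show ?thesis
        by (simp add: \<phi>_def mult_ac)
    qed
  qed (use assms lam0 V0 Cadv_pos in auto)
  also have "\<dots> = (2 * Cadv * (V + 1)) * (\<delta> * wt k * \<phi> t / (2 * sqrt lam))"
    by (simp add: \<phi>_def)
  also have "\<dots> \<le> sqrt lam * (\<delta> * wt k * \<phi> t / (2 * sqrt lam))"
    using lam_large assms(5) lam0 by (intro mult_right_mono) auto
  also have "\<dots> = \<delta> / 2 * \<phi> t * wt k"
    using lam0 by simp
  finally show ?thesis
    by (subst duhamel_diff) (auto intro!: continuous_on_nonlin assms)
qed

text \<open>Complement to the contraction estimate: no halving, but a gain of sqrt t. It serves for
  the passage to the limit in the iteration and for the first-order expansion.\<close>

lemma duhamel_nonlin_diff_le_sqrt: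
  assumes "small d" "small d'" "0 \<le> t" "t \<le> 1" "0 \<le> \<delta>"
    and diff: "\<And>s k. 0 \<le> s \<Longrightarrow> s \<le> t \<Longrightarrow> norm (d s k - d' s k) \<le> \<delta> * wt k"
  shows "norm (duhamel (nonlin d) t k - duhamel (nonlin d') t k) \<le> 2 * Cadv * (V + 1) * \<delta> * wt k * sqrt t"
proof -
  have "norm (duhamel (\<lambda>s k. nonlin d s k - nonlin d' s k) t k) \<le> (2 * Cadv * (V + 1) * \<delta> * wt k) * sqrt t"
  proof (rule duhamel_le_sqrt)
    show "continuous_on {0..t} (\<lambda>s. nonlin d s k - nonlin d' s k)"
      by (intro continuous_intros continuous_on_nonlin assms)
    show "norm (nonlin d s k - nonlin d' s k) \<le> 2 * Cadv * (V + 1) * \<delta> * wt k * sqrt (freq_norm_sq k)"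
      if "0 \<le> s" "s \<le> t" for s
      using nonlin_diff_le[OF assms(1,2), of s "\<delta>" k] that assms by simp
  qed (use assms V0 Cadv_pos in auto)
  then show ?thesis
    by (subst duhamel_diff) (auto intro!: continuous_on_nonlin assms)
qed

primrec iter :: "nat \<Rightarrow> real \<Rightarrow> int^3 \<Rightarrow> complex^3" where
  "iter 0 = (\<lambda>t k. 0)"
| "iter (Suc n) = (\<lambda>t k. - duhamel (nonlin (iter n)) t k)"

text \<open>The three properties are proved together: the estimate of the next step needs two
  consecutive iterates in the ball \<open>small\<close>, and the ball bound comes from summing the
  steps; 2 (1 - (1/2)^n) is the partial sum of the geometric series.\<close>

lemma iter_properties:
  "(\<forall>k. continuous_on {0..1} (\<lambda>t. iter n t k)) \<and>
   (\<forall>t k. 0 \<le> t \<longrightarrow> t \<le> 1 \<longrightarrow> norm (iter n t k) \<le> 2 * E * (1 - (1/2) ^ n) * \<phi> t * wt k) \<and>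
   (\<forall>t k. 0 \<le> t \<longrightarrow> t \<le> 1 \<longrightarrow> norm (iter (Suc n) t k - iter n t k) \<le> E * (1/2) ^ n * \<phi> t * wt k)"
  (is "?C n \<and> ?B n \<and> ?D n")
proof (induction n)
  case 0
  have "norm (duhamel (nonlin (\<lambda>t k. 0)) t k) \<le> E * \<phi> t * wt k" if t: "0 \<le> t" "t \<le> 1" for t k
  proof -
    have "norm (duhamel (nonlin (\<lambda>t k. 0)) t k) \<le> E * wt k * t\<^sup>2 / 2"
    proof (rule duhamel_le_linear[where F="nonlin (\<lambda>t k. 0)", OF continuous_on_nonlin[OF small_zero t(2)] t(1)])
      show "norm (nonlin (\<lambda>t k. 0) s k) \<le> E * wt k * s" if "0 \<le> s" "s \<le> t" for s
        using forcing[of s k] that t by (simp add: nonlin_def)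
    qed
    also have "\<dots> \<le> E * wt k * \<phi> t"
    proof -
      have "t\<^sup>2 * 1 \<le> \<phi> t"
        unfolding \<phi>_def using t lam0 by (intro mult_left_mono) auto
      then have "t\<^sup>2 / 2 \<le> \<phi> t"
        using \<phi>_nonneg[of t] by linarith
      then have "E * wt k * (t\<^sup>2 / 2) \<le> E * wt k * \<phi> t"
        using E0 by (intro mult_left_mono) auto
      then show ?thesis by simp
    qed
    finally show ?thesis by (simp add: mult_ac)
  qed
  then show ?case by simp
next
  case (Suc n)
  then have C: "?C n" and B: "?B n" and D: "?D n"
    by blast+
  have fac: "2 * E * (1 - (1/2) ^ m) * \<phi> t * wt k \<le> 2 * E * \<phi> t * wt k" for m t k
    using E0 by (intro mult_right_mono) (auto simp: mult_left_le)
  have sn: "small (iter n)"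
    using C B fac[of n] unfolding small_def by (meson order_trans)
  have C': "?C (Suc n)"
    by (auto intro!: continuous_intros continuous_on_duhamel continuous_on_nonlin sn)
  have B': "norm (iter (Suc n) t k) \<le> 2 * E * (1 - (1/2) ^ Suc n) * \<phi> t * wt k" if "0 \<le> t" "t \<le> 1" for t :: real and k
  proof -
    have "norm (iter (Suc n) t k) \<le> norm (iter n t k) + norm (iter (Suc n) t k - iter n t k)"
      using norm_triangle_ineq[of "iter n t k" "iter (Suc n) t k - iter n t k"] by simp
    also have "\<dots> \<le> 2 * E * (1 - (1/2) ^ n) * \<phi> t * wt k + E * (1/2) ^ n * \<phi> t * wt k"
      using B D that by (intro add_mono) blast+
    also have "\<dots> = 2 * E * (1 - (1/2) ^ Suc n) * \<phi> t * wt k"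
      by (simp add: algebra_simps)
    finally show ?thesis .
  qed
  have sSn: "small (iter (Suc n))"
    unfolding small_def
  proof (intro conjI allI impI)
    fix t :: real and k assume "0 \<le> t" "t \<le> 1"
    then show "norm (iter (Suc n) t k) \<le> 2 * E * \<phi> t * wt k"
      using B'[of t k] fac[of "Suc n" t k] by (meson order_trans)
  qed (use C' in blast)
  have "norm (iter (Suc (Suc n)) t k - iter (Suc n) t k) \<le> E * (1/2) ^ Suc n * \<phi> t * wt k"
    if t: "0 \<le> t" "t \<le> 1" for t k
  proof -
    have "iter (Suc (Suc n)) t k - iter (Suc n) t k
        = - (duhamel (nonlin (iter (Suc n))) t k - duhamel (nonlin (iter n)) t k)"
      by (simp only: iter.simps minus_diff_minus)
    then have "norm (iter (Suc (Suc n)) t k - iter (Suc n) t k)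
        = norm (duhamel (nonlin (iter (Suc n))) t k - duhamel (nonlin (iter n)) t k)"
      by (simp only: norm_minus_cancel)
    also have "\<dots> \<le> E * (1/2) ^ n / 2 * \<phi> t * wt k"
      by (rule duhamel_nonlin_diff_le_exp[OF sSn sn t]) (use D E0 in auto)
    finally show ?thesis
      by simp
  qed
  then show ?case
    using C' B' by blast
qed

lemma small_iter: "small (iter n)"
proof -
  have "2 * E * (1 - (1/2) ^ n) * \<phi> t * wt k \<le> 2 * E * \<phi> t * wt k" for t k
    using E0 by (intro mult_right_mono) (auto simp: mult_left_le)
  then show ?thesis
    using iter_properties[of n] unfolding small_def by (meson order_trans)
qed

lemma iter_step:
  "0 \<le> t \<Longrightarrow> t \<le> 1 \<Longrightarrow> norm (iter (Suc n) t k - iter n t k) \<le> E * (1/2) ^ n * \<phi> t * wt k"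
  using iter_properties[of n] by blast

lemma iter_dist:
  assumes "0 \<le> t" "t \<le> 1"
  shows "norm (iter (n + j) t k - iter n t k) \<le> 2 * E * (1/2) ^ n * \<phi> t * wt k"
proof -
  have "norm (iter (n + j) t k - iter n t k) \<le> 2 * E * ((1/2) ^ n - (1/2) ^ (n + j)) * \<phi> t * wt k"
  proof (induction j)
    case (Suc j)
    have "norm (iter (n + Suc j) t k - iter n t k)
        \<le> norm (iter (Suc (n + j)) t k - iter (n + j) t k) + norm (iter (n + j) t k - iter n t k)"
      using norm_triangle_ineq[of "iter (Suc (n + j)) t k - iter (n + j) t k" "iter (n + j) t k - iter n t k"]
      by (simp del: iter.simps)
    also have "\<dots> \<le> E * (1/2) ^ (n + j) * \<phi> t * wt k + 2 * E * ((1/2) ^ n - (1/2) ^ (n + j)) * \<phi> t * wt k"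
      by (intro add_mono iter_step assms Suc)
    also have "\<dots> = 2 * E * ((1/2) ^ n - (1/2) ^ (n + Suc j)) * \<phi> t * wt k"
      by (simp add: algebra_simps)
    finally show ?case .
  qed simp
  also have "\<dots> \<le> 2 * E * (1/2) ^ n * \<phi> t * wt k"
    using E0 by (intro mult_right_mono mult_left_mono) auto
  finally show ?thesis .
qed

text \<open>The limit of the iterates, as a telescoping series so that the M-test yields uniform
  convergence in time.\<close>

definition sol :: "real \<Rightarrow> int^3 \<Rightarrow> complex^3" where
  "sol t k = (\<Sum>n. iter (Suc n) t k - iter n t k)"

lemma uniform_limit_iter: "uniform_limit {0..1} (\<lambda>n t. iter n t k) (\<lambda>t. sol t k) sequentially"
proof -
  have "uniform_limit {0..1} (\<lambda>n t. \<Sum>i<n. iter (Suc i) t k - iter i t k) (\<lambda>t. sol t k) sequentially"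
    unfolding sol_def
  proof (rule Weierstrass_m_test)
    show "norm (iter (Suc n) t k - iter n t k) \<le> E * exp lam * wt k * (1/2) ^ n" if "t \<in> {0..1}" for n t
    proof -
      have "E * (1/2) ^ n * \<phi> t * wt k \<le> E * (1/2) ^ n * exp lam * wt k"
        using \<phi>_le[of t] that E0 by (intro mult_right_mono mult_left_mono) auto
      then show ?thesis
        using iter_step[of t n k] that by (simp add: mult_ac del: iter.simps)
    qed
    show "summable (\<lambda>n. E * exp lam * wt k * (1/2) ^ n)"
      by (intro summable_mult summable_geometric) auto
  qed
  moreover have "(\<Sum>i<n. iter (Suc i) t k - iter i t k) = iter n t k" for n t
    using sum_lessThan_telescope[of "\<lambda>n. iter n t k" n] by (simp del: iter.simps(2))
  ultimately show ?thesis
    by (simp only:)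
qed

lemma iter_tendsto: "0 \<le> t \<Longrightarrow> t \<le> 1 \<Longrightarrow> (\<lambda>n. iter n t k) \<longlonglongrightarrow> sol t k"
  using tendsto_uniform_limitI[OF uniform_limit_iter] by simp

lemma sol_iter_dist:
  assumes "0 \<le> t" "t \<le> 1"
  shows "norm (sol t k - iter n t k) \<le> 2 * E * (1/2) ^ n * \<phi> t * wt k"
proof (rule Lim_norm_ubound)
  show "(\<lambda>j. iter (n + j) t k - iter n t k) \<longlonglongrightarrow> sol t k - iter n t k"
    using LIMSEQ_ignore_initial_segment[OF iter_tendsto[OF assms, of k], of n]
    by (intro tendsto_diff tendsto_const) (simp add: add.commute)
qed (use iter_dist[OF assms] in auto)

lemma sol_bound: "0 \<le> t \<Longrightarrow> t \<le> 1 \<Longrightarrow> norm (sol t k) \<le> 2 * E * \<phi> t * wt k"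
  using sol_iter_dist[of t k 0] by simp

lemma small_sol: "small sol"
proof -
  have "continuous_on {0..1} (\<lambda>t. sol t k)" for k
    by (rule uniform_limit_theorem[OF _ uniform_limit_iter])
      (use small_iter in \<open>auto simp: small_def intro!: always_eventually\<close>)
  then show ?thesis
    using sol_bound by (simp add: small_def)
qed

lemma sol_fixed_point:
  assumes t: "0 \<le> t" "t \<le> 1"
  shows "sol t k = - duhamel (nonlin sol) t k"
proof (rule LIMSEQ_unique)
  show "(\<lambda>n. iter (Suc n) t k) \<longlonglongrightarrow> sol t k"
    by (rule LIMSEQ_Suc[OF iter_tendsto[OF t]])
  have "(\<lambda>n. duhamel (nonlin (iter n)) t k - duhamel (nonlin sol) t k) \<longlonglongrightarrow> 0"
  proof (rule Lim_null_comparison)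
    define B where "B = 2 * Cadv * (V + 1) * (2 * E * exp lam) * wt k * sqrt t"
    show "\<forall>\<^sub>F n in sequentially. norm (duhamel (nonlin (iter n)) t k - duhamel (nonlin sol) t k) \<le> B * (1/2) ^ n"
    proof (rule always_eventually, rule allI)
      fix n
      have "norm (duhamel (nonlin (iter n)) t k - duhamel (nonlin sol) t k)
          \<le> 2 * Cadv * (V + 1) * (2 * E * (1/2) ^ n * exp lam) * wt k * sqrt t"
      proof (rule duhamel_nonlin_diff_le_sqrt[OF small_iter small_sol t])
        fix s k assume "0 \<le> s" "s \<le> t"
        then have s: "0 \<le> s" "s \<le> 1" using t by auto
        have "2 * E * (1/2) ^ n * \<phi> s * wt k \<le> 2 * E * (1/2) ^ n * exp lam * wt k"
          using \<phi>_le[OF s] E0 by (intro mult_right_mono mult_left_mono) auto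
        then show "norm (iter n s k - sol s k) \<le> 2 * E * (1/2) ^ n * exp lam * wt k"
          using sol_iter_dist[OF s, of k n] norm_minus_commute[of "iter n s k" "sol s k"] by linarith
      qed (use E0 in auto)
      then show "norm (duhamel (nonlin (iter n)) t k - duhamel (nonlin sol) t k) \<le> B * (1/2) ^ n"
        by (simp add: B_def algebra_simps)
    qed
    show "(\<lambda>n. B * (1/2) ^ n) \<longlonglongrightarrow> 0"
      using tendsto_mult_right_zero[OF LIMSEQ_power_zero[of "1/2::real"], of B] by simp
  qed
  from tendsto_minus[OF LIM_zero_cancel[OF this]]
  show "(\<lambda>n. iter (Suc n) t k) \<longlonglongrightarrow> - duhamel (nonlin sol) t k"
    by simp
qed

lemma hermitian_nonlin: "0 \<le> s \<Longrightarrow> s \<le> 1 \<Longrightarrow> hermitian (d s) \<Longrightarrow> hermitian (nonlin d s)"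
  unfolding nonlin_def using v_herm[of s] by (intro hermitian_adv) (auto simp: hermitian_def)

lemma hermitian_iter: "0 \<le> t \<Longrightarrow> t \<le> 1 \<Longrightarrow> hermitian (iter n t)"
proof (induction n arbitrary: t)
  case (Suc n)
  have "hermitian (duhamel (nonlin (iter n)) t)"
    using Suc by (intro hermitian_duhamel continuous_on_nonlin small_iter hermitian_nonlin) auto
  then show ?case
    by (simp add: hermitian_def)
qed (simp add: hermitian_def)

lemma hermitian_sol:
  assumes t: "0 \<le> t" "t \<le> 1"
  shows "hermitian (sol t)"
  unfolding hermitian_def
proof (intro allI)
  fix k i
  have "(\<lambda>n. iter n t (- k) $ i) \<longlonglongrightarrow> sol t (- k) $ i"
    by (intro tendsto_vec_nth iter_tendsto t)
  moreover have "(\<lambda>n. iter n t (- k) $ i) = (\<lambda>n. cnj (iter n t k $ i))"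
    using hermitian_iter[OF t] by (simp add: hermitian_def)
  moreover have "(\<lambda>n. cnj (iter n t k $ i)) \<longlonglongrightarrow> cnj (sol t k $ i)"
    by (intro tendsto_cnj tendsto_vec_nth iter_tendsto t)
  ultimately show "sol t (- k) $ i = cnj (sol t k $ i)"
    using LIMSEQ_unique by metis
qed

text \<open>With zero perturbation \<open>nonlin\<close> is the forcing, so the left-hand side is a
  difference of two Duhamel integrals, and the Lipschitz estimate in sqrt t applies to
  \<open>sol\<close>, which is itself of size \<open>2 * E * \<phi> t\<close>.\<close>

lemma sol_first_order:
  assumes t: "0 \<le> t" "t \<le> 1"
  shows "norm (sol t k + duhamel (\<lambda>s. adv (v s) (v s)) t k) \<le> 4 * Cadv * (V + 1) * E * \<phi> t * wt k * sqrt t"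
proof -
  have "norm (duhamel (nonlin sol) t k - duhamel (nonlin (\<lambda>t k. 0)) t k)
      \<le> 2 * Cadv * (V + 1) * (2 * E * \<phi> t) * wt k * sqrt t"
  proof (rule duhamel_nonlin_diff_le_sqrt[OF small_sol small_zero t])
    fix s k assume s: "0 \<le> s" "s \<le> t"
    have "2 * E * \<phi> s * wt k \<le> 2 * E * \<phi> t * wt k"
      using \<phi>_mono[OF s] E0 by (intro mult_right_mono mult_left_mono) auto
    then show "norm (sol s k - 0) \<le> 2 * E * \<phi> t * wt k"
      using sol_bound[of s k] s t by simp
  qed (use E0 in auto)
  moreover have "nonlin (\<lambda>t k. 0) = (\<lambda>s. adv (v s) (v s))"
    by (simp add: nonlin_def fun_eq_iff)
  ultimately show ?thesis
    unfolding sol_fixed_point[OF t] by (simp add: norm_minus_commute algebra_simps)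
qed

end

section \<open>From coefficient families back to real vector fields\<close>

lemma summable_norm_wt:
  assumes "\<And>k. norm (a k) \<le> A * wt k"
  shows "(\<lambda>k. norm (a k)) summable_on UNIV"
  by (rule summable_on_comparison_test[OF summable_on_cmult_right[OF summable_wt]]) (use assms in auto)

lemma summable_wt_pair:
  "(\<lambda>(l, k). wt l * wt (k - l)) summable_on (UNIV \<times> UNIV)"
proof (rule summable_on_SigmaI)
  show "((\<lambda>k. case (l, k) of (l, k) \<Rightarrow> wt l * wt (k - l)) has_sum wt l * (\<Sum>\<^sub>\<infinity>k. wt k)) UNIV" for l
  proof -
    have "((\<lambda>k. wt (k - l)) has_sum (\<Sum>\<^sub>\<infinity>k. wt k)) UNIV"
      using has_sum_reindex_bij_betw[OF bij_diff_right, of wt] has_sum_infsum[OF summable_wt] by simp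
    then show ?thesis
      by (simp add: has_sum_cmult_right)
  qed
  show "(\<lambda>l. wt l * (\<Sum>\<^sub>\<infinity>k. wt k)) summable_on UNIV"
    by (intro summable_on_cmult_left summable_wt)
qed auto

text \<open>The product is summed over pairs (l, k - l) of frequencies; exchanging the sums is
  legitimate because \<open>wt l * wt (k - l)\<close> is summable over all pairs.\<close>

lemma conv_fourier_sum:
  assumes a: "\<And>k. norm (a k) \<le> A * wt k" and b: "\<And>k. norm (b k) \<le> B * wt k"
  shows "(\<Sum>\<^sub>\<infinity>k. a k $ i * fourier_mode k x) * (\<Sum>\<^sub>\<infinity>k. b k $ j * fourier_mode k x)
    = (\<Sum>\<^sub>\<infinity>k. conv a b k $ i $ j * fourier_mode k x)"
proof -
  define f where "f l k = a l $ i * fourier_mode l x * (b (k - l) $ j * fourier_mode (k - l) x)" for l k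
  have "(\<lambda>p. norm (case p of (l, k) \<Rightarrow> f l k)) summable_on (UNIV \<times> UNIV)"
  proof (rule summable_on_comparison_test[OF summable_on_cmult_right[OF summable_wt_pair, of "A * B"]])
    fix p :: "(int^3) \<times> (int^3)"
    show "norm (case p of (l, k) \<Rightarrow> f l k) \<le> A * B * (case p of (l, k) \<Rightarrow> wt l * wt (k - l))"
      using conv_term_le[OF a b, where l="fst p" and i=i and k="snd p" and j=j] by (simp add: f_def case_prod_beta norm_mult)
  qed auto
  then have s: "(\<lambda>(l, k). f l k) summable_on (UNIV \<times> UNIV)"
    by (rule abs_summable_summable)
  have "(\<Sum>\<^sub>\<infinity>k. conv a b k $ i $ j * fourier_mode k x) = (\<Sum>\<^sub>\<infinity>k. \<Sum>\<^sub>\<infinity>l. f l k)"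
  proof (rule infsum_cong)
    fix k
    have "fourier_mode k x = fourier_mode l x * fourier_mode (k - l) x" for l
      using fourier_mode_add[of l "k - l" x] by simp
    then have "f l k = a l $ i * b (k - l) $ j * fourier_mode k x" for l
      by (simp add: f_def mult_ac)
    then show "conv a b k $ i $ j * fourier_mode k x = (\<Sum>\<^sub>\<infinity>l. f l k)"
      by (simp add: conv_def infsum_cmult_left')
  qed
  also have "\<dots> = (\<Sum>\<^sub>\<infinity>l. \<Sum>\<^sub>\<infinity>k. f l k)"
    by (rule infsum_swap_banach[OF s, symmetric])
  also have "\<dots> = (\<Sum>\<^sub>\<infinity>l. a l $ i * fourier_mode l x * (\<Sum>\<^sub>\<infinity>k. b k $ j * fourier_mode k x))"
  proof (rule infsum_cong)
    fix l
    show "(\<Sum>\<^sub>\<infinity>k. f l k) = a l $ i * fourier_mode l x * (\<Sum>\<^sub>\<infinity>k. b k $ j * fourier_mode k x)"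
      unfolding f_def infsum_cmult_right'
      using infsum_reindex_bij_betw[OF bij_diff_right, of "\<lambda>k. b k $ j * fourier_mode k x"] by simp
  qed
  also have "\<dots> = (\<Sum>\<^sub>\<infinity>k. a k $ i * fourier_mode k x) * (\<Sum>\<^sub>\<infinity>k. b k $ j * fourier_mode k x)"
    by (rule infsum_cmult_left')
  finally show ?thesis ..
qed

lemma hermitian_fourier_sum_real:
  assumes "hermitian a"
  shows "Im (\<Sum>\<^sub>\<infinity>k. a k $ i * fourier_mode k x) = 0"
proof -
  have "cnj (\<Sum>\<^sub>\<infinity>k. a k $ i * fourier_mode k x) = (\<Sum>\<^sub>\<infinity>k. cnj (a k $ i * fourier_mode k x))"
    by (rule infsum_cnj[symmetric])
  also have "\<dots> = (\<Sum>\<^sub>\<infinity>k. a (- k) $ i * fourier_mode (- k) x)"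
    using assms by (simp add: hermitian_def fourier_mode_uminus)
  also have "\<dots> = (\<Sum>\<^sub>\<infinity>k. a k $ i * fourier_mode k x)"
    by (rule infsum_reindex_bij_betw[OF bij_neg])
  finally show ?thesis
    by (metis Reals_cnj_iff complex_is_Real_iff)
qed

text \<open>Taking the real part makes the field real by construction; for a hermitian family the
  sum is already real and nothing is lost.\<close>

definition real_field :: "(int^3 \<Rightarrow> complex^3) \<Rightarrow> real^3 \<Rightarrow> real^3" where
  "real_field a x = (\<chi> i. Re (\<Sum>\<^sub>\<infinity>k. a k $ i * fourier_mode k x))"

lemma periodic_real_field: "periodic (real_field a)"
  using periodic_fourier_mode by (simp add: periodic_def real_field_def)

lemma real_field_nth:
  assumes "hermitian a"
  shows "complex_of_real (real_field a x $ i) = (\<Sum>\<^sub>\<infinity>k. a k $ i * fourier_mode k x)"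
  using hermitian_fourier_sum_real[OF assms] by (simp add: real_field_def complex_eq_iff)

lemma complex_vec_real_field:
  assumes "hermitian a" "\<And>k. norm (a k) \<le> A * wt k"
  shows "complex_vec (real_field a x) = fourier_series a x"
  using fourier_series_nth(1)[OF summable_norm_wt[OF assms(2)]]
  by (simp add: vec_eq_iff real_field_nth[OF assms(1)])

lemma real_field_norm_le:
  assumes "\<And>k. norm (a k) \<le> A * wt k"
  shows "\<bar>real_field a x $ i\<bar> \<le> A * (\<Sum>\<^sub>\<infinity>k. wt k)"
proof -
  have s: "(\<lambda>k. norm (a k $ i)) summable_on UNIV"
    by (rule fourier_series_nth(2)[OF summable_norm_wt[OF assms]])
  have "\<bar>real_field a x $ i\<bar> \<le> norm (\<Sum>\<^sub>\<infinity>k. a k $ i * fourier_mode k x)"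
    by (simp add: real_field_def abs_Re_le_cmod)
  also have "\<dots> \<le> (\<Sum>\<^sub>\<infinity>k. norm (a k $ i))"
    by (rule norm_fourier_sum_le[OF s])
  also have "\<dots> \<le> (\<Sum>\<^sub>\<infinity>k. A * wt k)"
    by (rule infsum_mono[OF s summable_on_cmult_right[OF summable_wt]])
      (rule order_trans[OF Finite_Cartesian_Product.norm_nth_le assms])
  finally show ?thesis
    by (simp add: infsum_cmult_right')
qed

lemma fourier_coeff_real_field:
  assumes "hermitian a" "\<And>k. norm (a k) \<le> A * wt k"
  shows "fourier_coeff (\<lambda>x. real_field a x $ i) k = a k $ i"
  by (rule fourier_coeff_fourier_sum[OF fourier_series_nth(2)[OF summable_norm_wt[OF assms(2)]]])
    (rule real_field_nth[OF assms(1)])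

lemma fourier_vec_real_field:
  assumes "hermitian a" "\<And>k. norm (a k) \<le> A * wt k"
  shows "fourier_vec (real_field a) = a"
  by (simp add: fourier_vec_def fun_eq_iff vec_eq_iff fourier_coeff_real_field[OF assms])

text \<open>Identifies the nonlinearity of \<open>mild_solution\<close>, which is defined through
  integrals over the cell, with the convolution on which \<open>adv\<close> is built.\<close>

lemma fourier_tensor_real_field:
  assumes "hermitian a" "\<And>k. norm (a k) \<le> A * wt k"
  shows "fourier_tensor (tensor (real_field a) (real_field a)) = conv a a"
proof -
  have A0: "0 \<le> A"
    using assms(2)[of 0] order_trans[OF norm_ge_zero] wt_pos[of 0] by (metis zero_le_mult_iff not_less)
  have "fourier_coeff (\<lambda>x. real_field a x $ i * real_field a x $ j) k = conv a a k $ i $ j" for i j k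
  proof (rule fourier_coeff_fourier_sum[where c="\<lambda>k. conv a a k $ i $ j"])
    show "(\<lambda>k. norm (conv a a k $ i $ j)) summable_on UNIV"
      by (rule summable_norm_wt[where A="A * A * Kw"])
        (use norm_conv_le[OF assms(2,2)] A0 in \<open>simp add: mult.assoc\<close>)
    show "complex_of_real (real_field a x $ i * real_field a x $ j)
        = (\<Sum>\<^sub>\<infinity>k. conv a a k $ i $ j * fourier_mode k x)" for x
      by (simp add: real_field_nth[OF assms(1)] conv_fourier_sum[OF assms(2,2)])
  qed
  then show ?thesis
    by (simp add: fourier_tensor_def tensor_def fun_eq_iff vec_eq_iff)
qed

lemma vector_smult_scaleR: "z *s (r *\<^sub>R a) = r *\<^sub>R (z *s a)" for a :: "complex^3"
  by (simp add: vec_eq_iff scaleR_conv_of_real mult_ac)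

text \<open>The sum over frequencies and the time integral may be exchanged since the heat factor is
  at most 1 and |k| wt k is summable. Here the gauge integral in \<open>duhamel\<close> meets the
  Lebesgue integral of \<open>mild_solution\<close>.\<close>

lemma fourier_series_duhamel:
  assumes F: "\<And>k. continuous_on {0..t} (\<lambda>s. F s k)" and t: "0 \<le> t"
    and le: "\<And>s k. 0 \<le> s \<Longrightarrow> s \<le> t \<Longrightarrow> norm (F s k) \<le> A * (sqrt (freq_norm_sq k) * wt k)"
  shows "(\<integral>s\<in>{0..t}. fourier_series (heat (t - s) (F s)) x \<partial>lborel) = fourier_series (duhamel F t) x"
proof -
  define f where "f k s = indicator {0..t} s *\<^sub>R (fourier_mode k x *s heat (t - s) (F s) k)" for k s
  have bl: "bounded_linear (\<lambda>a::complex^3. fourier_mode k x *s a)" for k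
    by (rule bounded_linear_intro[of _ 1])
      (simp_all add: vector_add_ldistrib vector_smult_scaleR norm_vector_smult)
  have c: "continuous_on {0..t} (\<lambda>s. fourier_mode k x *s heat (t - s) (F s) k)" for k
    by (rule bounded_linear.continuous_on[OF bl continuous_on_heat[OF F]])
  have int: "integrable lborel (f k)" for k
    unfolding f_def by (rule borel_integrable_compact[OF compact_Icc c])
  have nf: "norm (f k s) \<le> indicator {0..t} s *\<^sub>R (A * (sqrt (freq_norm_sq k) * wt k))" for k s
  proof (cases "s \<in> {0..t}")
    case True
    have "exp (- (t - s) * freq_norm_sq k) * norm (F s k) \<le> 1 * norm (F s k)"
      using True by (intro mult_right_mono) (auto simp: mult_nonpos_nonneg)
    also have "\<dots> \<le> A * (sqrt (freq_norm_sq k) * wt k)"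
      using le[of s k] True by simp
    finally show ?thesis
      using True by (simp add: f_def norm_vector_smult heat_def)
  qed (simp add: f_def)
  have "(\<lambda>k. \<integral>s. norm (f k s) \<partial>lborel) summable_on UNIV"
  proof (rule summable_on_comparison_test[OF summable_on_cmult_right[OF summable_sqrt_wt, of "t * A"]])
    fix k
    have i2: "integrable lborel (\<lambda>s. indicator {0..t} s *\<^sub>R (A * (sqrt (freq_norm_sq k) * wt k)))"
      by (rule borel_integrable_compact[OF compact_Icc continuous_on_const])
    have "(\<integral>s. norm (f k s) \<partial>lborel) \<le> (\<integral>s. indicator {0..t} s *\<^sub>R (A * (sqrt (freq_norm_sq k) * wt k)) \<partial>lborel)"
      by (intro integral_mono integrable_norm int i2 nf)
    also have "\<dots> = t * A * (sqrt (freq_norm_sq k) * wt k)"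
      using t by simp
    finally show "(\<integral>s. norm (f k s) \<partial>lborel) \<le> t * A * (sqrt (freq_norm_sq k) * wt k)" .
  qed simp
  note sw = integral_infsum(2)[OF sigma_finite_lborel int this]
  have "(\<integral>s\<in>{0..t}. fourier_series (heat (t - s) (F s)) x \<partial>lborel) = (\<integral>s. (\<Sum>\<^sub>\<infinity>k. f k s) \<partial>lborel)"
    unfolding set_lebesgue_integral_def f_def fourier_series_def
    by (rule Bochner_Integration.integral_cong) (auto simp: infsum_scaleR_right)
  also have "\<dots> = (\<Sum>\<^sub>\<infinity>k. \<integral>s. f k s \<partial>lborel)"
    by (rule sw)
  also have "\<dots> = (\<Sum>\<^sub>\<infinity>k. fourier_mode k x *s duhamel F t k)"
  proof (rule infsum_cong)
    fix k
    have hi: "(\<lambda>s. heat (t - s) (F s) k) integrable_on {0..t}"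
      by (intro integrable_continuous_interval continuous_on_heat F)
    have "(\<integral>s. f k s \<partial>lborel) = integral {0..t} (\<lambda>s. fourier_mode k x *s heat (t - s) (F s) k)"
      using set_borel_integral_eq_integral(2)[of "{0..t}" "\<lambda>s. fourier_mode k x *s heat (t - s) (F s) k"] int[of k, unfolded f_def[abs_def]]
      by (simp add: f_def set_integrable_def set_lebesgue_integral_def)
    then show "(\<integral>s. f k s \<partial>lborel) = fourier_mode k x *s duhamel F t k"
      using integral_linear[OF hi bl] by (simp add: duhamel_def o_def)
  qed
  finally show ?thesis
    by (simp add: fourier_series_def)
qed

lemma borel_measurable_Re_comp: "f \<in> borel_measurable M \<Longrightarrow> (\<lambda>x. Re (f x)) \<in> borel_measurable M"
  by (rule borel_measurable_continuous_on[of Re]) (auto intro: continuous_intros)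

lemma borel_measurable_real_field: "(\<lambda>x. real_field a x $ i) \<in> borel_measurable torus"
  unfolding real_field_def vec_lambda_beta
  by (intro borel_measurable_Re_comp borel_measurable_fourier_sum)

text \<open>The fixed point equation on coefficients turns into the Duhamel formula at every x,
  because all series involved are dominated by summable weights.\<close>

lemma (in perturbed_heat_flow) mild_solution_real_field:
  assumes u0: "\<And>x. real_field (v 0) x = u0 x" and v: "\<And>t. v t = heat t (v 0)"
  shows "mild_solution 1 u0 (\<lambda>t. real_field (\<lambda>k. v t k + sol t k))"
proof -
  define c where "c t k = v t k + sol t k" for t k
  have cb: "norm (c t k) \<le> (V + 1) * wt k" if "0 \<le> t" "t \<le> 1" for t k
    unfolding c_def by (rule small_sum_bound[OF small_sol that])
  have ch: "hermitian (c t)" if "0 \<le> t" "t \<le> 1" for t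
    using v_herm[OF that] hermitian_sol[OF that] by (simp add: hermitian_def c_def)
  have cc: "continuous_on {0..1} (\<lambda>t. c t k)" for k
    unfolding c_def using small_sol v_cont by (auto simp: small_def intro!: continuous_intros)
  have u0': "fourier_vec u0 = v 0"
  proof -
    have "fourier_vec (real_field (v 0)) = v 0"
      by (rule fourier_vec_real_field[where A=V]) (use v_herm v_bound in auto)
    moreover have "real_field (v 0) = u0"
      using u0 by blast
    ultimately show ?thesis by simp
  qed
  have nonlin: "leray (div_tensor (fourier_tensor (tensor (real_field (c s)) (real_field (c s))))) = nonlin sol s"
    if "0 \<le> s" "s \<le> 1" for s
  proof -
    have "fourier_tensor (tensor (real_field (c s)) (real_field (c s))) = conv (c s) (c s)"
      by (rule fourier_tensor_real_field[where A="V + 1"]) (use cb ch that in auto)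
    then show ?thesis
      by (simp add: nonlin_def adv_def c_def[abs_def])
  qed
  have "mild_solution 1 u0 (\<lambda>t. real_field (c t))"
    unfolding mild_solution_def
  proof (intro conjI ballI)
    show "periodic (real_field (c t))" for t
      by (rule periodic_real_field)
    let ?T = "restrict_space lborel {0<..<1::real}"
    have mc: "(\<lambda>t. c t k $ i) \<in> borel_measurable ?T" for k i
    proof -
      have "continuous_on {0<..<1} (\<lambda>t. c t k $ i)"
        by (intro continuous_intros continuous_on_subset[OF cc]) auto
      then have "(\<lambda>t. c t k $ i) \<in> borel_measurable (restrict_space borel {0<..<1})"
        by (rule borel_measurable_continuous_on_restrict)
      then show ?thesis
        by (simp cong: measurable_cong_sets add: sets_restrict_space_cong[OF sets_lborel])
    qed
    have m: "(\<lambda>p. real_field (c (fst p)) (snd p)) \<in> borel_measurable (?T \<Otimes>\<^sub>M torus)"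
      unfolding real_field_def
    proof (rule borel_measurable_vec, unfold vec_lambda_beta, intro borel_measurable_Re_comp borel_measurable_infsum borel_measurable_times)
      show "(\<lambda>p. c (fst p) k $ i) \<in> borel_measurable (?T \<Otimes>\<^sub>M torus)" for k i
        by (rule measurable_compose[OF measurable_fst mc])
      show "(\<lambda>p. fourier_mode k (snd p)) \<in> borel_measurable (?T \<Otimes>\<^sub>M torus)" for k
        by (rule measurable_compose[OF measurable_snd borel_measurable_fourier_mode])
    qed
    have "Linf_norm (?T \<Otimes>\<^sub>M torus) (\<lambda>(t, x). real_field (c t) x) \<le> ereal (3 * ((V + 1) * (\<Sum>\<^sub>\<infinity>k. wt k)))"
      unfolding Linf_norm_def
    proof (rule esssup_I)
      show "(\<lambda>x. ereal (norm (case x of (t, x) \<Rightarrow> real_field (c t) x))) \<in> borel_measurable (?T \<Otimes>\<^sub>M torus)"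
        using m by (simp add: case_prod_beta')
      show "AE x in ?T \<Otimes>\<^sub>M torus. ereal (norm (case x of (t, x) \<Rightarrow> real_field (c t) x)) \<le> ereal (3 * ((V + 1) * (\<Sum>\<^sub>\<infinity>k. wt k)))"
      proof (rule AE_I2)
        fix p assume "p \<in> space (?T \<Otimes>\<^sub>M torus)"
        then have p: "0 \<le> fst p" "fst p \<le> 1"
          by (auto simp: space_pair_measure space_restrict_space)
        have "norm (real_field (c (fst p)) (snd p)) \<le> (\<Sum>i\<in>UNIV. norm (real_field (c (fst p)) (snd p) $ i))"
          by (rule norm_vec_le_sum)
        also have "\<dots> \<le> (\<Sum>i\<in>(UNIV::3 set). (V + 1) * (\<Sum>\<^sub>\<infinity>k. wt k))"
          using real_field_norm_le[OF cb[OF p]] by (intro sum_mono) auto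
        finally show "ereal (norm (case p of (t, x) \<Rightarrow> real_field (c t) x)) \<le> ereal (3 * ((V + 1) * (\<Sum>\<^sub>\<infinity>k. wt k)))"
          by (simp add: case_prod_beta')
      qed
    qed
    then show "in_Linf (?T \<Otimes>\<^sub>M torus) (\<lambda>(t, x). real_field (c t) x)"
      using m unfolding in_Linf_def by (auto simp: case_prod_beta')
    \<comment> \<open>\<phi> vanishes at time 0, hence so does the perturbation.\<close>
    have "c 0 = v 0"
      using sol_bound[of 0] by (simp add: c_def[abs_def] \<phi>_def)
    then show "AE x in torus. real_field (c 0) x = u0 x"
      using u0 by simp
    fix t :: real assume "t \<in> {0<..1}"
    then have t: "0 < t" "t \<le> 1" "0 \<le> t" by auto
    have nlb: "norm (nonlin sol s k) \<le> Cadv * ((V + 1) * (V + 1)) * (sqrt (freq_norm_sq k) * wt k)"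
      if "0 \<le> s" "s \<le> t" for s k
      unfolding nonlin_def
      by (rule norm_adv_le) (use cb[unfolded c_def] that t V0 in auto)
    have si: "(\<integral>s\<in>{0..t}. fourier_series (heat (t - s)
         (leray (div_tensor (fourier_tensor (tensor (real_field (c s)) (real_field (c s))))))) x \<partial>lborel)
        = fourier_series (duhamel (nonlin sol) t) x" for x
    proof -
      have "(\<integral>s\<in>{0..t}. fourier_series (heat (t - s)
         (leray (div_tensor (fourier_tensor (tensor (real_field (c s)) (real_field (c s))))))) x \<partial>lborel)
        = (\<integral>s\<in>{0..t}. fourier_series (heat (t - s) (nonlin sol s)) x \<partial>lborel)"
        by (rule set_lebesgue_integral_cong) (use t nonlin in auto)
      also have "\<dots> = fourier_series (duhamel (nonlin sol) t) x"
        by (rule fourier_series_duhamel[OF continuous_on_nonlin[OF small_sol t(2)] t(3) nlb])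
      finally show ?thesis .
    qed
    have e: "fourier_series (c t) x = fourier_series (v t) x - fourier_series (duhamel (nonlin sol) t) x" for x
    proof -
      have s1: "(\<lambda>k. fourier_mode k x *s v t k) summable_on UNIV"
        by (rule fourier_series_nth(3)[OF summable_norm_wt[OF v_bound]]) (use t in auto)
      have s2: "(\<lambda>k. fourier_mode k x *s sol t k) summable_on UNIV"
        by (rule fourier_series_nth(3)[OF summable_norm_wt[OF sol_bound]]) (use t in auto)
      have "fourier_series (c t) x = fourier_series (v t) x + fourier_series (sol t) x"
        unfolding fourier_series_def c_def vector_add_ldistrib by (rule infsum_add[OF s1 s2])
      also have "fourier_series (sol t) x = - fourier_series (duhamel (nonlin sol) t) x"
        unfolding fourier_series_def infsum_uminus[symmetric]
        by (rule infsum_cong) (simp add: sol_fixed_point[OF t(3) t(2)] vec_eq_iff)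
      finally show ?thesis by simp
    qed
    show "AE x in torus. complex_vec (real_field (c t) x) =
        fourier_series (heat t (fourier_vec u0)) x -
        (\<integral>s\<in>{0..t}. fourier_series (heat (t - s)
         (leray (div_tensor (fourier_tensor (tensor (real_field (c s)) (real_field (c s))))))) x \<partial>lborel)"
      unfolding si u0' v[symmetric] e[symmetric]
      by (rule AE_I2, rule complex_vec_real_field[OF ch cb]) (use t in auto)
  qed
  then show ?thesis
    by (simp add: c_def[abs_def])
qed

section \<open>The initial data\<close>

lemma abs_exp_neg_diff_le:
  fixes x y :: real
  assumes "0 \<le> x" "0 \<le> y"
  shows "\<bar>exp (- x) - exp (- y)\<bar> \<le> \<bar>x - y\<bar>"
proof -
  have *: "exp (- a) - exp (- b) \<le> b - a" if "0 \<le> a" "a \<le> b" for a b :: real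
  proof -
    have "exp (- a) - exp (- b) = exp (- a) * (1 - exp (- (b - a)))"
      by (simp add: algebra_simps flip: exp_add)
    also have "\<dots> \<le> 1 * (b - a)"
    proof (rule mult_mono)
      show "1 - exp (- (b - a)) \<le> b - a"
        using exp_ge_add_one_self[of "- (b - a)"] by linarith
    qed (use that in auto)
    finally show ?thesis by simp
  qed
  show ?thesis
    using *[of x y] *[of y x] assms by (cases "x \<le> y") auto
qed

text \<open>For |k1| = |k2| = 1 and |k3| = m the quantity 1 + |k|^2 is 3 + m^2. Four of its powers
  pay for \<open>wt\<close>, the fifth for the derivative in the divergence, and m + 1 is the factor
  in \<open>norm_G_le\<close>.\<close>

lemma polynomial_geometric_bound:
  obtains P :: real where "0 < P" "\<And>m::nat. (3 + (real m)\<^sup>2) ^ 5 * (real m + 1) * (1/2) ^ m \<le> P"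
proof -
  have "(\<lambda>m::nat. (3 + (real m)\<^sup>2) ^ 5 * (real m + 1) * (1/2) ^ m) \<longlonglongrightarrow> 0"
    by real_asymp
  then have "Bseq (\<lambda>m::nat. (3 + (real m)\<^sup>2) ^ 5 * (real m + 1) * (1/2) ^ m)"
    by (rule convergent_imp_Bseq[OF convergentI])
  then obtain P where P: "0 < P" "\<And>m::nat. norm ((3 + (real m)\<^sup>2) ^ 5 * (real m + 1) * (1/2) ^ m) \<le> P"
    by (auto elim!: BseqE)
  show ?thesis
  proof (rule that[OF P(1)])
    fix m :: nat
    show "(3 + (real m)\<^sup>2) ^ 5 * (real m + 1) * (1/2) ^ m \<le> P"
      using P(2)[of m] by (rule order_trans[rotated]) simp
  qed
qed

text \<open>The function \<open>N / (N + sin \<theta>)\<close> is a Poisson kernel: its Fourier coefficients form the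
  two-sided geometric sequence \<open>a\<close> with ratio \<open>\<i> r\<close>, where \<open>r = N - sqrt (N\<^sup>2 - 1)\<close>.\<close>

locale swirl =
  fixes N r c :: real
  assumes N3: "3 \<le> N" and r0: "0 < r" and r_eq: "r\<^sup>2 + 1 = 2 * N * r"
    and r_ge: "1 / (2 * N) \<le> r" and r_le: "r \<le> 1 / N"
    and c_eq: "c * (N - r) = N" and c_ge: "1 \<le> c" and c_le: "c \<le> 2"
begin

lemma r_third: "r \<le> 1/3"
proof -
  have "1 / N \<le> 1 / 3" using N3 by (intro divide_left_mono) auto
  then show ?thesis using r_le by linarith
qed

definition a :: "int \<Rightarrow> complex" where
  "a n = of_real c * (if 0 \<le> n then (\<i> * of_real r) ^ nat n else (- \<i> * of_real r) ^ nat (- n))"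

text \<open>Fourier coefficients of the reciprocal factor (N + sin \<theta>) / N.\<close>

definition b :: "int \<Rightarrow> complex" where
  "b n = (if n = 0 then 1 else if n = 1 then - \<i> / of_real (2 * N) else if n = - 1 then \<i> / of_real (2 * N) else 0)"

lemma norm_a: "norm (a n) = c * r ^ nat \<bar>n\<bar>"
  using c_ge r0 by (auto simp: a_def norm_mult norm_power)

lemma a_uminus: "a (- n) = cnj (a n)"
proof (cases n "0::int" rule: linorder_cases)
  case less
  then show ?thesis by (simp add: a_def)
next
  case greater
  then show ?thesis by (simp add: a_def)
qed (simp add: a_def)

lemma b_uminus: "b (- n) = cnj (b n)"
  by (auto simp: b_def)

text \<open>The equation (N + sin \<theta>) f = N at a positive frequency: multiplication by sin
  \<theta> shifts frequencies by one in both directions. It holds because i r is a root of the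
  characteristic polynomial, by r^2 + 1 = 2 N r.\<close>

lemma a_recurrence_pos: "of_real N * a (int n + 1) + (a (int n) - a (int n + 2)) / (2 * \<i>) = 0"
proof -
  define z where "z = \<i> * complex_of_real r"
  have "a (int n) = of_real c * z ^ n" "a (int n + 1) = of_real c * z ^ n * z" "a (int n + 2) = of_real c * z ^ n * z\<^sup>2"
    by (simp_all add: a_def z_def nat_add_distrib power_add power2_eq_square)
  then have "of_real N * a (int n + 1) + (a (int n) - a (int n + 2)) / (2 * \<i>)
      = of_real c * z ^ n * (of_real N * z + (1 - z\<^sup>2) / (2 * \<i>))"
    by (simp add: algebra_simps diff_divide_distrib)
  also have "of_real N * z + (1 - z\<^sup>2) / (2 * \<i>) = \<i> * of_real (2 * N * r - (r\<^sup>2 + 1)) / 2"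
    by (simp add: z_def field_simps power2_eq_square)
  finally show ?thesis
    using r_eq by simp
qed

lemma a_recurrence:
  assumes "n \<noteq> 0"
  shows "of_real N * a n + (a (n - 1) - a (n + 1)) / (2 * \<i>) = 0"
proof (cases "0 < n")
  case True
  then obtain m where "n = int m + 1"
    by (metis add.commute zero_less_imp_eq_int Suc_pred int_Suc of_nat_Suc)
  then show ?thesis
    using a_recurrence_pos[of m] by (simp add: add.commute)
next
  case False
  with assms have "0 < - n" by simp
  then obtain m where m: "- n = int m + 1"
    by (metis add.commute zero_less_imp_eq_int Suc_pred int_Suc of_nat_Suc)
  then have "n = - (int m + 1)" "n - 1 = - (int m + 2)" "n + 1 = - int m"
    by auto
  then have n: "a n = cnj (a (int m + 1))" "a (n - 1) = cnj (a (int m + 2))" "a (n + 1) = cnj (a (int m))"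
    using a_uminus by metis+
  have "of_real N * a n + (a (n - 1) - a (n + 1)) / (2 * \<i>)
      = cnj (of_real N * a (int m + 1) + (a (int m) - a (int m + 2)) / (2 * \<i>))"
    unfolding n by (simp add: field_simps)
  then show ?thesis
    unfolding a_recurrence_pos by simp
qed

text \<open>At frequency 0 the two one-sided geometric sequences meet, and \<open>c\<close> is the
  normalisation that makes the equation hold there.\<close>

lemma a_recurrence_0: "of_real N * a 0 + (a (- 1) - a 1) / (2 * \<i>) = of_real N"
proof -
  have "of_real N * a 0 + (a (- 1) - a 1) / (2 * \<i>) = of_real (c * (N - r))"
    by (simp add: a_def field_simps)
  then show ?thesis
    unfolding c_eq .
qed

lemma summable_a: "(\<lambda>n. norm (a n)) summable_on UNIV"
proof -
  have geo: "(\<lambda>n. c * r ^ n) summable_on UNIV"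
    using r0 r_third by (intro summable_on_cmult_right) (simp add: summable_on_UNIV_nonneg_real_iff summable_geometric)
  from summable_on_nat_abs[OF geo] show ?thesis
    by (simp add: norm_a)
qed

text \<open>The sum S exists by absolute convergence. Index shifts multiply it by cis
  (\<plusminus>\<theta>), so the recurrence becomes S (N + sin \<theta>) = N, which determines
  S.\<close>

lemma has_sum_a: "((\<lambda>n. a n * cis (of_int n * \<theta>)) has_sum of_real (N / (N + sin \<theta>))) UNIV"
proof -
  define S where "S = (\<Sum>\<^sub>\<infinity>n. a n * cis (of_int n * \<theta>))"
  have "(\<lambda>n. a n * cis (of_int n * \<theta>)) summable_on UNIV"
    by (rule abs_summable_summable) (simp add: norm_mult summable_a)
  then have S: "((\<lambda>n. a n * cis (of_int n * \<theta>)) has_sum S) UNIV"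
    unfolding S_def by (rule has_sum_infsum)
  have shift: "((\<lambda>n. a (n - m) * cis (of_int n * \<theta>)) has_sum (S * cis (of_int m * \<theta>))) UNIV" for m :: int
  proof -
    have hs: "((\<lambda>n. a (n - m) * cis (of_int (n - m) * \<theta>)) has_sum S) UNIV"
      using has_sum_reindex_bij_betw[OF bij_diff_right, of "\<lambda>n. a n * cis (of_int n * \<theta>)" _ S] S by simp
    have e: "cis (of_int (n - m) * \<theta>) * cis (of_int m * \<theta>) = cis (of_int n * \<theta>)" for n
      by (simp add: cis_mult algebra_simps)
    from has_sum_cmult_left[OF hs, of "cis (of_int m * \<theta>)"] show ?thesis
      by (simp only: mult.assoc e)
  qed
  have "((\<lambda>n. of_real N * (a n * cis (of_int n * \<theta>)) + (a (n - 1) * cis (of_int n * \<theta>) +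
      - (a (n - (-1)) * cis (of_int n * \<theta>))) * (1 / (2 * \<i>))) has_sum
      (of_real N * S + (S * cis (of_int 1 * \<theta>) + - (S * cis (of_int (-1) * \<theta>))) * (1 / (2 * \<i>)))) UNIV"
    by (intro has_sum_add has_sum_cmult_right has_sum_cmult_left has_sum_uminusI S shift)
  moreover have "of_real N * (a n * cis (of_int n * \<theta>)) + (a (n - 1) * cis (of_int n * \<theta>) +
      - (a (n - (-1)) * cis (of_int n * \<theta>))) * (1 / (2 * \<i>)) = (if n = 0 then of_real N else 0)" for n
  proof -
    have eq: "of_real N * (a n * cis (of_int n * \<theta>)) + (a (n - 1) * cis (of_int n * \<theta>) +
      - (a (n - (-1)) * cis (of_int n * \<theta>))) * (1 / (2 * \<i>))
      = (of_real N * a n + (a (n - 1) - a (n + 1)) / (2 * \<i>)) * cis (of_int n * \<theta>)"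
      by (simp add: field_simps)
    have cases: "of_real N * a n + (a (n - 1) - a (n + 1)) / (2 * \<i>) = (if n = 0 then of_real N else 0)"
    proof (cases "n = 0")
      case True
      then have "n - 1 = - 1" "n + 1 = 1" by auto
      then show ?thesis
        unfolding if_P[OF True] using a_recurrence_0 True by (simp only:)
    next
      case False
      then show ?thesis
        unfolding if_not_P[OF False] by (rule a_recurrence)
    qed
    show ?thesis
      unfolding eq cases by (cases "n = 0") simp_all
  qed
  ultimately have "((\<lambda>n::int. if n = 0 then of_real N else 0) has_sum
      (of_real N * S + (S * cis (of_int 1 * \<theta>) + - (S * cis (of_int (-1) * \<theta>))) * (1 / (2 * \<i>)))) UNIV"
    by simp
  moreover have "((\<lambda>n::int. if n = 0 then of_real N else 0) has_sum complex_of_real N) UNIV"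
    by (rule has_sum_finite_neutralI[of "{0}"]) auto
  ultimately have "of_real N * S + (S * cis (of_int 1 * \<theta>) + - (S * cis (of_int (-1) * \<theta>))) * (1 / (2 * \<i>)) = of_real N"
    by (rule has_sum_unique)
  moreover have "of_real N * S + (S * cis (of_int 1 * \<theta>) + - (S * cis (of_int (-1) * \<theta>))) * (1 / (2 * \<i>))
      = S * of_real (N + sin \<theta>)"
  proof -
    have "cis \<theta> - cis (- \<theta>) = 2 * \<i> * of_real (sin \<theta>)"
      by (simp add: complex_eq_iff)
    then have "S * cis \<theta> + - (S * cis (- \<theta>)) = S * (2 * \<i> * of_real (sin \<theta>))"
      by (metis diff_conv_add_uminus right_diff_distrib)
    moreover have "S * (2 * \<i> * y) * (1 / (2 * \<i>)) = S * y" for y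
      by (simp add: complex_eq_iff algebra_simps)
    ultimately have "(S * cis \<theta> + - (S * cis (- \<theta>))) * (1 / (2 * \<i>)) = S * of_real (sin \<theta>)"
      by (simp only:)
    then show ?thesis
      by (simp add: algebra_simps)
  qed
  ultimately have "S * of_real (N + sin \<theta>) = of_real N"
    by simp
  moreover have "N + sin \<theta> \<noteq> 0"
    using sin_ge_minus_one[of \<theta>] N3 by linarith
  ultimately have "S = of_real (N / (N + sin \<theta>))"
    by (simp add: field_simps del: of_real_add)
  then show ?thesis
    using S by simp
qed

lemma has_sum_b: "((\<lambda>n. b n * cis (of_int n * \<theta>)) has_sum of_real ((N + sin \<theta>) / N)) UNIV"
proof (rule has_sum_finite_neutralI[of "{-1, 0, 1}"])
  have "b (- 1) * cis (- \<theta>) + (1 + b 1 * cis \<theta>) = of_real ((N + sin \<theta>) / N)"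
    using N3 by (simp add: b_def complex_eq_iff field_simps)
  then show "complex_of_real ((N + sin \<theta>) / N) = (\<Sum>n\<in>{-1, 0, 1}. b n * cis (of_int n * \<theta>))"
    by (simp add: b_def)
qed (auto simp: b_def)

text \<open>cos x2 lives on the frequencies (0, \<plusminus>1, n) and cos x1 on (\<plusminus>1, 0,
  n), each with coefficient 1/2.\<close>

definition data :: "int^3 \<Rightarrow> complex^3" where
  "data k = (\<chi> i. if i = 1 then (if k $ 1 = 0 \<and> \<bar>k $ 2\<bar> = 1 then a (k $ 3) / 2 else 0)
     else if i = 2 then (if \<bar>k $ 1\<bar> = 1 \<and> k $ 2 = 0 then b (k $ 3) / 2 else 0) else 0)"

lemma data_nth:
  "data k $ 1 = (if k $ 1 = 0 \<and> \<bar>k $ 2\<bar> = 1 then a (k $ 3) / 2 else 0)"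
  "data k $ 2 = (if \<bar>k $ 1\<bar> = 1 \<and> k $ 2 = 0 then b (k $ 3) / 2 else 0)"
  "data k $ 3 = 0"
  by (simp_all add: data_def)

lemma hermitian_data: "hermitian data"
  by (auto simp: hermitian_def data_def a_uminus b_uminus)

text \<open>Coefficients supported on a line of frequencies (p, q, n) reduce the sum over Z^3 to a
  one-dimensional series times a fixed mode in x1, x2.\<close>

lemma has_sum_mode_line:
  fixes f :: "int \<Rightarrow> complex" and p q :: int
  assumes "((\<lambda>n. f n * cis (of_int n * x $ 3)) has_sum S) UNIV"
  shows "((\<lambda>k. (if k $ 1 = p \<and> k $ 2 = q then f (k $ 3) else 0) * fourier_mode k x) has_sum
     (cis (of_int p * x $ 1 + of_int q * x $ 2) * S)) UNIV"
proof -
  define e :: "int \<Rightarrow> int^3" where "e n = vector [p, q, n]" for n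
  have e: "e n $ 1 = p" "e n $ 2 = q" "e n $ 3 = n" for n
    by (simp_all add: e_def)
  have inj: "inj e"
    by (rule injI) (metis e(3))
  have range: "k \<in> range e \<longleftrightarrow> k $ 1 = p \<and> k $ 2 = q" for k
  proof
    assume "k $ 1 = p \<and> k $ 2 = q"
    then have "k = e (k $ 3)"
      by (simp add: vec_eq_iff forall_3 e)
    then show "k \<in> range e" by blast
  qed (auto simp: e)
  have "((\<lambda>n. cis (of_int p * x $ 1 + of_int q * x $ 2) * (f n * cis (of_int n * x $ 3))) has_sum
      (cis (of_int p * x $ 1 + of_int q * x $ 2) * S)) UNIV"
    by (rule has_sum_cmult_right[OF assms])
  also have "(\<lambda>n. cis (of_int p * x $ 1 + of_int q * x $ 2) * (f n * cis (of_int n * x $ 3)))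
      = (\<lambda>k. f (k $ 3) * fourier_mode k x) \<circ> e"
    by (auto simp: fun_eq_iff fourier_mode_eq_cis sum_3 e cis_mult[symmetric])
  finally have "((\<lambda>k. f (k $ 3) * fourier_mode k x) has_sum
      (cis (of_int p * x $ 1 + of_int q * x $ 2) * S)) (range e)"
    by (rule has_sum_reindex[OF inj, THEN iffD2])
  then show ?thesis
    by (subst has_sum_cong_neutral[where T="range e" and g="\<lambda>k. f (k $ 3) * fourier_mode k x"])
      (auto simp: range simp del: rangeI)
qed

lemma data_fourier_sum:
  "(\<Sum>\<^sub>\<infinity>k. data k $ i * fourier_mode k x) = of_real (u_in N x $ i)"
proof -
  have cos: "cis (- y) * S / 2 + cis y * S / 2 = of_real (cos y) * S" for y S
    by (simp add: field_simps complex_eq_iff)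
  have h1: "((\<lambda>k. data k $ 1 * fourier_mode k x) has_sum of_real (u_in N x $ 1)) UNIV"
  proof -
    have ha: "((\<lambda>n. a n / 2 * cis (of_int n * x $ 3)) has_sum of_real (N / (N + sin (x $ 3))) / 2) UNIV"
      using has_sum_divide_const[OF has_sum_a, of "x $ 3" 2] by simp
    have "((\<lambda>k. (if k $ 1 = 0 \<and> k $ 2 = - 1 then a (k $ 3) / 2 else 0) * fourier_mode k x
        + (if k $ 1 = 0 \<and> k $ 2 = 1 then a (k $ 3) / 2 else 0) * fourier_mode k x) has_sum
        (cis (of_int 0 * x $ 1 + of_int (- 1) * x $ 2) * (of_real (N / (N + sin (x $ 3))) / 2)
        + cis (of_int 0 * x $ 1 + of_int 1 * x $ 2) * (of_real (N / (N + sin (x $ 3))) / 2))) UNIV"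
      by (intro has_sum_add has_sum_mode_line ha)
    moreover have "(if k $ 1 = 0 \<and> k $ 2 = - 1 then a (k $ 3) / 2 else 0) * fourier_mode k x
        + (if k $ 1 = 0 \<and> k $ 2 = 1 then a (k $ 3) / 2 else 0) * fourier_mode k x = data k $ 1 * fourier_mode k x" for k
      by (auto simp: data_nth)
    moreover have "cis (of_int 0 * x $ 1 + of_int (- 1) * x $ 2) * (of_real (N / (N + sin (x $ 3))) / 2)
        + cis (of_int 0 * x $ 1 + of_int 1 * x $ 2) * (of_real (N / (N + sin (x $ 3))) / 2) = of_real (u_in N x $ 1)"
      using cos[of "x $ 2" "of_real (N / (N + sin (x $ 3)))"] by (simp add: u_in_def)
    ultimately show ?thesis by simp
  qed
  have h2: "((\<lambda>k. data k $ 2 * fourier_mode k x) has_sum of_real (u_in N x $ 2)) UNIV"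
  proof -
    have hb: "((\<lambda>n. b n / 2 * cis (of_int n * x $ 3)) has_sum of_real ((N + sin (x $ 3)) / N) / 2) UNIV"
      using has_sum_divide_const[OF has_sum_b, of "x $ 3" 2] by simp
    have "((\<lambda>k. (if k $ 1 = - 1 \<and> k $ 2 = 0 then b (k $ 3) / 2 else 0) * fourier_mode k x
        + (if k $ 1 = 1 \<and> k $ 2 = 0 then b (k $ 3) / 2 else 0) * fourier_mode k x) has_sum
        (cis (of_int (- 1) * x $ 1 + of_int 0 * x $ 2) * (of_real ((N + sin (x $ 3)) / N) / 2)
        + cis (of_int 1 * x $ 1 + of_int 0 * x $ 2) * (of_real ((N + sin (x $ 3)) / N) / 2))) UNIV"
      by (intro has_sum_add has_sum_mode_line hb)
    moreover have "(if k $ 1 = - 1 \<and> k $ 2 = 0 then b (k $ 3) / 2 else 0) * fourier_mode k x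
        + (if k $ 1 = 1 \<and> k $ 2 = 0 then b (k $ 3) / 2 else 0) * fourier_mode k x = data k $ 2 * fourier_mode k x" for k
      by (auto simp: data_nth)
    moreover have "cis (of_int (- 1) * x $ 1 + of_int 0 * x $ 2) * (of_real ((N + sin (x $ 3)) / N) / 2)
        + cis (of_int 1 * x $ 1 + of_int 0 * x $ 2) * (of_real ((N + sin (x $ 3)) / N) / 2) = of_real (u_in N x $ 2)"
      using cos[of "x $ 1" "of_real ((N + sin (x $ 3)) / N)"] by (simp add: u_in_def)
    ultimately show ?thesis by simp
  qed
  have "i = 1 \<or> i = 2 \<or> i = 3"
    by (rule exhaust_3)
  then show ?thesis
    using infsumI[OF h1] infsumI[OF h2] by (auto simp: data_nth u_in_def)
qed

lemma real_field_data: "real_field data x = u_in N x"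
  by (simp add: real_field_def data_fourier_sum)

lemma norm_ab_le:
  "norm (a n) \<le> 2 * (1/2) ^ nat \<bar>n\<bar>" "norm (b n) \<le> 2 * (1/2) ^ nat \<bar>n\<bar>"
proof -
  have "c * r ^ nat \<bar>n\<bar> \<le> 2 * (1/2) ^ nat \<bar>n\<bar>"
    using c_le c_ge r0 r_third by (intro mult_mono power_mono) auto
  then show "norm (a n) \<le> 2 * (1/2) ^ nat \<bar>n\<bar>"
    by (simp add: norm_a)
  have "1 / (2 * N) \<le> 1"
    using N3 by simp
  then show "norm (b n) \<le> 2 * (1/2) ^ nat \<bar>n\<bar>"
    using N3 by (auto simp: b_def norm_divide)
qed

lemma norm_data_le:
  assumes P: "\<And>m::nat. (3 + (real m)\<^sup>2) ^ 5 * (real m + 1) * (1/2) ^ m \<le> P"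
  shows "norm (data k) \<le> P * wt k"
proof (cases "(k $ 1 = 0 \<and> \<bar>k $ 2\<bar> = 1) \<or> (\<bar>k $ 1\<bar> = 1 \<and> k $ 2 = 0)")
  case True
  define m where "m = nat \<bar>k $ 3\<bar>"
  have m: "(real_of_int (k $ 3))\<^sup>2 = (real m)\<^sup>2"
    by (simp add: m_def)
  note sq = power2_of_int_unit
  have q: "1 + freq_norm_sq k = 2 + (real m)\<^sup>2"
    using True by (auto simp: freq_norm_sq_3 m sq)
  have "norm (data k) \<le> (\<Sum>i\<in>UNIV. norm (data k $ i))"
    by (rule norm_vec_le_sum)
  also have "\<dots> \<le> (1/2) ^ m"
    using True norm_ab_le[of "k $ 3"] by (auto simp: sum_3 data_nth norm_divide m_def)
  also have "\<dots> \<le> P * wt k"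
  proof -
    have "(2 + (real m)\<^sup>2) ^ 4 * (1/2) ^ m \<le> (3 + (real m)\<^sup>2) ^ 5 * (real m + 1) * (1/2) ^ m"
    proof (intro mult_right_mono)
      have "(2 + (real m)\<^sup>2) ^ 4 \<le> (3 + (real m)\<^sup>2) ^ 4"
        by (intro power_mono) auto
      also have "\<dots> \<le> (3 + (real m)\<^sup>2) ^ 5"
        by (intro power_increasing) auto
      also have "\<dots> \<le> (3 + (real m)\<^sup>2) ^ 5 * (real m + 1)"
        by (simp add: algebra_simps)
      finally show "(2 + (real m)\<^sup>2) ^ 4 \<le> (3 + (real m)\<^sup>2) ^ 5 * (real m + 1)" .
    qed auto
    then have "(2 + (real m)\<^sup>2) ^ 4 * (1/2) ^ m \<le> P"
      using P[of m] by linarith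
    moreover have "0 < (2 + (real m)\<^sup>2) ^ 4"
      by (intro zero_less_power add_pos_nonneg) auto
    ultimately show ?thesis
      unfolding wt_def q by (simp add: field_simps)
  qed
  finally show ?thesis .
next
  case False
  then have "data k = 0"
    by (auto simp: data_def vec_eq_iff)
  moreover have "0 \<le> P"
    using P[of 0] by (rule order_trans[rotated]) simp
  ultimately show ?thesis by simp
qed

section \<open>The nonlinearity along the heat flow of the data\<close>

definition v :: "real \<Rightarrow> int^3 \<Rightarrow> complex^3" where
  "v t = heat t data"

lemma v_nth: "v t k $ i = of_real (exp (- (t * freq_norm_sq k))) * data k $ i"
  by (simp add: v_def heat_def) (simp add: scaleR_conv_of_real)

text \<open>The diagonal entries of \<open>v \<otimes> v\<close> depend on \<open>x\<^sub>2, x\<^sub>3\<close> or on \<open>x\<^sub>1, x\<^sub>3\<close> only and are killed by the divergence,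
  so the nonlinearity is determined by the entry \<open>G\<close>.\<close>

definition G :: "real \<Rightarrow> int^3 \<Rightarrow> complex" where
  "G s k = conv (v s) (v s) k $ 1 $ 2"

lemma conv_21: "conv (v s) (v s) k $ 2 $ 1 = G s k"
proof -
  have "(\<Sum>\<^sub>\<infinity>l. v s l $ 2 * v s (k - l) $ 1) = (\<Sum>\<^sub>\<infinity>l. v s (k - l) $ 2 * v s (k - (k - l)) $ 1)"
    by (rule infsum_reindex_bij_betw[OF bij_diff_left, symmetric])
  then show ?thesis
    by (simp add: G_def conv_def mult.commute)
qed

lemma conv_diag: "k $ 1 \<noteq> 0 \<Longrightarrow> conv (v s) (v s) k $ 1 $ 1 = 0"
  "k $ 2 \<noteq> 0 \<Longrightarrow> conv (v s) (v s) k $ 2 $ 2 = 0"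
  unfolding conv_def vec_lambda_beta
  by (rule infsum_0; auto simp: v_nth data_nth)+

lemma conv_3: "conv (v s) (v s) k $ 3 $ j = 0" "conv (v s) (v s) k $ i $ 3 = 0"
  unfolding conv_def vec_lambda_beta
  by (rule infsum_0; simp add: v_nth data_nth)+

lemma G_zero: "\<not> (\<bar>k $ 1\<bar> = 1 \<and> \<bar>k $ 2\<bar> = 1) \<Longrightarrow> G s k = 0"
  unfolding G_def conv_def vec_lambda_beta
  by (rule infsum_0) (auto simp: v_nth data_nth)

lemma div_conv:
  "div_tensor (conv (v s) (v s)) k $ 1 = \<i> * of_int (k $ 2) * G s k"
  "div_tensor (conv (v s) (v s)) k $ 2 = \<i> * of_int (k $ 1) * G s k"
  "div_tensor (conv (v s) (v s)) k $ 3 = 0"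
  using conv_diag[of k s]
  by (cases "k $ 1 = 0"; cases "k $ 2 = 0"; simp add: div_tensor_def sum_3 conv_21 conv_3 G_def[symmetric])+

lemma adv_nth:
  "adv (v s) (v s) k $ i = div_tensor (conv (v s) (v s)) k $ i
     - of_int (k $ i) * (2 * \<i> * of_int (k $ 1) * of_int (k $ 2) * G s k) / of_real (freq_norm_sq k)"
proof -
  have "(\<Sum>j\<in>UNIV. of_int (k $ j) * div_tensor (conv (v s) (v s)) k $ j)
      = 2 * \<i> * of_int (k $ 1) * of_int (k $ 2) * G s k"
    by (simp add: sum_3 div_conv)
  then show ?thesis
    by (simp add: adv_def leray_def)
qed

text \<open>In the convolution l must lie on a line carrying \<open>a\<close> and k - l in the
  support of \<open>b\<close>. This leaves l = (0, k2, n - m) with m in {-1, 0, 1}.\<close>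

lemma G_eq:
  assumes k: "\<bar>k $ 1\<bar> = 1" "\<bar>k $ 2\<bar> = 1"
  defines "n \<equiv> k $ 3"
  shows "G s k = of_real (exp (- (2 * s)) / 4) * (of_real (exp (- (s * (of_int n)\<^sup>2))) * a n +
    (- \<i> / of_real (2 * N)) * of_real (exp (- s)) *
      (of_real (exp (- (s * (of_int n - 1)\<^sup>2))) * a (n - 1) - of_real (exp (- (s * (of_int n + 1)\<^sup>2))) * a (n + 1)))"
proof -
  note sq = power2_of_int_unit
  define e :: "int \<Rightarrow> int^3" where "e m = vector [0, k $ 2, n - m]" for m
  have e: "e m $ 1 = 0" "e m $ 2 = k $ 2" "e m $ 3 = n - m" for m
    by (simp_all add: e_def)
  have inj: "inj_on e {-1, 0, 1}"
    by (rule inj_onI) (metis e(3) diff_left_imp_eq)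
  have "G s k = (\<Sum>\<^sub>\<infinity>l\<in>e ` {-1, 0, 1}. v s l $ 1 * v s (k - l) $ 2)"
    unfolding G_def conv_def vec_lambda_beta
  proof (rule infsum_cong_neutral)
    fix l assume "l \<in> UNIV - e ` {-1, 0, 1}"
    then have l: "l \<notin> e ` {-1, 0, 1}" by simp
    show "v s l $ 1 * v s (k - l) $ 2 = 0"
    proof (rule ccontr)
      assume "v s l $ 1 * v s (k - l) $ 2 \<noteq> 0"
      then have nz: "l $ 1 = 0" "k $ 2 - l $ 2 = 0" "b (k $ 3 - l $ 3) \<noteq> 0"
        by (auto simp: v_nth data_nth split: if_splits)
      then have "k $ 3 - l $ 3 \<in> {-1, 0, 1}"
        by (auto simp: b_def split: if_splits)
      moreover have "l = e (k $ 3 - l $ 3)"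
        using nz by (simp add: vec_eq_iff forall_3 e n_def)
      ultimately show False
        using l by blast
    qed
  qed auto
  also have "\<dots> = (\<Sum>m\<in>{-1, 0, 1}. v s (e m) $ 1 * v s (k - e m) $ 2)"
  proof -
    have "(\<Sum>\<^sub>\<infinity>l\<in>e ` {-1, 0, 1}. v s l $ 1 * v s (k - l) $ 2) = (\<Sum>l\<in>e ` {-1, 0, 1}. v s l $ 1 * v s (k - l) $ 2)"
      by (rule infsum_finite) simp
    then show ?thesis
      unfolding sum.reindex[OF inj] o_def .
  qed
  also have "\<dots> = (\<Sum>m\<in>{-1, 0, 1}. of_real (exp (- (s * (1 + (of_int (n - m))\<^sup>2)))) * (a (n - m) / 2)
      * (of_real (exp (- (s * (1 + (of_int m)\<^sup>2)))) * (b m / 2)))"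
    by (rule sum.cong) (auto simp: v_nth data_nth e k freq_norm_sq_3 sq n_def)
  also have "\<dots> = of_real (exp (- (s * (1 + (of_int (n - (-1)))\<^sup>2)))) * (a (n - (-1)) / 2)
      * (of_real (exp (- (s * (1 + 1)))) * (\<i> / of_real (2 * N) / 2))
    + of_real (exp (- (s * (1 + (of_int n)\<^sup>2)))) * (a n / 2) * (of_real (exp (- (s * 1))) * (1 / 2))
    + of_real (exp (- (s * (1 + (of_int (n - 1))\<^sup>2)))) * (a (n - 1) / 2)
      * (of_real (exp (- (s * (1 + 1)))) * (- \<i> / of_real (2 * N) / 2))"
    by (simp add: b_def)
  also have "\<dots> = of_real (exp (- (2 * s)) / 4) * (of_real (exp (- (s * (of_int n)\<^sup>2))) * a n +
    (- \<i> / of_real (2 * N)) * of_real (exp (- s)) *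
      (of_real (exp (- (s * (of_int n - 1)\<^sup>2))) * a (n - 1) - of_real (exp (- (s * (of_int n + 1)\<^sup>2))) * a (n + 1)))"
  proof -
    have ex: "exp (- (s * (1 + y))) = exp (- s) * exp (- (s * y))" for y
      by (simp add: algebra_simps flip: exp_add)
    have e2: "exp (- (2 * s)) = exp (- s) * exp (- s)"
      by (simp flip: exp_add)
    define w where "w = \<i> / complex_of_real (2 * N)"
    have w: "- \<i> / complex_of_real (2 * N) = - w"
      by (simp add: w_def)
    show ?thesis
      unfolding ex e2 w w_def[symmetric] of_real_mult of_real_divide by (simp add: algebra_simps)
  qed
  finally show ?thesis .
qed

text \<open>The recurrence for \<open>a\<close>, that is \<open>a b = 1\<close> in physical space, turns \<open>G\<close> into a sum of
  differences of exponentials that vanish at \<open>s = 0\<close>.\<close>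

lemma G_eq':
  assumes k: "\<bar>k $ 1\<bar> = 1" "\<bar>k $ 2\<bar> = 1" and nz: "k $ 3 \<noteq> 0"
  defines "n \<equiv> k $ 3"
  shows "G s k = of_real (exp (- (2 * s)) / 4) * (\<i> / of_real (2 * N)) *
    (of_real (exp (- (s * (of_int n)\<^sup>2)) - exp (- (s * (1 + (of_int n - 1)\<^sup>2)))) * a (n - 1)
     - of_real (exp (- (s * (of_int n)\<^sup>2)) - exp (- (s * (1 + (of_int n + 1)\<^sup>2)))) * a (n + 1))"
proof -
  have ex: "exp (- (s * (1 + y))) = exp (- s) * exp (- (s * y))" for y
    by (simp add: algebra_simps flip: exp_add)
  have an: "a n = \<i> / of_real (2 * N) * (a (n - 1) - a (n + 1))"
  proof -
    have gen: "y = \<i> / 2 * x" if "y + x / (2 * \<i>) = 0" for x y :: complex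
    proof -
      have "x / (2 * \<i>) = - (\<i> / 2 * x)"
        by (simp add: field_simps)
      then show ?thesis
        using that by simp
    qed
    have "of_real N * a n = \<i> / 2 * (a (n - 1) - a (n + 1))"
      by (rule gen[OF a_recurrence]) (use nz in \<open>simp add: n_def\<close>)
    then show ?thesis
      using N3 by (simp add: field_simps)
  qed
  show ?thesis
    unfolding G_eq[OF k] ex n_def[symmetric] an by (simp add: algebra_simps)
qed

text \<open>The differences n^2 - (1 + (n - 1)^2) = 2 n - 2 and n^2 - (1 + (n + 1)^2) = - (2 n + 2)
  of the exponents give the factors in \<open>A\<close>. For m = 1 the coefficient 2 m - 2 removes
  r^0, so a factor r \<le> 1 / N survives in every case; with the 1 / (2 N) in front it produces
  N^{-2}.\<close>

lemma norm_G_le: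
  assumes k: "\<bar>k $ 1\<bar> = 1" "\<bar>k $ 2\<bar> = 1" and nz: "k $ 3 \<noteq> 0" and s: "0 \<le> s"
  defines "m \<equiv> nat \<bar>k $ 3\<bar>"
  shows "norm (G s k) \<le> 5 / 2 * (real m + 1) * (1/2) ^ m * s / N\<^sup>2"
proof -
  define n where "n = k $ 3"
  define A where "A = (2 * real m - 2) * r ^ (m - 1) + (2 * real m + 2) * r ^ (m + 1)"
  have m1: "1 \<le> m" using nz by (simp add: m_def)
  have d: "\<bar>exp (- (s * x)) - exp (- (s * y))\<bar> \<le> s * \<bar>x - y\<bar>" if "0 \<le> x" "0 \<le> y" for x y
    using abs_exp_neg_diff_le[of "s * x" "s * y"] that s by (simp add: abs_mult right_diff_distrib[symmetric])
  have t1: "norm (of_real (exp (- (s * (of_int n)\<^sup>2)) - exp (- (s * (1 + (of_int n - 1)\<^sup>2)))) * a (n - 1))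
      \<le> s * \<bar>2 * of_int n - 2\<bar> * (c * r ^ nat \<bar>n - 1\<bar>)"
  proof -
    have "\<bar>exp (- (s * (of_int n)\<^sup>2)) - exp (- (s * (1 + (of_int n - 1)\<^sup>2)))\<bar> \<le> s * \<bar>2 * of_int n - 2\<bar>"
    proof -
      have "(of_int n)\<^sup>2 - (1 + (of_int n - 1)\<^sup>2) = 2 * of_int n - (2 :: real)"
        by (simp add: power2_eq_square algebra_simps)
      moreover have "(0 :: real) \<le> 1 + (of_int n - 1)\<^sup>2"
        by (intro add_nonneg_nonneg) auto
      ultimately show ?thesis
        using d[of "(of_int n)\<^sup>2" "1 + (of_int n - 1)\<^sup>2"] by (simp only: zero_le_power2)
    qed
    then show ?thesis
      unfolding norm_mult norm_a norm_of_real using c_ge r0 by (intro mult_right_mono) auto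
  qed
  have t2: "norm (of_real (exp (- (s * (of_int n)\<^sup>2)) - exp (- (s * (1 + (of_int n + 1)\<^sup>2)))) * a (n + 1))
      \<le> s * \<bar>2 * of_int n + 2\<bar> * (c * r ^ nat \<bar>n + 1\<bar>)"
  proof -
    have "\<bar>exp (- (s * (of_int n)\<^sup>2)) - exp (- (s * (1 + (of_int n + 1)\<^sup>2)))\<bar> \<le> s * \<bar>- (2 * of_int n + 2)\<bar>"
    proof -
      have "(of_int n)\<^sup>2 - (1 + (of_int n + 1)\<^sup>2) = - (2 * of_int n + (2 :: real))"
        by (simp add: power2_eq_square algebra_simps)
      moreover have "(0 :: real) \<le> 1 + (of_int n + 1)\<^sup>2"
        by (intro add_nonneg_nonneg) auto
      ultimately show ?thesis
        using d[of "(of_int n)\<^sup>2" "1 + (of_int n + 1)\<^sup>2"] by (simp only: zero_le_power2)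
    qed
    then show ?thesis
      unfolding norm_mult norm_a norm_of_real abs_minus_cancel using c_ge r0 by (intro mult_right_mono) auto
  qed
  have sumA: "s * \<bar>2 * of_int n - 2\<bar> * (c * r ^ nat \<bar>n - 1\<bar>) + s * \<bar>2 * of_int n + 2\<bar> * (c * r ^ nat \<bar>n + 1\<bar>) = s * c * A"
  proof (cases "0 < n")
    case True
    then have "n = int m" "nat \<bar>n - 1\<bar> = m - 1" "nat \<bar>n + 1\<bar> = m + 1"
      by (auto simp: m_def n_def)
    then show ?thesis
      using m1 by (simp add: A_def algebra_simps)
  next
    case False
    then have n: "n = - int m" "nat \<bar>n - 1\<bar> = m + 1" "nat \<bar>n + 1\<bar> = m - 1"
      using nz by (auto simp: m_def n_def)
    have "\<bar>2 * real_of_int n - 2\<bar> = 2 * real m + 2" "\<bar>2 * real_of_int n + 2\<bar> = 2 * real m - 2"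
      using n(1) m1 by auto
    then show ?thesis
      unfolding n(2,3) by (simp only:) (simp add: A_def algebra_simps)
  qed
  \<comment> \<open>One factor \<open>r\<close> is kept for the second 1 / N; all other powers of
    \<open>r\<close> are replaced by powers of 1/2, and 8 = 2 * 4 absorbs the shift from m - 2 to
    m.\<close>
  have A_le: "A \<le> 10 * (real m + 1) * r * (1/2) ^ m"
  proof -
    have "(2 * real m - 2) * r ^ (m - 1) \<le> 8 * (real m + 1) * r * (1/2) ^ m"
    proof (cases "m = 1")
      case True
      then show ?thesis using r0 by simp
    next
      case False
      define j where "j = m - 2"
      have j: "m = Suc (Suc j)"
        using m1 False by (simp add: j_def)
      have "r ^ j \<le> (1/2) ^ j"
        using r0 r_third by (intro power_mono) auto
      then have "(2 * real m - 2) * (r * r ^ j) \<le> (2 * real m + 2) * (r * (1/2) ^ j)"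
        using r0 m1 by (intro mult_mono) auto
      then show ?thesis
        using j by (simp add: algebra_simps)
    qed
    moreover have "(2 * real m + 2) * r ^ (m + 1) \<le> 2 * (real m + 1) * r * (1/2) ^ m"
    proof -
      have "r ^ m \<le> (1/2) ^ m"
        using r0 r_third by (intro power_mono) auto
      then have "(2 * real m + 2) * (r * r ^ m) \<le> (2 * real m + 2) * (r * (1/2) ^ m)"
        using r0 by (intro mult_left_mono) auto
      then show ?thesis by (simp add: algebra_simps)
    qed
    ultimately show ?thesis
      unfolding A_def by (simp add: algebra_simps)
  qed
  have "norm (G s k) = exp (- (2 * s)) / 4 * (1 / (2 * N)) *
    norm (of_real (exp (- (s * (of_int n)\<^sup>2)) - exp (- (s * (1 + (of_int n - 1)\<^sup>2)))) * a (n - 1)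
     - of_real (exp (- (s * (of_int n)\<^sup>2)) - exp (- (s * (1 + (of_int n + 1)\<^sup>2)))) * a (n + 1))"
    unfolding G_eq'[OF k nz] n_def[symmetric] norm_mult using N3 by (simp add: norm_divide norm_mult)
  also have "\<dots> \<le> 1 / 4 * (1 / (2 * N)) * (s * c * A)"
    using s N3 by (intro mult_mono order_trans[OF norm_triangle_ineq4 add_mono[OF t1 t2, unfolded sumA]]) auto
  also have "\<dots> \<le> 1 / 4 * (1 / (2 * N)) * (s * 2 * (10 * (real m + 1) * (1 / N) * (1/2) ^ m))"
  proof -
    have A0: "0 \<le> A"
      using m1 r0 by (simp add: A_def)
    have "A \<le> 10 * (real m + 1) * (1 / N) * (1/2) ^ m"
      by (rule order_trans[OF A_le]) (intro mult_right_mono mult_left_mono r_le; simp)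
    then show ?thesis
      using s N3 c_le c_ge A0 by (intro mult_left_mono mult_mono) auto
  qed
  also have "\<dots> = 5 / 2 * (real m + 1) * (1/2) ^ m * s / N\<^sup>2"
    using N3 by (simp add: power2_eq_square field_simps)
  finally show ?thesis .
qed

text \<open>For k3 = 0 and |k1| = |k2| = 1 the divergence i G (k2, k1, 0) is parallel to k, because
  k1 k2 = \<plusminus>1, so the Leray projection kills it; these are the frequencies at which
  \<open>G\<close> does not vanish at s = 0. For k3 \<noteq> 0, 20 = 4 * 2 * 5/2 combines the
  projection, the two equal off-diagonal entries and \<open>norm_G_le\<close>.\<close>

lemma forcing_le:
  assumes P: "\<And>m::nat. (3 + (real m)\<^sup>2) ^ 5 * (real m + 1) * (1/2) ^ m \<le> P" and s: "0 \<le> s"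
  shows "norm (adv (v s) (v s) k) \<le> 20 * P / N\<^sup>2 * wt k * s"
proof (cases "\<bar>k $ 1\<bar> = 1 \<and> \<bar>k $ 2\<bar> = 1 \<and> k $ 3 \<noteq> 0")
  case True
  then have k: "\<bar>k $ 1\<bar> = 1" "\<bar>k $ 2\<bar> = 1" "k $ 3 \<noteq> 0" by auto
  define m where "m = nat \<bar>k $ 3\<bar>"
  note sq = power2_of_int_unit
  have q: "freq_norm_sq k = 2 + (real m)\<^sup>2"
    using k by (simp add: freq_norm_sq_3 sq m_def)
  define z where "z = 3 + (real m)\<^sup>2"
  have z0: "0 < z" by (simp add: z_def add_pos_nonneg)
  have "norm (adv (v s) (v s) k) \<le> 4 * sqrt (freq_norm_sq k) * (2 * norm (G s k))"
  proof -
    have "k $ 1 \<noteq> 0" "k $ 2 \<noteq> 0" using k by auto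
    then have "(\<Sum>i\<in>UNIV. \<Sum>j\<in>UNIV. cmod (conv (v s) (v s) k $ i $ j)) = 2 * norm (G s k)"
      by (simp add: sum_3 conv_diag conv_3 conv_21 G_def[symmetric])
    then show ?thesis
      unfolding adv_def using norm_leray_div_le[of "conv (v s) (v s)" k] by simp
  qed
  also have "\<dots> \<le> 4 * z * (2 * (5 / 2 * (real m + 1) * (1/2) ^ m * s / N\<^sup>2))"
  proof (intro mult_mono mult_left_mono norm_G_le[OF k s, folded m_def])
    show "sqrt (freq_norm_sq k) \<le> z"
      using sqrt_le_1_plus[of "freq_norm_sq k"] by (simp add: q z_def)
  qed (use z0 in auto)
  also have "\<dots> = 20 * (z ^ 5 * (real m + 1) * (1/2) ^ m) * (1 / z ^ 4) * s / N\<^sup>2"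
    using z0 by (simp add: eval_nat_numeral)
  also have "\<dots> \<le> 20 * P * (1 / z ^ 4) * s / N\<^sup>2"
    using P[of m] z0 s by (intro divide_right_mono mult_right_mono mult_left_mono) (auto simp: z_def)
  also have "\<dots> = 20 * P / N\<^sup>2 * wt k * s"
    by (simp add: wt_def q z_def)
  finally show ?thesis .
next
  case False
  have "adv (v s) (v s) k = 0"
  proof (cases "\<bar>k $ 1\<bar> = 1 \<and> \<bar>k $ 2\<bar> = 1")
    case True
    then have k3: "k $ 3 = 0" using False by simp
    note sq = power2_of_int_unit
    have sqc: "complex_of_int j * complex_of_int j = 1" if "\<bar>j\<bar> = 1" for j :: int
      using that by (cases "j \<ge> 0") (auto simp: abs_if split: if_splits)
    have q: "freq_norm_sq k = 2"
      using True k3 by (simp add: freq_norm_sq_3 sq)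
    have "adv (v s) (v s) k $ 1 = \<i> * of_int (k $ 2) * G s k * (1 - of_int (k $ 1) * of_int (k $ 1))"
      "adv (v s) (v s) k $ 2 = \<i> * of_int (k $ 1) * G s k * (1 - of_int (k $ 2) * of_int (k $ 2))"
      by (simp_all add: adv_nth div_conv q algebra_simps)
    then show ?thesis
      using True sqc k3 by (simp add: vec_eq_iff forall_3 adv_nth[of s k 3] div_conv)
  next
    case False
    then show ?thesis
      using exhaust_3 by (auto simp: vec_eq_iff forall_3 adv_nth div_conv G_zero)
  qed
  moreover have "0 \<le> P"
    using P[of 0] by (rule order_trans[rotated]) simp
  ultimately show ?thesis
    using s by simp
qed

end

text \<open>Lets a single frequency bound the supremum norm from below.\<close>

lemma norm_fourier_coeff_le_Linf_norm:
  assumes [measurable]: "f \<in> borel_measurable torus"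
  shows "ereal (norm (fourier_coeff f k)) \<le> Linf_norm torus f"
proof (cases "Linf_norm torus f")
  case (real M)
  have "AE x in torus. ereal (norm (f x)) \<le> Linf_norm torus f"
    unfolding Linf_norm_def by (rule esssup_AE)
  then have "AE x in torus. \<bar>f x\<bar> \<le> M"
    unfolding real by eventually_elim simp
  then show ?thesis
    unfolding real by (simp add: fourier_coeff_bound)
next
  \<comment> \<open>With this value the function would be bounded by -1 in absolute value almost
    everywhere, and so would its coefficient, which is absurd.\<close>
  case MInf
  have "AE x in torus. ereal (norm (f x)) \<le> Linf_norm torus f"
    unfolding Linf_norm_def by (rule esssup_AE)
  then have "AE x in torus. \<bar>f x\<bar> \<le> - 1"
    unfolding MInf by eventually_elim simp
  then have "norm (fourier_coeff f k) \<le> - 1"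
    by (rule fourier_coeff_bound[rotated]) simp
  then show ?thesis
    using norm_ge_zero[of "fourier_coeff f k"] by linarith
qed simp

section \<open>Lower bound for the forcing at one frequency\<close>

context swirl
begin

text \<open>For small \<open>t\<close> the third component is \<open>t\<^sup>2 / N\<^sup>2\<close> times a multiple of \<open>sin x\<^sub>1 sin x\<^sub>2 sin (2 x\<^sub>3)\<close> to leading
  order; \<open>k0\<close> is a frequency of this function.\<close>

definition k0 :: "int^3" where "k0 = vector [1, 1, 2]"

lemma k0_nth: "k0 $ 1 = 1" "k0 $ 2 = 1" "k0 $ 3 = 2"
  by (simp_all add: k0_def)

lemma freq_norm_sq_k0: "freq_norm_sq k0 = 6"
  by (simp add: freq_norm_sq_3 k0_nth)

text \<open>The value of \<open>G\<close> at \<open>k0\<close>: it is real because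
  \<open>a 1\<close> and \<open>a 3\<close> are purely imaginary, like the factor i / (2 N) in
  front.\<close>

definition g :: "real \<Rightarrow> real" where
  "g s = c / (8 * N) * exp (- (2 * s)) * (r * (exp (- (2 * s)) - exp (- (4 * s))) - r ^ 3 * (exp (- (4 * s)) - exp (- (10 * s))))"

lemma G_k0: "G s k0 = of_real (g s)"
proof -
  have a1: "a 1 = of_real c * (\<i> * of_real r)"
    by (simp add: a_def)
  have a3: "a 3 = of_real c * (- \<i> * of_real (r ^ 3))"
  proof -
    have "(\<i> * complex_of_real r) ^ 3 = - \<i> * of_real (r ^ 3)"
      by (simp add: power3_eq_cube complex_eq_iff)
    then show ?thesis
      by (simp add: a_def)
  qed
  have e: "exp (- (s * (1 + 1))) = exp (- (2 * s))" "exp (- (s * 4)) = exp (- (4 * s))" "exp (- (s * (1 + 9))) = exp (- (10 * s))"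
    by (simp_all add: mult.commute)
  have "G s k0 = of_real (exp (- (2 * s)) / 4) * (\<i> / of_real (2 * N)) *
    (of_real (exp (- (4 * s)) - exp (- (2 * s))) * a 1 - of_real (exp (- (4 * s)) - exp (- (10 * s))) * a 3)"
    using G_eq'[of k0 s] by (simp add: k0_nth mult.commute)
  also have "\<dots> = of_real (g s)"
    unfolding a1 a3 g_def by (simp add: complex_eq_iff field_simps)
  finally show ?thesis .
qed

text \<open>To first order in s the bracket is r (2 s) - r^3 (6 s), and r \<le> 1/3 makes the
  subtracted part at most half of the first. The factor exp (-6) bounds the remaining exponentials
  for s \<le> 1, and 16 = 8 * 2 uses r \<ge> 1 / (2 N).\<close>

lemma g_ge:
  assumes s: "0 \<le> s" "s \<le> 1"
  shows "exp (- 6) / (16 * N\<^sup>2) * s \<le> g s"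
proof -
  have e1: "2 * s * exp (- (4 * s)) \<le> exp (- (2 * s)) - exp (- (4 * s))"
  proof -
    have "exp (- (4 * s)) * (1 + 2 * s) \<le> exp (- (4 * s)) * exp (2 * s)"
      using exp_ge_add_one_self[of "2 * s"] by (intro mult_left_mono) auto
    also have "\<dots> = exp (- (2 * s))"
      by (simp flip: exp_add)
    finally show ?thesis by (simp add: algebra_simps)
  qed
  have e2: "exp (- (4 * s)) - exp (- (10 * s)) \<le> 6 * s * exp (- (4 * s))"
  proof -
    have "exp (- (4 * s)) * (1 + - (6 * s)) \<le> exp (- (4 * s)) * exp (- (6 * s))"
      using exp_ge_add_one_self[of "- (6 * s)"] by (intro mult_left_mono) auto
    also have "\<dots> = exp (- (10 * s))"
      by (simp flip: exp_add)
    finally show ?thesis by (simp add: algebra_simps)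
  qed
  have r2: "6 * r\<^sup>2 \<le> 1"
  proof -
    have "r\<^sup>2 \<le> (1/3)\<^sup>2"
      using r0 r_third by (intro power_mono) auto
    then show ?thesis by (simp add: power2_eq_square)
  qed
  have "r * (s * exp (- (4 * s))) * 1 \<le> r * (s * exp (- (4 * s))) * (2 - 6 * r\<^sup>2)"
    using r0 s r2 by (intro mult_left_mono) auto
  also have "\<dots> = r * (2 * s * exp (- (4 * s))) - r ^ 3 * (6 * s * exp (- (4 * s)))"
    by (simp add: algebra_simps power2_eq_square power3_eq_cube)
  also have "\<dots> \<le> r * (exp (- (2 * s)) - exp (- (4 * s))) - r ^ 3 * (exp (- (4 * s)) - exp (- (10 * s)))"
    using r0 e1 e2 by (intro diff_mono mult_left_mono) auto
  finally have br: "r * (s * exp (- (4 * s))) \<le> r * (exp (- (2 * s)) - exp (- (4 * s))) - r ^ 3 * (exp (- (4 * s)) - exp (- (10 * s)))"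
    by simp
  have "exp (- 6) / (16 * N\<^sup>2) * s \<le> exp (- (6 * s)) / (16 * N\<^sup>2) * s"
    using s by (intro mult_right_mono divide_right_mono) auto
  also have "\<dots> = 1 / (8 * N) * exp (- (2 * s)) * (1 / (2 * N) * (s * exp (- (4 * s))))"
    by (simp add: power2_eq_square flip: exp_add)
  also have "\<dots> \<le> c / (8 * N) * exp (- (2 * s)) * (r * (s * exp (- (4 * s))))"
    using N3 c_ge r_ge r0 s by (intro mult_mono divide_right_mono) auto
  also have "\<dots> \<le> g s"
    unfolding g_def using N3 c_ge by (intro mult_left_mono br) auto
  finally show ?thesis .
qed

lemma adv_k0: "adv (v s) (v s) k0 $ 3 = - \<i> * of_real (2 / 3 * g s)"
  unfolding adv_nth div_conv freq_norm_sq_k0 G_k0 by (simp add: k0_nth)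

text \<open>The third component of the forcing at \<open>k0\<close> is -i times a nonnegative
  function, so there is no cancellation in time. Heat decay at |k0|^2 = 6 over a time at most 1
  gives one factor exp (-6) and \<open>g_ge\<close> the other; 1/24 is (2/3) / 16, and integrating s
  halves it to 1/48.\<close>

lemma duhamel_lower_bound:
  assumes cont: "continuous_on {0..t} (\<lambda>s. adv (v s) (v s) k0)" and t: "0 \<le> t" "t \<le> 1"
  shows "exp (- 12) / (48 * N\<^sup>2) * t\<^sup>2 \<le> norm (duhamel (\<lambda>s. adv (v s) (v s)) t k0 $ 3)"
proof -
  define h where "h s = exp (- (6 * (t - s))) * (2 / 3 * g s)" for s
  define \<kappa> where "\<kappa> = exp (- 12) / (24 * N\<^sup>2)"
  have F: "heat (t - s) (adv (v s) (v s)) k0 $ 3 = - \<i> * of_real (h s)" for s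
    unfolding heat_def vector_scaleR_component adv_k0 freq_norm_sq_k0 h_def
    by (simp add: scaleR_conv_of_real mult.commute)
  have hc: "continuous_on {0..t} h"
    unfolding h_def g_def by (intro continuous_intros)
  have "duhamel (\<lambda>s. adv (v s) (v s)) t k0 $ 3 = integral {0..t} (\<lambda>s. - \<i> * of_real (h s))"
    unfolding duhamel_nth[where F="\<lambda>s. adv (v s) (v s)" and k=k0, OF cont] F ..
  also have "\<dots> = - \<i> * of_real (integral {0..t} h)"
  proof -
    have "bounded_linear (\<lambda>y::real. - \<i> * complex_of_real y)"
      by (intro bounded_linear_const_mult bounded_linear_of_real)
    from integral_linear[OF integrable_continuous_interval[OF hc] this] show ?thesis
      by (simp add: o_def)
  qed
  finally have D: "norm (duhamel (\<lambda>s. adv (v s) (v s)) t k0 $ 3) = \<bar>integral {0..t} h\<bar>"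
    by (simp add: norm_mult)
  note I = has_integral_linear_upto[OF t(1), of \<kappa>]
  have "\<kappa> * (t\<^sup>2 / 2) \<le> integral {0..t} h"
  proof -
    have "integral {0..t} (\<lambda>s. \<kappa> * s) \<le> integral {0..t} h"
    proof (rule integral_le)
      show "(\<lambda>s. \<kappa> * s) integrable_on {0..t}"
        using I by blast
      show "h integrable_on {0..t}"
        by (rule integrable_continuous_interval[OF hc])
      fix s assume "s \<in> {0..t}"
      then have s: "0 \<le> s" "s \<le> 1" "s \<le> t" using t by auto
      have "exp (- 6) * (2 / 3 * (exp (- 6) / (16 * N\<^sup>2) * s)) \<le> h s"
        unfolding h_def using s t g_ge[OF s(1,2)] by (intro mult_mono) (auto intro!: mult_nonneg_nonneg)
      moreover have "exp (- 6) * (2 / 3 * (exp (- 6) / (16 * N\<^sup>2) * s)) = \<kappa> * s"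
        by (simp add: \<kappa>_def field_simps flip: exp_add)
      ultimately show "\<kappa> * s \<le> h s" by simp
    qed
    then show ?thesis
      unfolding integral_unique[OF I] by simp
  qed
  then show ?thesis
    unfolding D \<kappa>_def by simp
qed

end

section \<open>The solution for large N and the final theorem\<close>

lemma swirl_exists:
  assumes "3 \<le> N"
  shows "\<exists>r c. swirl N r c"
proof -
  \<comment> \<open>\<open>N - d\<close> is the smaller root of r^2 - 2 N r + 1 = 0; the roots
    multiply to 1, so it equals 1 / (N + d), which lies between 1 / (2 N) and 1 / N. With c = N / d
    the normalisation at frequency 0 holds.\<close>
  define d where "d = sqrt (N\<^sup>2 - 1)"
  have N2: "9 \<le> N\<^sup>2"
    using power_mono[OF assms, of 2] by simp
  have d2: "d\<^sup>2 = N\<^sup>2 - 1"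
    using N2 by (simp add: d_def)
  have d0: "0 < d"
    using N2 by (simp add: d_def)
  have dN: "d < N"
    by (rule power2_less_imp_less) (use d2 assms in auto)
  have dh: "N / 2 \<le> d"
  proof (rule power2_le_imp_le)
    show "(N / 2)\<^sup>2 \<le> d\<^sup>2"
      unfolding d2 power_divide using N2 by simp
  qed (use d0 in auto)
  have prod: "(N - d) * (N + d) = 1"
    using d2 by (simp add: algebra_simps power2_eq_square)
  have r: "N - d = 1 / (N + d)"
    using prod d0 assms by (simp add: field_simps)
  have "swirl N (N - d) (N / d)"
  proof
    show "(N - d)\<^sup>2 + 1 = 2 * N * (N - d)"
      using d2 by (simp add: power2_eq_square algebra_simps)
    show "1 / (2 * N) \<le> N - d"
      unfolding r using d0 dN assms by (intro divide_left_mono) auto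
    show "N - d \<le> 1 / N"
      unfolding r using d0 dN assms by (intro divide_left_mono) auto
    show "N / d * (N - (N - d)) = N" "1 \<le> N / d" "N / d \<le> 2"
      using d0 dN dh by (auto simp: field_simps)
  qed (use assms dN in auto)
  then show ?thesis by blast
qed

text \<open>\<open>P\<close>, and hence \<open>lam\<close> and \<open>K\<close>, do not depend on N,
  which makes the resulting constants absolute. \<open>N1\<close> yields
  \<open>2 * E * exp lam \<le> 1\<close>, the smallness needed for the fixed point.\<close>

lemma swirl_solution:
  assumes "0 < P" and P: "\<And>m::nat. (3 + (real m)\<^sup>2) ^ 5 * (real m + 1) * (1/2) ^ m \<le> P"
  defines "lam \<equiv> (2 * Cadv * (P + 1))\<^sup>2"
  defines "K \<equiv> 80 * Cadv * (P + 1) * P * exp lam"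
  assumes N3: "3 \<le> N" and N1: "40 * P * exp lam \<le> N" and N2: "96 * K * exp 12 \<le> N"
  shows "\<exists>u. mild_solution 1 (u_in N) u \<and>
     (\<forall>t. 0 \<le> t \<and> t \<le> 1 / N\<^sup>2 \<longrightarrow>
       ereal (exp (- 12) / 96 * (t\<^sup>2 / N\<^sup>2)) \<le> Linf_norm torus (\<lambda>x. u t x $ 3) \<and>
       Linf_norm torus (\<lambda>x. u t x $ 3) \<le> ereal (40 * P * exp lam * (\<Sum>\<^sub>\<infinity>k. wt k) * (t\<^sup>2 / N\<^sup>2)))"
proof -
  obtain r c where "swirl N r c"
    using swirl_exists[OF N3] by blast
  then interpret swirl N r c .
  define E where "E = 20 * P / N\<^sup>2"
  have NN: "N \<le> N\<^sup>2"
    using N3 by (simp add: power2_eq_square)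
  have lam0: "0 < lam"
    using Cadv_pos \<open>0 < P\<close> by (simp add: lam_def)
  have v_le: "norm (v t k) \<le> P * wt k" if "0 \<le> t" for t k
  proof -
    have "- t * freq_norm_sq k \<le> 0"
      using that by (simp add: mult_nonneg_nonneg)
    then have "exp (- t * freq_norm_sq k) * norm (data k) \<le> 1 * norm (data k)"
      by (intro mult_right_mono) auto
    then show ?thesis
      using norm_data_le[OF P, of k] by (simp add: v_def heat_def)
  qed
  interpret ns: perturbed_heat_flow v P E lam
  proof
    show "continuous_on {0..1} (\<lambda>t. v t k)" for k
      unfolding v_def heat_def by (intro continuous_intros)
    show "norm (v t k) \<le> P * wt k" if "0 \<le> t" "t \<le> 1" for t k
      by (rule v_le[OF that(1)])
    show "hermitian (v t)" if "0 \<le> t" "t \<le> 1" for t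
      using hermitian_data by (simp add: hermitian_def v_nth)
    show "norm (adv (v s) (v s) k) \<le> E * wt k * s" if "0 \<le> s" "s \<le> 1" for s k
      unfolding E_def by (rule forcing_le[OF P that(1)])
    show "2 * Cadv * (P + 1) \<le> sqrt lam"
      using Cadv_pos \<open>0 < P\<close> by (simp add: lam_def)
    have "40 * P * exp lam \<le> N\<^sup>2"
      using N1 NN by linarith
    then show "2 * E * exp lam \<le> 1"
      using N3 by (simp add: E_def field_simps)
  qed (use \<open>0 < P\<close> lam0 in \<open>auto simp: E_def\<close>)
  have v0: "v 0 = data"
    by (simp add: v_def heat_def fun_eq_iff)
  define u where "u t = real_field (\<lambda>k. v t k + ns.sol t k)" for t
  have "mild_solution 1 (u_in N) u"
    unfolding u_def[abs_def]
    by (rule ns.mild_solution_real_field) (simp_all add: v0 real_field_data, simp add: v_def)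
  moreover have "ereal (exp (- 12) / 96 * (t\<^sup>2 / N\<^sup>2)) \<le> Linf_norm torus (\<lambda>x. u t x $ 3) \<and>
       Linf_norm torus (\<lambda>x. u t x $ 3) \<le> ereal (40 * P * exp lam * (\<Sum>\<^sub>\<infinity>k. wt k) * (t\<^sup>2 / N\<^sup>2))"
    if t: "0 \<le> t" "t \<le> 1 / N\<^sup>2" for t
  proof -
    have "1 / N\<^sup>2 \<le> 1"
      using N3 NN by simp
    then have t1: "t \<le> 1" using t by linarith
    have sqt: "sqrt t \<le> 1 / N"
      using real_sqrt_le_mono[OF t(2)] N3 by (simp add: real_sqrt_divide)
    have \<phi>: "ns.\<phi> t \<le> t\<^sup>2 * exp lam"
      unfolding ns.\<phi>_def using t(1) t1 lam0 by (intro mult_left_mono) (auto simp: mult_left_le)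
    have herm: "hermitian (\<lambda>k. v t k + ns.sol t k)"
      using ns.v_herm[OF t(1) t1] ns.hermitian_sol[OF t(1) t1] by (simp add: hermitian_def)
    have bd: "norm (v t k + ns.sol t k) \<le> (P + 1) * wt k" for k
      by (rule ns.small_sum_bound[OF ns.small_sol t(1) t1])
    have [measurable]: "(\<lambda>x. u t x $ 3) \<in> borel_measurable torus"
      unfolding u_def by (rule borel_measurable_real_field)
    have v3: "v t k $ 3 = 0" for k
      by (simp add: v_nth data_nth)
    have coeff: "fourier_coeff (\<lambda>x. u t x $ 3) k = ns.sol t k $ 3" for k
      unfolding u_def fourier_coeff_real_field[OF herm bd] by (simp add: v3)
    have "exp (- 12) / (48 * N\<^sup>2) * t\<^sup>2 \<le> norm (duhamel (\<lambda>s. adv (v s) (v s)) t k0 $ 3)"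
    proof (rule duhamel_lower_bound[OF _ t(1) t1])
      show "continuous_on {0..t} (\<lambda>s. adv (v s) (v s) k0)"
        using ns.continuous_on_nonlin[OF ns.small_zero t1, of k0] by (simp add: ns.nonlin_def)
    qed
    also have "\<dots> \<le> norm (ns.sol t k0 $ 3) + norm ((ns.sol t k0 + duhamel (\<lambda>s. adv (v s) (v s)) t k0) $ 3)"
      using norm_triangle_ineq4[of "(ns.sol t k0 + duhamel (\<lambda>s. adv (v s) (v s)) t k0) $ 3" "ns.sol t k0 $ 3"]
      by simp
    \<comment> \<open>Since sqrt t \<le> 1 / N, the correction is at most K / N times t^2 / N^2,
      with 80 = 4 * 20 in \<open>K\<close>; \<open>N2\<close> makes this half of what
      \<open>duhamel_lower_bound\<close> provides.\<close>
    also have "norm ((ns.sol t k0 + duhamel (\<lambda>s. adv (v s) (v s)) t k0) $ 3) \<le> exp (- 12) / (96 * N\<^sup>2) * t\<^sup>2"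
    proof -
      have "norm ((ns.sol t k0 + duhamel (\<lambda>s. adv (v s) (v s)) t k0) $ 3)
          \<le> norm (ns.sol t k0 + duhamel (\<lambda>s. adv (v s) (v s)) t k0)"
        by (rule Finite_Cartesian_Product.norm_nth_le)
      also have "\<dots> \<le> 4 * Cadv * (P + 1) * E * ns.\<phi> t * wt k0 * sqrt t"
        by (rule ns.sol_first_order[OF t(1) t1])
      also have "\<dots> \<le> 4 * Cadv * (P + 1) * E * (t\<^sup>2 * exp lam) * 1 * (1 / N)"
        using Cadv_pos \<open>0 < P\<close> \<phi> sqt t(1) N3
        by (intro mult_mono mult_left_mono) (auto simp: E_def wt_def freq_norm_sq_k0)
      also have "\<dots> = K / N * (t\<^sup>2 / N\<^sup>2)"
        by (simp add: K_def E_def mult_ac)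
      also have "\<dots> \<le> exp (- 12) / 96 * (t\<^sup>2 / N\<^sup>2)"
      proof (rule mult_right_mono)
        show "K / N \<le> exp (- 12) / 96"
          using N2 N3 by (simp add: exp_minus field_simps)
      qed simp
      finally show ?thesis by simp
    qed
    finally have "exp (- 12) / 96 * (t\<^sup>2 / N\<^sup>2) \<le> norm (fourier_coeff (\<lambda>x. u t x $ 3) k0)"
      by (simp add: coeff field_simps)
    then have "ereal (exp (- 12) / 96 * (t\<^sup>2 / N\<^sup>2)) \<le> ereal (norm (fourier_coeff (\<lambda>x. u t x $ 3) k0))"
      by (simp only: ereal_less_eq)
    also have "\<dots> \<le> Linf_norm torus (\<lambda>x. u t x $ 3)"
      by (rule norm_fourier_coeff_le_Linf_norm) measurable
    finally have lower: "ereal (exp (- 12) / 96 * (t\<^sup>2 / N\<^sup>2)) \<le> Linf_norm torus (\<lambda>x. u t x $ 3)" .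
    have u3: "u t x $ 3 = real_field (ns.sol t) x $ 3" for x
      by (simp add: u_def real_field_def v3)
    have "\<bar>u t x $ 3\<bar> \<le> 40 * P * exp lam * (\<Sum>\<^sub>\<infinity>k. wt k) * (t\<^sup>2 / N\<^sup>2)" for x
    proof -
      have "\<bar>u t x $ 3\<bar> \<le> 2 * E * ns.\<phi> t * (\<Sum>\<^sub>\<infinity>k. wt k)"
        unfolding u3 by (rule real_field_norm_le[OF ns.sol_bound[OF t(1) t1]])
      also have "\<dots> \<le> 2 * E * (t\<^sup>2 * exp lam) * (\<Sum>\<^sub>\<infinity>k. wt k)"
        using \<phi> \<open>0 < P\<close> by (intro mult_right_mono mult_left_mono infsum_nonneg) (auto simp: E_def)
      finally show ?thesis
        by (simp add: E_def mult_ac)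
    qed
    then have "Linf_norm torus (\<lambda>x. u t x $ 3) \<le> ereal (40 * P * exp lam * (\<Sum>\<^sub>\<infinity>k. wt k) * (t\<^sup>2 / N\<^sup>2))"
      unfolding Linf_norm_def by (intro esssup_I) auto
    with lower show ?thesis ..
  qed
  ultimately show ?thesis by blast
qed

theorem theorem2:
  shows "(\<forall>N::real. N > 1 \<longrightarrow> favorable_initial_pressure_gradient (u_in N)) \<and>
    (\<exists>N0 C1 C2 :: real. N0 > 0 \<and> C1 > 0 \<and> C2 > 0 \<and>
      (\<forall>N::real. N > 1 \<and> N > N0 \<longrightarrow>
        (\<exists>u. mild_solution 1 (u_in N) u \<and>
          (\<forall>v. mild_solution 1 (u_in N) v \<longrightarrow> (\<forall>t\<in>{0..1}. AE x in torus. v t x = u t x)) \<and>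
          (\<forall>t. 0 \<le> t \<and> t \<le> 1 / N\<^sup>2 \<longrightarrow>
             ereal (C1 * (t\<^sup>2 / N\<^sup>2)) \<le> Linf_norm torus (\<lambda>x. u t x $ 3) \<and>
             Linf_norm torus (\<lambda>x. u t x $ 3) \<le> ereal (C2 * (t\<^sup>2 / N\<^sup>2))))))"
proof (rule conjI)
  show "\<forall>N::real. N > 1 \<longrightarrow> favorable_initial_pressure_gradient (u_in N)"
    using favorable_u_in by blast
next
  obtain P :: real where P: "0 < P" "\<And>m::nat. (3 + (real m)\<^sup>2) ^ 5 * (real m + 1) * (1/2) ^ m \<le> P"
    using polynomial_geometric_bound by blast
  define lam where "lam = (2 * Cadv * (P + 1))\<^sup>2"
  define K where "K = 80 * Cadv * (P + 1) * P * exp lam"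
  define N0 where "N0 = max 3 (max (40 * P * exp lam) (96 * K * exp 12))"
  define C1 :: real where "C1 = exp (- 12) / 96"
  define C2 where "C2 = 40 * P * exp lam * (\<Sum>\<^sub>\<infinity>k. wt k)"
  have "0 < N0" "0 < C1"
    by (auto simp: N0_def C1_def)
  \<comment> \<open>\<open>Kw\<close> is 256 times the sum of the weights, so its positivity gives
    that of the sum.\<close>
  moreover have "0 < C2"
    using P(1) Kw_pos by (simp add: C2_def Kw_def)
  moreover have "\<exists>u. mild_solution 1 (u_in N) u \<and>
      (\<forall>v. mild_solution 1 (u_in N) v \<longrightarrow> (\<forall>t\<in>{0..1}. AE x in torus. v t x = u t x)) \<and>
      (\<forall>t. 0 \<le> t \<and> t \<le> 1 / N\<^sup>2 \<longrightarrow>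
         ereal (C1 * (t\<^sup>2 / N\<^sup>2)) \<le> Linf_norm torus (\<lambda>x. u t x $ 3) \<and>
         Linf_norm torus (\<lambda>x. u t x $ 3) \<le> ereal (C2 * (t\<^sup>2 / N\<^sup>2)))"
    if "N > 1 \<and> N > N0" for N
  proof -
    have N: "3 \<le> N" "40 * P * exp lam \<le> N" "96 * K * exp 12 \<le> N"
      using that by (auto simp: N0_def)
    obtain u where u: "mild_solution 1 (u_in N) u" and
      est: "\<forall>t. 0 \<le> t \<and> t \<le> 1 / N\<^sup>2 \<longrightarrow>
         ereal (C1 * (t\<^sup>2 / N\<^sup>2)) \<le> Linf_norm torus (\<lambda>x. u t x $ 3) \<and>
         Linf_norm torus (\<lambda>x. u t x $ 3) \<le> ereal (C2 * (t\<^sup>2 / N\<^sup>2))"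
      using swirl_solution[OF P N[unfolded K_def lam_def]] unfolding C1_def C2_def lam_def by blast
    have "\<forall>v. mild_solution 1 (u_in N) v \<longrightarrow> (\<forall>t\<in>{0..1}. AE x in torus. v t x = u t x)"
      using mild_solution_unique[OF u] by auto
    then show ?thesis
      using u est by blast
  qed
  ultimately show "\<exists>N0 C1 C2 :: real. N0 > 0 \<and> C1 > 0 \<and> C2 > 0 \<and>
      (\<forall>N::real. N > 1 \<and> N > N0 \<longrightarrow>
        (\<exists>u. mild_solution 1 (u_in N) u \<and>
          (\<forall>v. mild_solution 1 (u_in N) v \<longrightarrow> (\<forall>t\<in>{0..1}. AE x in torus. v t x = u t x)) \<and>
          (\<forall>t. 0 \<le> t \<and> t \<le> 1 / N\<^sup>2 \<longrightarrow>
             ereal (C1 * (t\<^sup>2 / N\<^sup>2)) \<le> Linf_norm torus (\<lambda>x. u t x $ 3) \<and>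
             Linf_norm torus (\<lambda>x. u t x $ 3) \<le> ereal (C2 * (t\<^sup>2 / N\<^sup>2)))))"
    by blast
qed

end
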